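(* Let $\mu\in\mathcal V$ and let $\overline\mu\in\overline{\mathcal V}$ be an extension of $\mu$ to $\overline K[x]$. Let $\mathcal B^{\mathrm{opt}}=\mathcal B^{\mathrm{opt}}(\overline\mu)$ and let $1=m_0<m_1<\cdots<m_n<\cdots$ be the (finite or infinite) sequence of degrees over $K$ of all balls in $\mathcal B^{\mathrm{opt}}$. Let $\mathcal B^{\mathrm{opt}}_{m_n}\subseteq\mathcal B^{\mathrm{opt}}$ be the subset of balls $B$ with $\deg_K B=m_n$. For each $n\in\mathbb N_0$ with $\mathcal B^{\mathrm{opt}}_{m_n}\neq\emptyset$, take a well-ordered cofinal family $\mathcal B_{m_n}\subseteq\mathcal B^{\mathrm{opt}}_{m_n}$ with respect to descending inclusion, such that $\mathcal B_{m_n}=\{B\}$ whenever $\mathcal B^{\mathrm{opt}}_{m_n}$ has a last (smallest) ball $B$. Let $B_n:=\min(\mathcal B_{m_n})$ be the first (largest) ball of $\mathcal B_{m_n}$ and $\mu_n:=\mu_{B_n}$. Then the chain $$\mu_0<\mu_1<\cdots<\mu_n<\cdots$$ is a Mac Lane–Vaquié chain of $\mu$.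
   Context: $(K,v)$ is a valued field, $\overline K$ an algebraic closure of $K$, and $v$ also denotes a fixed extension of $v$ to $\overline K$. Put $\Gamma=v\overline K$ and fix an embedding $\Gamma\hookrightarrow\Lambda$ into a divisible (totally) ordered abelian group $\Lambda$. $\mathcal V$ is the set of all $\Lambda$-valued valuations on $K(x)$ whose restriction to $K$ is $v$, identified with valuations $\mu:K[x]\to\Lambda\cup\{\infty\}$ with $\mu^{-1}(\infty)=\{0\}$ and $\mu_{\mid K}=v$; $\overline{\mathcal V}$ is the set of $\Lambda$-valued valuations on $\overline K(x)$ whose restriction to $\overline K$ is $v$. Both are partially ordered by $\mu\le\eta$ iff $\mu(f)\le\eta(f)$ for all polynomials $f$. An extension of $\mu\in\mathcal V$ is $\overline\mu\in\overline{\mathcal V}$ with $\overline\mu_{\mid K[x]}=\mu$. Balls. For $(a,\delta)\in\overline K\times\Lambda$: $B(a,\delta)=\{b\in\overline K\mid v(b-a)\ge\delta\}$, and $v_{a,\delta}\in\overline{\mathcal V}$ is given by $v_{a,\delta}\left(\sum_k a_k(x-a)^k\right)=\min_k\{v(a_k)+k\delta\}$. $\mathbb B$ is the set of all such balls $B(a,\delta)$. For $c\in\overline K$, $p_K(c)\in K[x]$ is its minimal polynomial over $K$ and $\deg_K c=\deg p_K(c)$. For $S\subseteq\overline K$: $\deg_K S=\min\{\deg_K c\mid c\in S\}$, $\operatorname{Min}_K S=\{c\in S\mid\deg_K c=\deg_K S\}$. Types of valuations. $\mu\in\mathcal V$ (value group $\Gamma_\mu$, residue field $k_\mu$) is valuation-transcendental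 if $\Gamma_\mu/vK$ is not torsion or $k_\mu$ is transcendental over the residue field $Kv$; otherwise it is valuation-algebraic. A family $\mathcal C=\{\mu_i\}_{i\in I}$ is increasing if $I$ is totally ordered and $\mu_i<\mu_j$ for $i<j$. A polynomial $f$ is $\mathcal C$-stable if $\mu_i(f)$ is constant for all sufficiently large $i$, and $\mathcal C$-unstable otherwise. If all polynomials are $\mathcal C$-stable, the stable limit $\lim(\mathcal C)$ is the valuation sending $f$ to the eventually constant value $\mu_i(f)$. $\operatorname{KP}_\infty(\mathcal C)$ is the set of monic $\mathcal C$-unstable polynomials of smallest degree among $\mathcal C$-unstable polynomials. Optimal balls. If $\mu$ is valuation-transcendental, then $\overline\mu=v_{a,\delta}$ for some $(a,\delta)$, and $\mathcal B(\overline\mu)=\{B\in\mathbb B\mid B\supseteq B(a,\delta)\}$. If $\mu$ is valuation-algebraic, then $\overline\mu$ is the stable limit of an increasing family $\{\overline\mu_i=v_{a_i,\delta_i}\}_{i\in I}$ in $\overline{\mathcal V}$ extending an increasing family $\{\mu_i\}_{i\in I}$ in $\mathcal V$ with stable limit $\mu$; fix such a family and let $\mathcal B(\overline\mu)=\{B\in\mathbb B\mid B\supseteq B(a_i,\delta_i)\text{ for some }i\in I\}$. For non-constant $f\in K[x]$ let $\epsilon_\mu(f)=\max\{(\mu(f)-\mu(\partial_s f))/s\mid s\ge1,\ \partial_sf\neq0\}$, where the Hasse–Schmidt derivatives $\partial_s$ are defined by $f(x+y)=\sum_{s\ge0}(\partial_s f)y^s$. A ball $B=B(b,\gamma)\in\mathcal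 B(\overline\mu)$ is $\mu$-optimal if there is $c\in\operatorname{Min}_K B$ with $\epsilon_\mu(p_K(c))=\gamma$ (as a set, $B$ is $\mu$-optimal if it has a presentation $B(b,\gamma)$ with this property, and $\gamma$ is then taken as its radius). $\mathcal B^{\mathrm{opt}}(\overline\mu)$ is the set of $\mu$-optimal balls in $\mathcal B(\overline\mu)$, and for $B=B(b,\gamma)$ in it, $\mu_B:=(v_{b,\gamma})_{\mid K[x]}$. Key polynomials. $\mathcal G_\mu=\bigoplus_{\alpha\in\Gamma_\mu}\mathcal P_\alpha/\mathcal P_\alpha^+$ with $\mathcal P_\alpha=\{f\mid\mu(f)\ge\alpha\}$, $\mathcal P_\alpha^+=\{f\mid\mu(f)>\alpha\}$; for $f\neq0$, $\operatorname{in}_\mu f$ is the image of $f$ in $\mathcal P_{\mu(f)}/\mathcal P_{\mu(f)}^+$. A monic $\phi\in K[x]$ is a key polynomial for $\mu$ if $(\operatorname{in}_\mu\phi)\mathcal G_\mu$ is a homogeneous prime ideal containing no $\operatorname{in}_\mu f$ with $f\ne0$, $\deg f<\deg\phi$; $\operatorname{KP}(\mu)$ is the set of these. For valuation-transcendental $\mu$ (then $\operatorname{KP}(\mu)\neq\emptyset$), $\deg(\mu)$ is the smallest degree of a key polynomial for $\mu$. For valuation-algebraic $\mu=\lim\{\mu_i\}$ (with $\mu_i$ valuation-transcendental), $\deg(\mu)=\max_i\deg(\mu_i)$, or $\infty$ if these degrees are unbounded. For $\mu<\eta$, $\mathbf t(\mu,\eta)$ is the set of monic $\phi\in K[x]$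 of smallest degree with $\mu(\phi)<\eta(\phi)$. Augmentations. Given $\phi\in\operatorname{KP}(\mu)$ and $\gamma\in\Lambda$, $\gamma>\mu(\phi)$, the ordinary augmentation $[\mu;\phi,\gamma]$ sends $\sum_i f_i\phi^i$ ($\deg f_i<\deg\phi$) to $\min_i\{\mu(f_i)+i\gamma\}$. Given an increasing family $\mathcal C=\{\rho_i\}_{i\in I}$, $\phi\in\operatorname{KP}_\infty(\mathcal C)$ and $\gamma\in\Lambda$ with $\gamma>\rho_i(\phi)$ for all $i$, the limit augmentation $[\mathcal C;\phi,\gamma]$ sends $\sum_j f_j\phi^j$ ($\deg f_j<\deg\phi$) to $\min_j\{\rho_{\mathcal C}(f_j)+j\gamma\}$, where $\rho_{\mathcal C}(f_j)$ is the stable value of $\rho_i(f_j)$. Mac Lane–Vaquié chain of $\mu$: a finite or countably infinite totally ordered sequence $\mu_0<\mu_1<\cdots<\mu_n<\cdots\le\mu$ in $\mathcal V$ such that: (MLV1) $1=\deg(\mu_0)<\deg(\mu_1)<\cdots<\deg(\mu_n)<\cdots$. (MLV2) Each step $\mu_{n-1}<\mu_n$ is either an ordinary augmentation $\mu_n=[\mu_{n-1};\phi_n,\gamma_n]$ with $\phi_n\in\operatorname{KP}(\mu_{n-1})$, $\gamma_n\in\Lambda$, $\gamma_n>\mu_{n-1}(\phi_n)$; or a limit augmentation $\mu_n=[\mathcal C_{n-1};\phi_n,\gamma_n]$, where $\mathcal C_{n-1}=\{\rho_i\}_{i\in I_{n-1}}$ is a well-ordered increasing family of valuations of constant degree with $\mu_{n-1}=\min(\mathcal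 C_{n-1})$, $\phi_n\in\operatorname{KP}_\infty(\mathcal C_{n-1})$, $\gamma_n\in\Lambda$, $\gamma_n>\rho_i(\phi_n)$ for all $i$. (MLV3) $\phi_n\notin\mathbf t(\mu_n,\mu)$ for all $\mu_n<\mu$ (for those $n\ge1$ for which $\phi_n$ is defined). (MLV4) If $\mu$ is valuation-transcendental, the sequence is finite with last valuation $\mu$. If $\mu$ is valuation-algebraic of finite degree, the sequence has a last valuation $\mu_{r-1}$ and there is a well-ordered increasing family $\mathcal C_{r-1}$ of valuations of constant degree with $\mu_{r-1}=\min(\mathcal C_{r-1})$ and $\mu=\lim(\mathcal C_{r-1})$. If $\mu$ is valuation-algebraic of infinite degree, the sequence is infinite and $\mu$ is its stable limit. *)

theory Defs
  imports
    "HOL-Algebra.Algebraic_Closure_Type"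
    "HOL-Computational_Algebra.Computational_Algebra"
    "HOL-Library.Extended"
    "HOL-Library.Extended_Nat"
    "HOL-Library.Poly_Mapping"
begin

text \<open>
  Conventions. The field \<open>K\<close> is a type \<open>'k\<close>, its algebraic closure a type \<open>'l\<close> together with an
  embedding \<open>\<iota> :: 'k \<Rightarrow> 'l\<close>, and \<open>\<Lambda>\<close> is a type \<open>'v\<close>; valuations take values in \<open>'v extended\<close>, where
  \<open>Pinf\<close> is the value \<open>\<infinity>\<close> and \<open>Minf\<close> is excluded. The order on valuations is the pointwise order of
  the function type. A family that is strictly increasing in a totally ordered index set is
  order isomorphic to its image, so such families are represented by sets of valuations.
\<close>

definition nmul :: "nat \<Rightarrow> 'v::comm_monoid_add \<Rightarrow> 'v" where
  "nmul n x = (\<Sum>i<n. x)"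

definition fin_val :: "'v extended \<Rightarrow> 'v" where
  "fin_val t = (THE \<alpha>. t = Fin \<alpha>)"

definition divisible_group :: "'v::ab_group_add itself \<Rightarrow> bool" where
  "divisible_group T \<longleftrightarrow> (\<forall>n>0. \<forall>x::'v. \<exists>y. nmul n y = x)"

definition algebraic_closure_embedding :: "('k::field \<Rightarrow> 'l::alg_closed_field) \<Rightarrow> bool" where
  "algebraic_closure_embedding \<iota> \<longleftrightarrow>
     (\<forall>x y. \<iota> (x + y) = \<iota> x + \<iota> y) \<and> (\<forall>x y. \<iota> (x * y) = \<iota> x * \<iota> y) \<and> \<iota> 1 = 1 \<and>
     (\<forall>c. \<exists>p. p \<noteq> 0 \<and> poly (map_poly \<iota> p) c = 0)"


section \<open>Valuations\<close>

definition valuation :: "('r::comm_ring_1 \<Rightarrow> 'v::linordered_ab_group_add extended) \<Rightarrow> bool" where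
  "valuation w \<longleftrightarrow>
     (\<forall>x. w x \<noteq> Minf) \<and> (\<forall>x. w x = Pinf \<longleftrightarrow> x = 0) \<and>
     (\<forall>x y. w (x * y) = w x + w y) \<and> (\<forall>x y. min (w x) (w y) \<le> w (x + y))"

text \<open>The sets \<open>\<V>\<close> (for \<open>K\<close>) and its analogue over the algebraic closure.\<close>
definition poly_exts :: "('f::field \<Rightarrow> 'v::linordered_ab_group_add extended) \<Rightarrow> ('f poly \<Rightarrow> 'v extended) set" where
  "poly_exts v = {\<mu>. valuation \<mu> \<and> (\<forall>a. \<mu> [:a:] = v a)}"

definition restr :: "('k::field \<Rightarrow> 'l::field) \<Rightarrow> ('l poly \<Rightarrow> 'v extended) \<Rightarrow> 'k poly \<Rightarrow> 'v extended" where
  "restr \<iota> \<eta> f = \<eta> (map_poly \<iota> f)"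

text \<open>The valuation on \<open>K(x)\<close> corresponding to \<open>\<mu>\<close>, \<open>f/g \<mapsto> \<mu>(f) - \<mu>(g)\<close>.\<close>
definition frac_val ::
  "('f::field poly \<Rightarrow> 'v::linordered_ab_group_add extended) \<Rightarrow> 'f poly fract \<Rightarrow> 'v extended" where
  "frac_val \<mu> z = (THE t. \<exists>f g. g \<noteq> 0 \<and> z = Fract f g \<and> t = \<mu> f - \<mu> g)"

definition value_group ::
  "('f::field poly \<Rightarrow> 'v::linordered_ab_group_add extended) \<Rightarrow> 'v set" where
  "value_group \<mu> = {\<alpha>. \<exists>z. z \<noteq> 0 \<and> frac_val \<mu> z = Fin \<alpha>}"

text \<open>\<open>vK\<close>, recovered from \<open>\<mu>\<close> restricted to the constants.\<close>
definition base_value_group ::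
  "('f::field poly \<Rightarrow> 'v::linordered_ab_group_add extended) \<Rightarrow> 'v set" where
  "base_value_group \<mu> = {\<alpha>. \<exists>a. a \<noteq> 0 \<and> \<mu> [:a:] = Fin \<alpha>}"

definition val_ring ::
  "('f::field poly \<Rightarrow> 'v::linordered_ab_group_add extended) \<Rightarrow> 'f poly fract ring" where
  "val_ring \<mu> = ring_of_type_algebra \<lparr>carrier := {z. 0 \<le> frac_val \<mu> z}\<rparr>"

definition val_max_ideal ::
  "('f::field poly \<Rightarrow> 'v::linordered_ab_group_add extended) \<Rightarrow> 'f poly fract set" where
  "val_max_ideal \<mu> = {z. 0 < frac_val \<mu> z}"

definition residue_field ::
  "('f::field poly \<Rightarrow> 'v::linordered_ab_group_add extended) \<Rightarrow> 'f poly fract set ring" where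
  "residue_field \<mu> = val_ring \<mu> Quot val_max_ideal \<mu>"

text \<open>The image of \<open>Kv\<close> in the residue field of \<open>\<mu>\<close>.\<close>
definition base_residue_field ::
  "('f::field poly \<Rightarrow> 'v::linordered_ab_group_add extended) \<Rightarrow> 'f poly fract set set" where
  "base_residue_field \<mu> =
     {val_max_ideal \<mu> +>\<^bsub>val_ring \<mu>\<^esub> Fract [:a:] 1 | a. 0 \<le> \<mu> [:a:]}"

definition valuation_transcendental ::
  "('f::field poly \<Rightarrow> 'v::linordered_ab_group_add extended) \<Rightarrow> bool" where
  "valuation_transcendental \<mu> \<longleftrightarrow>
     (\<exists>\<alpha>\<in>value_group \<mu>. \<forall>n>0. nmul n \<alpha> \<notin> base_value_group \<mu>) \<or>
     (\<exists>\<xi>\<in>carrier (residue_field \<mu>).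
        ring.transcendental (residue_field \<mu>) (base_residue_field \<mu>) \<xi>)"


section \<open>Increasing families\<close>

definition increasing_family ::
  "('f::field \<Rightarrow> 'v::linordered_ab_group_add extended) \<Rightarrow> ('f poly \<Rightarrow> 'v extended) set \<Rightarrow> bool" where
  "increasing_family v C \<longleftrightarrow> C \<noteq> {} \<and> C \<subseteq> poly_exts v \<and> Complete_Partial_Order.chain (\<le>) C"

definition stable ::
  "('f::field poly \<Rightarrow> 'v::linordered_ab_group_add extended) set \<Rightarrow> 'f poly \<Rightarrow> bool" where
  "stable C f \<longleftrightarrow> (\<exists>\<rho>\<in>C. \<forall>\<sigma>\<in>C. \<rho> \<le> \<sigma> \<longrightarrow> \<sigma> f = \<rho> f)"

definition stable_value ::
  "('f::field poly \<Rightarrow> 'v::linordered_ab_group_add extended) set \<Rightarrow> 'f poly \<Rightarrow> 'v extended" where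
  "stable_value C f = (THE t. \<exists>\<rho>\<in>C. \<forall>\<sigma>\<in>C. \<rho> \<le> \<sigma> \<longrightarrow> \<sigma> f = t)"

definition is_stable_limit ::
  "('f::field poly \<Rightarrow> 'v::linordered_ab_group_add extended) \<Rightarrow> ('f poly \<Rightarrow> 'v extended) set \<Rightarrow> bool" where
  "is_stable_limit \<mu> C \<longleftrightarrow> (\<forall>f. stable C f) \<and> \<mu> = stable_value C"

definition KP_inf ::
  "('f::field poly \<Rightarrow> 'v::linordered_ab_group_add extended) set \<Rightarrow> 'f poly set" where
  "KP_inf C = {\<phi>. lead_coeff \<phi> = 1 \<and> \<not> stable C \<phi> \<and> (\<forall>f. \<not> stable C f \<longrightarrow> degree \<phi> \<le> degree f)}"


section \<open>Balls and the degree over the base field\<close>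

definition vball :: "('l::field \<Rightarrow> 'v::linordered_ab_group_add extended) \<Rightarrow> 'l \<Rightarrow> 'v \<Rightarrow> 'l set" where
  "vball w a \<delta> = {b. Fin \<delta> \<le> w (b - a)}"

text \<open>The valuation \<open>v\<^sub>a\<^sub>,\<^sub>\<delta>\<close>: the coefficients of \<open>f(x + a)\<close> are those of the expansion of \<open>f\<close> in
  powers of \<open>x - a\<close>.\<close>
definition ball_val ::
  "('l::field \<Rightarrow> 'v::linordered_ab_group_add extended) \<Rightarrow> 'l \<Rightarrow> 'v \<Rightarrow> 'l poly \<Rightarrow> 'v extended" where
  "ball_val w a \<delta> f =
     Min ((\<lambda>k. w (coeff (pcompose f [:a, 1:]) k) + Fin (nmul k \<delta>)) ` {..degree f})"

definition min_polynomial :: "('k::field \<Rightarrow> 'l::field) \<Rightarrow> 'l \<Rightarrow> 'k poly" where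
  "min_polynomial \<iota> c = (THE p. lead_coeff p = 1 \<and> poly (map_poly \<iota> p) c = 0 \<and>
     (\<forall>q. q \<noteq> 0 \<and> poly (map_poly \<iota> q) c = 0 \<longrightarrow> degree p \<le> degree q))"

definition deg_elt :: "('k::field \<Rightarrow> 'l::field) \<Rightarrow> 'l \<Rightarrow> nat" where
  "deg_elt \<iota> c = degree (min_polynomial \<iota> c)"

definition deg_set :: "('k::field \<Rightarrow> 'l::field) \<Rightarrow> 'l set \<Rightarrow> nat" where
  "deg_set \<iota> S = (LEAST n. \<exists>c\<in>S. n = deg_elt \<iota> c)"

definition Min_deg :: "('k::field \<Rightarrow> 'l::field) \<Rightarrow> 'l set \<Rightarrow> 'l set" where
  "Min_deg \<iota> S = {c \<in> S. deg_elt \<iota> c = deg_set \<iota> S}"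


section \<open>Optimal balls\<close>

text \<open>The Hasse--Schmidt derivative is the coefficient of \<open>y^s\<close> in \<open>f(x + y)\<close>, regarded as a
  polynomial in \<open>y\<close> over \<open>K[x]\<close>.\<close>
definition hasse :: "nat \<Rightarrow> 'f::field poly \<Rightarrow> 'f poly" where
  "hasse s f = coeff (pcompose (map_poly (\<lambda>a. [:a:]) f) [:[:0, 1:], 1:]) s"

text \<open>Division by \<open>s\<close> in the divisible ordered group is expressed by \<open>nmul s t = \<dots>\<close>, which has a
  unique solution \<open>t\<close>.\<close>
definition eps :: "('f::field poly \<Rightarrow> 'v::linordered_ab_group_add extended) \<Rightarrow> 'f poly \<Rightarrow> 'v" where
  "eps \<mu> f =
     Max {t. \<exists>s\<ge>1. hasse s f \<noteq> 0 \<and> nmul s t = fin_val (\<mu> f) - fin_val (\<mu> (hasse s f))}"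

text \<open>The increasing families of ball valuations that may be fixed in order to define the balls of a
  valuation-algebraic \<open>\<mu>\<close>.\<close>
definition ball_family ::
  "('l::alg_closed_field \<Rightarrow> 'v::linordered_ab_group_add extended) \<Rightarrow> ('k::field \<Rightarrow> 'l) \<Rightarrow>
   ('k poly \<Rightarrow> 'v extended) \<Rightarrow> ('l poly \<Rightarrow> 'v extended) \<Rightarrow> ('l poly \<Rightarrow> 'v extended) set \<Rightarrow> bool" where
  "ball_family w \<iota> \<mu> \<mu>' D \<longleftrightarrow>
     increasing_family w D \<and> (\<forall>\<rho>\<in>D. \<exists>a \<delta>. \<rho> = ball_val w a \<delta>) \<and> is_stable_limit \<mu>' D \<and>
     increasing_family (w \<circ> \<iota>) (restr \<iota> ` D) \<and>
     (\<forall>\<rho>\<in>D. \<forall>\<sigma>\<in>D. \<rho> < \<sigma> \<longrightarrow> restr \<iota> \<rho> < restr \<iota> \<sigma>) \<and> is_stable_limit \<mu> (restr \<iota> ` D)"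

text \<open>\<open>\<B>(\<mu>')\<close>; the fixed family \<open>D\<close> is used only if \<open>\<mu>\<close> is valuation-algebraic.\<close>
definition nest ::
  "('l::alg_closed_field \<Rightarrow> 'v::linordered_ab_group_add extended) \<Rightarrow>
   ('k::field poly \<Rightarrow> 'v extended) \<Rightarrow> ('l poly \<Rightarrow> 'v extended) \<Rightarrow> ('l poly \<Rightarrow> 'v extended) set \<Rightarrow>
   'l set set" where
  "nest w \<mu> \<mu>' D =
     {B. (\<exists>b \<gamma>. B = vball w b \<gamma>) \<and>
         (\<exists>a \<delta>. ball_val w a \<delta> \<in> (if valuation_transcendental \<mu> then {\<mu>'} else D) \<and> vball w a \<delta> \<subseteq> B)}"

definition optimal_presentation ::
  "('l::alg_closed_field \<Rightarrow> 'v::linordered_ab_group_add extended) \<Rightarrow> ('k::field \<Rightarrow> 'l) \<Rightarrow>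
   ('k poly \<Rightarrow> 'v extended) \<Rightarrow> 'l set \<Rightarrow> 'l \<Rightarrow> 'v \<Rightarrow> bool" where
  "optimal_presentation w \<iota> \<mu> B b \<gamma> \<longleftrightarrow>
     B = vball w b \<gamma> \<and> (\<exists>c\<in>Min_deg \<iota> B. eps \<mu> (min_polynomial \<iota> c) = \<gamma>)"

definition opt_balls ::
  "('l::alg_closed_field \<Rightarrow> 'v::linordered_ab_group_add extended) \<Rightarrow> ('k::field \<Rightarrow> 'l) \<Rightarrow>
   ('k poly \<Rightarrow> 'v extended) \<Rightarrow> ('l poly \<Rightarrow> 'v extended) \<Rightarrow> ('l poly \<Rightarrow> 'v extended) set \<Rightarrow>
   'l set set" where
  "opt_balls w \<iota> \<mu> \<mu>' D =
     {B \<in> nest w \<mu> \<mu>' D. \<exists>b \<gamma>. optimal_presentation w \<iota> \<mu> B b \<gamma>}"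

text \<open>\<open>\<mu>\<^sub>B\<close> for an optimal ball \<open>B\<close>. A presentation with the optimality property is chosen because
  \<open>\<Lambda>\<close> may be larger than the value group, so that the set \<open>B\<close> alone need not determine a radius.\<close>
definition opt_ball_val ::
  "('l::alg_closed_field \<Rightarrow> 'v::linordered_ab_group_add extended) \<Rightarrow> ('k::field \<Rightarrow> 'l) \<Rightarrow>
   ('k poly \<Rightarrow> 'v extended) \<Rightarrow> 'l set \<Rightarrow> 'k poly \<Rightarrow> 'v extended" where
  "opt_ball_val w \<iota> \<mu> B =
     (let p = (SOME p. optimal_presentation w \<iota> \<mu> B (fst p) (snd p))
      in restr \<iota> (ball_val w (fst p) (snd p)))"


section \<open>Graded algebra and key polynomials\<close>

text \<open>\<open>\<G>\<^sub>\<mu> = \<Oplus> \<P>\<^sub>\<alpha> / \<P>\<^sub>\<alpha>\<^sup>+\<close> is built as the quotient of \<open>\<Oplus> \<P>\<^sub>\<alpha>\<close> by the ideal \<open>\<Oplus> \<P>\<^sub>\<alpha>\<^sup>+\<close>, with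
  \<open>\<alpha>\<close> ranging over the value group of \<open>\<mu>\<close>. Finitely supported maps carry the convolution product.\<close>
definition graded_cover ::
  "('f::field poly \<Rightarrow> 'v::linordered_ab_group_add extended) \<Rightarrow> ('v \<Rightarrow>\<^sub>0 'f poly) ring" where
  "graded_cover \<mu> = ring_of_type_algebra
     \<lparr>carrier := {u. Poly_Mapping.keys u \<subseteq> value_group \<mu> \<and> (\<forall>\<alpha>. Fin \<alpha> \<le> \<mu> (Poly_Mapping.lookup u \<alpha>))}\<rparr>"

definition graded_kernel ::
  "('f::field poly \<Rightarrow> 'v::linordered_ab_group_add extended) \<Rightarrow> ('v \<Rightarrow>\<^sub>0 'f poly) set" where
  "graded_kernel \<mu> = {u. Poly_Mapping.keys u \<subseteq> value_group \<mu> \<and> (\<forall>\<alpha>. Fin \<alpha> < \<mu> (Poly_Mapping.lookup u \<alpha>))}"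

definition graded_algebra ::
  "('f::field poly \<Rightarrow> 'v::linordered_ab_group_add extended) \<Rightarrow> ('v \<Rightarrow>\<^sub>0 'f poly) set ring" where
  "graded_algebra \<mu> = graded_cover \<mu> Quot graded_kernel \<mu>"

definition initial_form ::
  "('f::field poly \<Rightarrow> 'v::linordered_ab_group_add extended) \<Rightarrow> 'f poly \<Rightarrow> ('v \<Rightarrow>\<^sub>0 'f poly) set" where
  "initial_form \<mu> f =
     graded_kernel \<mu> +>\<^bsub>graded_cover \<mu>\<^esub> Poly_Mapping.single (fin_val (\<mu> f)) f"

text \<open>The principal ideal below is homogeneous, being generated by a homogeneous element.\<close>
definition KP :: "('f::field poly \<Rightarrow> 'v::linordered_ab_group_add extended) \<Rightarrow> 'f poly set" where
  "KP \<mu> = {\<phi>. lead_coeff \<phi> = 1 \<and>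
     primeideal (PIdl\<^bsub>graded_algebra \<mu>\<^esub> (initial_form \<mu> \<phi>)) (graded_algebra \<mu>) \<and>
     (\<forall>f. f \<noteq> 0 \<and> degree f < degree \<phi> \<longrightarrow>
        initial_form \<mu> f \<notin> PIdl\<^bsub>graded_algebra \<mu>\<^esub> (initial_form \<mu> \<phi>))}"

definition trans_deg ::
  "('f::field poly \<Rightarrow> 'v::linordered_ab_group_add extended) \<Rightarrow> nat" where
  "trans_deg \<mu> = (LEAST n. \<exists>\<phi>\<in>KP \<mu>. n = degree \<phi>)"

text \<open>The degree of \<open>\<mu>\<close> as an element of \<open>\<V>\<close>. In the valuation-algebraic case the degrees along a
  family with stable limit \<open>\<mu>\<close> are used; their supremum in \<^typ>\<open>enat\<close> is their maximum if they are
  bounded and \<open>\<infinity>\<close> otherwise, and does not depend on the family.\<close>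
definition deg_val ::
  "('f::field \<Rightarrow> 'v::linordered_ab_group_add extended) \<Rightarrow> ('f poly \<Rightarrow> 'v extended) \<Rightarrow> enat" where
  "deg_val v \<mu> =
     (if valuation_transcendental \<mu> then enat (trans_deg \<mu>)
      else let C = (SOME C. increasing_family v C \<and> (\<forall>\<rho>\<in>C. valuation_transcendental \<rho>) \<and>
                            is_stable_limit \<mu> C)
           in (SUP \<rho>\<in>C. enat (trans_deg \<rho>)))"

text \<open>\<open>\<^bold>t(\<mu>, \<eta>)\<close>\<close>
definition tangent ::
  "('f::field poly \<Rightarrow> 'v::linordered_ab_group_add extended) \<Rightarrow> ('f poly \<Rightarrow> 'v extended) \<Rightarrow> 'f poly set" where
  "tangent \<mu> \<eta> = {\<phi>. lead_coeff \<phi> = 1 \<and> \<mu> \<phi> < \<eta> \<phi> \<and>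
     (\<forall>f. lead_coeff f = 1 \<and> \<mu> f < \<eta> f \<longrightarrow> degree \<phi> \<le> degree f)}"


section \<open>Augmentations and Mac Lane--Vaquie chains\<close>

text \<open>\<open>\<eta>\<close> is given on \<open>\<phi>\<close>-expansions by \<open>\<Sum> f\<^sub>i \<phi>^i \<mapsto> min (\<omega>(f\<^sub>i) + i\<gamma>)\<close>. For \<open>degree \<phi> > 0\<close>, which
  holds for the polynomials used below, this determines \<open>\<eta>\<close>.\<close>
definition augments ::
  "('f::field poly \<Rightarrow> 'v::linordered_ab_group_add extended) \<Rightarrow> 'f poly \<Rightarrow> 'v \<Rightarrow>
   ('f poly \<Rightarrow> 'v extended) \<Rightarrow> bool" where
  "augments \<omega> \<phi> \<gamma> \<eta> \<longleftrightarrow>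
     (\<forall>n f. (\<forall>i\<le>n. degree (f i) < degree \<phi>) \<longrightarrow>
        \<eta> (\<Sum>i\<le>n. f i * \<phi> ^ i) = Min ((\<lambda>i. \<omega> (f i) + Fin (nmul i \<gamma>)) ` {..n}))"

definition ordinary_augmentation ::
  "('f::field poly \<Rightarrow> 'v::linordered_ab_group_add extended) \<Rightarrow> 'f poly \<Rightarrow> 'v \<Rightarrow>
   ('f poly \<Rightarrow> 'v extended) \<Rightarrow> bool" where
  "ordinary_augmentation \<mu> \<phi> \<gamma> \<eta> \<longleftrightarrow> \<phi> \<in> KP \<mu> \<and> \<mu> \<phi> < Fin \<gamma> \<and> augments \<mu> \<phi> \<gamma> \<eta>"

definition limit_augmentation ::
  "('f::field poly \<Rightarrow> 'v::linordered_ab_group_add extended) set \<Rightarrow> 'f poly \<Rightarrow> 'v \<Rightarrow>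
   ('f poly \<Rightarrow> 'v extended) \<Rightarrow> bool" where
  "limit_augmentation C \<phi> \<gamma> \<eta> \<longleftrightarrow>
     \<phi> \<in> KP_inf C \<and> (\<forall>\<rho>\<in>C. \<rho> \<phi> < Fin \<gamma>) \<and> augments (stable_value C) \<phi> \<gamma> \<eta>"

text \<open>A well-ordered increasing family of valuations of constant degree with minimum \<open>\<mu>\<close>.\<close>
definition const_deg_family ::
  "('f::field \<Rightarrow> 'v::linordered_ab_group_add extended) \<Rightarrow> ('f poly \<Rightarrow> 'v extended) \<Rightarrow>
   ('f poly \<Rightarrow> 'v extended) set \<Rightarrow> bool" where
  "const_deg_family v \<mu> C \<longleftrightarrow>
     increasing_family v C \<and> well_order_on C (relation_of (\<le>) C) \<and>
     (\<forall>\<rho>\<in>C. \<forall>\<sigma>\<in>C. deg_val v \<rho> = deg_val v \<sigma>) \<and> \<mu> \<in> C \<and> (\<forall>\<rho>\<in>C. \<mu> \<le> \<rho>)"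

text \<open>The sequence \<open>m 0 < m 1 < \<dots>\<close> consists of the terms \<open>m n\<close> with \<open>n < N\<close>, where \<open>N = \<infinity>\<close> is
  allowed. In the valuation-algebraic case of finite degree the condition \<open>\<rho> < \<mu>\<close> says that \<open>\<mu>\<close> is
  not itself a member of the family whose limit it is.\<close>
definition MLV_chain ::
  "('f::field \<Rightarrow> 'v::linordered_ab_group_add extended) \<Rightarrow> ('f poly \<Rightarrow> 'v extended) \<Rightarrow>
   enat \<Rightarrow> (nat \<Rightarrow> 'f poly \<Rightarrow> 'v extended) \<Rightarrow> bool" where
  "MLV_chain v \<mu> N m \<longleftrightarrow>
     0 < N \<and>
     (\<forall>n. enat n < N \<longrightarrow> m n \<in> poly_exts v \<and> m n \<le> \<mu>) \<and>
     (\<forall>n. enat (Suc n) < N \<longrightarrow> m n < m (Suc n)) \<and>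
     deg_val v (m 0) = 1 \<and>
     (\<forall>n. enat (Suc n) < N \<longrightarrow> deg_val v (m n) < deg_val v (m (Suc n))) \<and>
     (\<exists>\<phi> \<gamma>.
        (\<forall>n. enat (Suc n) < N \<longrightarrow>
           ordinary_augmentation (m n) (\<phi> (Suc n)) (\<gamma> (Suc n)) (m (Suc n)) \<or>
           (\<exists>C. const_deg_family v (m n) C \<and>
                limit_augmentation C (\<phi> (Suc n)) (\<gamma> (Suc n)) (m (Suc n)))) \<and>
        (\<forall>n\<ge>1. enat n < N \<and> m n < \<mu> \<longrightarrow> \<phi> n \<notin> tangent (m n) \<mu>)) \<and>
     (valuation_transcendental \<mu> \<longrightarrow> (\<exists>r. N = enat (Suc r) \<and> m r = \<mu>)) \<and>
     (\<not> valuation_transcendental \<mu> \<and> deg_val v \<mu> < \<infinity> \<longrightarrow>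
        (\<exists>r C. N = enat (Suc r) \<and> const_deg_family v (m r) C \<and> (\<forall>\<rho>\<in>C. \<rho> < \<mu>) \<and>
               is_stable_limit \<mu> C)) \<and>
     (\<not> valuation_transcendental \<mu> \<and> deg_val v \<mu> = \<infinity> \<longrightarrow>
        N = \<infinity> \<and> is_stable_limit \<mu> (range m))"

end

theory Submission
  imports Defs
begin

text \<open>
  Write \<open>L c\<close> for the value of \<open>x - c\<close> under \<open>\<mu>'\<close>. Polynomials split over the algebraic closure, so every
  comparison of valuations there reduces to linear ones. The number \<open>\<epsilon>\<^sub>\<mu>(f)\<close> is the largest \<open>L c\<close>
  over the roots \<open>c\<close> of \<open>f\<close>; hence the optimal balls are the balls \<open>B(c, L c)\<close> for which \<open>L c\<close> is maximal
  among the conjugates of \<open>c\<close> and the degree of \<open>c\<close> is minimal among all \<open>c'\<close> with \<open>L c' \<ge> L c\<close>. A polynomial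
  \<open>f\<close> of degree less than that of \<open>c\<close> has no root in this ball, so it has the same initial form as the
  constant \<open>f(c)\<close>; therefore the minimal polynomial of \<open>c\<close> is a key polynomial of least degree for \<open>\<mu>\<^sub>B\<close>.

  A root of degree less than \<open>m\<^sub>n\<^sub>+\<^sub>1\<close> is never closer than some optimal ball of degree at most \<open>m\<^sub>n\<close>, so
  polynomials of degree less than \<open>m\<^sub>n\<^sub>+\<^sub>1\<close> have reached their final value along \<open>\<B>\<^sub>n\<close>, while the minimal
  polynomial of a centre of degree \<open>m\<^sub>n\<^sub>+\<^sub>1\<close> has not. The step is an ordinary or a limit augmentation according
  to whether there is a last ball of degree \<open>m\<^sub>n\<close>. The degree of a valuation-algebraic \<open>\<mu>\<close> does not depend on the
  family used to compute it because the valuations below \<open>\<mu>\<close> are totally ordered and the least degree of a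
  key polynomial is monotone.
\<close>

section \<open>Valuations\<close>

text \<open>A ball as a set need not determine its radius, since \<Lambda> may be larger than the
  value group. Optimal balls are therefore handled through centres \<open>c\<close> with the
  canonical radius \<open>L c\<close>; every optimal presentation is shown to carry this radius for
  a suitable centre, so the valuation of an optimal ball does not depend on the chosen presentation.
  The graded algebra is translated into approximate divisibility \<open>vdvd\<close>, and
  transcendence of a residue into a statement about values of polynomial expressions; all later
  arguments are about inequalities between values. Key polynomials are recognised by comparing a
  valuation with a larger function that may be infinite at nonzero polynomials. This single
  criterion covers both tangent polynomials and evaluation at a root. The nest of balls is accessed
  through three facts on the valuations generating it: they are ball valuations, they lie below
  \<open>\<mu>'\<close>, and they attain each single value of \<open>\<mu>'\<close>. These hold for
  the fixed family in the valuation-algebraic case and for \<open>\<mu>'\<close> alone in the other,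
  so both cases share one treatment.\<close>

lemma ext_add_less_le:
  fixes a b c d :: "'v::linordered_ab_group_add extended"
  assumes "a < b" "c \<le> d" "c \<noteq> Pinf" "b \<noteq> Minf" "c \<noteq> Minf"
  shows "a + c < b + d"
  using assms by (cases a; cases b; cases c; cases d) (auto intro: add_less_le_mono)

lemma ext_add_le_less:
  fixes a b c d :: "'v::linordered_ab_group_add extended"
  assumes "a \<le> b" "c < d" "a \<noteq> Pinf" "a \<noteq> Minf" "d \<noteq> Minf"
  shows "a + c < b + d"
  using assms by (cases a; cases b; cases c; cases d) (auto intro: add_le_less_mono)

lemma ext_add_eq_Pinf:
  fixes a b :: "'v::linordered_ab_group_add extended"
  shows "a + b = Pinf \<longleftrightarrow> a = Pinf \<or> b = Pinf"
  by (cases a; cases b) auto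

lemma ext_add_eq_Minf:
  fixes a b :: "'v::linordered_ab_group_add extended"
  shows "a \<noteq> Minf \<Longrightarrow> b \<noteq> Minf \<Longrightarrow> a + b \<noteq> Minf"
  by (cases a; cases b) auto

lemma fin_val_Fin [simp]: "fin_val (Fin a) = a"
  by (simp add: fin_val_def)

lemma Fin_fin_val: "x \<noteq> Pinf \<Longrightarrow> x \<noteq> Minf \<Longrightarrow> Fin (fin_val x) = x"
  by (cases x) auto

lemma nmul_0 [simp]: "nmul 0 x = 0"
  by (simp add: nmul_def)

lemma nmul_Suc: "nmul (Suc n) x = nmul n x + x"
  by (simp add: nmul_def)

lemma nmul_1 [simp]: "nmul (Suc 0) x = x"
  by (simp add: nmul_def)

lemma nmul_add: "nmul (m + n) x = nmul m x + nmul n x"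
  by (induction n) (auto simp: nmul_Suc algebra_simps)

lemma nmul_zero [simp]: "nmul n (0 :: 'v::comm_monoid_add) = 0"
  by (simp add: nmul_def)

lemma nmul_mono: "x \<le> y \<Longrightarrow> nmul n x \<le> nmul n (y :: 'v::linordered_ab_group_add)"
  by (induction n) (auto simp: nmul_Suc add_mono)

lemma nmul_strict_mono: "n > 0 \<Longrightarrow> x < y \<Longrightarrow> nmul n x < nmul n (y :: 'v::linordered_ab_group_add)"
  by (induction n) (auto simp: nmul_Suc intro!: add_le_less_mono nmul_mono)

lemma nmul_inject: "n > 0 \<Longrightarrow> nmul n x = nmul n y \<longleftrightarrow> x = (y :: 'v::linordered_ab_group_add)"
  using nmul_strict_mono[of n x y] nmul_strict_mono[of n y x] by (cases x y rule: linorder_cases) auto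

text \<open>The value infinity may occur away from 0, so that evaluation at an algebraic element is
  an instance. The requirement \<open>w 1 = 0\<close> excludes the constant map with value infinity,
  which satisfies the other laws.\<close>

locale pseudo_valuation =
  fixes w :: "'r::comm_ring_1 \<Rightarrow> 'v::linordered_ab_group_add extended"
  assumes not_Minf [simp]: "w x \<noteq> Minf"
    and zero [simp]: "w 0 = Pinf"
    and one [simp]: "w 1 = 0"
    and mult: "w (x * y) = w x + w y"
    and add_ge: "min (w x) (w y) \<le> w (x + y)"
begin

text \<open>Twice this value is 0, and an ordered group has no torsion.\<close>

lemma minus_one: "w (- 1) = 0"
proof -
  have "w (- 1) + w (- 1) = 0"
    using mult[of "- 1" "- 1"] by simp
  then show ?thesis
    by (cases "w (- 1)") (auto simp: zero_extended_def)
qed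

lemma minus [simp]: "w (- x) = w x"
  using mult[of "- 1" x] by (simp add: minus_one)

lemma diff_ge: "min (w x) (w y) \<le> w (x - y)"
  using add_ge[of x "- y"] by simp

lemma diff_commute: "w (x - y) = w (y - x)"
  using minus[of "x - y"] by simp

lemma add_geI: "t \<le> w x \<Longrightarrow> t \<le> w y \<Longrightarrow> t \<le> w (x + y)"
  using add_ge[of x y] by (auto simp: min_def split: if_splits)

lemma add_gtI: "t < w x \<Longrightarrow> t < w y \<Longrightarrow> t < w (x + y)"
  using add_ge[of x y] by (auto simp: min_def split: if_splits)

lemma diff_geI: "t \<le> w x \<Longrightarrow> t \<le> w y \<Longrightarrow> t \<le> w (x - y)"
  using add_geI[of t x "- y"] by simp

lemma diff_gtI: "t < w x \<Longrightarrow> t < w y \<Longrightarrow> t < w (x - y)"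
  using add_gtI[of t x "- y"] by simp

lemma add_eq:
  assumes "w x < w y" shows "w (x + y) = w x"
proof (rule antisym)
  show "w x \<le> w (x + y)" using assms by (intro add_geI) auto
  show "w (x + y) \<le> w x"
    using diff_ge[of "x + y" y] assms by (auto simp: min_def split: if_splits)
qed

lemma diff_eq: "w x < w y \<Longrightarrow> w (x - y) = w x"
  using add_eq[of x "- y"] by simp

text \<open>The hypothesis expresses that \<open>x\<close> and \<open>y\<close> have the same
  initial form. Inequalities of this shape replace equality in the graded algebra.\<close>

lemma eq_if_diff_gt:
  assumes "w x < w (x - y)" shows "w y = w x"
  using add_eq[of x "y - x"] assms diff_commute[of x y] by simp

lemma sum_geI: "(\<And>i. i \<in> A \<Longrightarrow> t \<le> w (f i)) \<Longrightarrow> t \<le> w (sum f A)"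
  by (induction A rule: infinite_finite_induct) (auto intro: add_geI)

text \<open>The bound must be finite because the empty sum has value infinity, which has to exceed
  \<open>t\<close> strictly.\<close>

lemma sum_gtI: "t \<noteq> Pinf \<Longrightarrow> (\<And>i. i \<in> A \<Longrightarrow> t < w (f i)) \<Longrightarrow> t < w (sum f A)"
  by (induction A rule: infinite_finite_induct) (cases t, auto intro: add_gtI)+

lemma sum_eq:
  assumes "finite A" "i \<in> A" "\<And>j. j \<in> A - {i} \<Longrightarrow> w (f i) < w (f j)"
  shows "w (sum f A) = w (f i)"
proof (cases "w (f i) = Pinf")
  case True
  then have "A - {i} = {}" using assms(3) by (metis all_not_in_conv less_extended_simps(4))
  then have "A = {i}" using assms(2) by auto
  then show ?thesis by simp
next
  case False
  then have "w (f i) < w (sum f (A - {i}))"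
    using assms by (intro sum_gtI) auto
  then show ?thesis
    using add_eq[of "f i" "sum f (A - {i})"] assms by (simp add: sum.remove)
qed

lemma prod_mset: "w (prod_mset (image_mset f A)) = sum_mset (image_mset (\<lambda>x. w (f x)) A)"
  by (induction A) (auto simp: mult)

lemma power_Fin: "w x = Fin a \<Longrightarrow> w (x ^ n) = Fin (nmul n a)"
  by (induction n) (auto simp: nmul_Suc mult zero_extended_def add.commute)

end

lemma valuation_imp_pseudo:
  assumes "valuation w" shows "pseudo_valuation w"
proof
  have *: "w 1 = w 1 + w 1" "w 1 \<noteq> Minf" "w 1 \<noteq> Pinf"
    using assms unfolding valuation_def by (metis mult_1) (use assms in \<open>auto simp: valuation_def\<close>)
  show "w 1 = 0"
    using * by (cases "w 1") (auto simp: zero_extended_def)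
qed (use assms in \<open>auto simp: valuation_def\<close>)

locale is_valuation =
  fixes w :: "'r::comm_ring_1 \<Rightarrow> 'v::linordered_ab_group_add extended"
  assumes valuation: "valuation w"

sublocale is_valuation \<subseteq> pseudo_valuation w
  by (rule valuation_imp_pseudo[OF valuation])

context is_valuation
begin

lemma eq_Pinf_iff [simp]: "w x = Pinf \<longleftrightarrow> x = 0"
  using valuation by (simp add: valuation_def)

lemma finite_value: "x \<noteq> 0 \<Longrightarrow> \<exists>a. w x = Fin a"
  by (cases "w x") auto

lemma Fin_fin_val_eq: "x \<noteq> 0 \<Longrightarrow> Fin (fin_val (w x)) = w x"
  by (rule Fin_fin_val) auto

lemma mult_cancel_less: "x \<noteq> 0 \<Longrightarrow> w x + a < w x + b \<longleftrightarrow> a < b"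
  using finite_value[of x] by (cases a; cases b) auto

end

section \<open>Key polynomials\<close>

text \<open>Divisibility of initial forms, expressed without the graded algebra.\<close>
definition vdvd :: "('r::comm_ring_1 \<Rightarrow> 'v::linordered_ab_group_add extended) \<Rightarrow> 'r \<Rightarrow> 'r \<Rightarrow> bool" where
  "vdvd \<mu> g f \<longleftrightarrow> (\<exists>h. \<mu> f < \<mu> (f - g * h))"

text \<open>This is Mac Lane's minimality; it is the property that lets \<phi>-expansions compute
  values.\<close>

definition v_minimal :: "('f::field poly \<Rightarrow> 'v::linordered_ab_group_add extended) \<Rightarrow> 'f poly \<Rightarrow> bool" where
  "v_minimal \<mu> \<phi> \<longleftrightarrow> lead_coeff \<phi> = 1 \<and> 0 < degree \<phi> \<and>
     (\<forall>f. f \<noteq> 0 \<and> degree f < degree \<phi> \<longrightarrow> \<not> vdvd \<mu> \<phi> f)"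

text \<open>Primality is tested on homogeneous elements only. Properness of the ideal is contained
  in minimality, applied to the polynomial 1 of degree 0.\<close>

definition key_poly :: "('f::field poly \<Rightarrow> 'v::linordered_ab_group_add extended) \<Rightarrow> 'f poly \<Rightarrow> bool" where
  "key_poly \<mu> \<phi> \<longleftrightarrow> v_minimal \<mu> \<phi> \<and> (\<forall>f g. vdvd \<mu> \<phi> (f * g) \<longrightarrow> vdvd \<mu> \<phi> f \<or> vdvd \<mu> \<phi> g)"

lemma degree_mod_less_pos:
  fixes f g :: "'f::field poly"
  assumes "0 < degree g" shows "degree (f mod g) < degree g"
  using degree_mod_less[of g f] assms by fastforce

section \<open>Calculus of divisibility of initial forms\<close>

context is_valuation
begin

lemma vdvd_nonzero: "vdvd w g f \<Longrightarrow> f \<noteq> 0"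
  by (auto simp: vdvd_def)

text \<open>Subtracting the two approximations leaves one for \<open>f'\<close>. Its error exceeds
  the value of \<open>f\<close>, and the bound on \<open>f'\<close> turns this into an error
  exceeding the value of \<open>f'\<close>.\<close>

lemma vdvd_congruent:
  assumes "vdvd w g f" "w f < w (f - f' - g * k)" "w f' \<le> w f" shows "vdvd w g f'"
proof -
  obtain h where h: "w f < w (f - g * h)" using assms(1) by (auto simp: vdvd_def)
  have "w f < w ((f - g * h) - (f - f' - g * k))"
    using h assms(2) by (rule diff_gtI)
  also have "(f - g * h) - (f - f' - g * k) = f' - g * (h - k)"
    by (simp add: algebra_simps)
  finally show ?thesis using assms(3) unfolding vdvd_def by (intro exI[of _ "h - k"]) auto
qed

lemma vdvd_mult:
  assumes "vdvd w g f" "u \<noteq> 0" shows "vdvd w g (f * u)"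
proof -
  obtain h where h: "w f < w (f - g * h)" using assms(1) by (auto simp: vdvd_def)
  have "w (u * f) < w (u * (f - g * h))"
    using h assms(2) by (simp add: mult mult_cancel_less)
  then show ?thesis unfolding vdvd_def by (intro exI[of _ "h * u"]) (simp add: algebra_simps)
qed

lemma vdvd_value: "w f < w (f - g * h) \<Longrightarrow> w g + w h = w f"
  using eq_if_diff_gt[of f "g * h"] by (simp add: mult)

text \<open>\<open>vdvd w f 1\<close> says that the initial form of \<open>f\<close> is a unit.\<close>
lemma vdvd_1_trans:
  assumes "vdvd w f g" "vdvd w g 1" shows "vdvd w f 1"
proof -
  obtain k where k: "w 1 < w (1 - g * k)" using assms(2) by (auto simp: vdvd_def)
  then have "k \<noteq> 0" by auto
  then have "vdvd w f (g * k)" using assms(1) by (rule vdvd_mult[rotated])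
  moreover have gk: "w (g * k) = 0" using vdvd_value[OF k] by (simp add: mult)
  moreover have "w (g * k) < w (g * k - 1 - f * 0)"
    using k gk diff_commute[of 1 "g * k"] by simp
  ultimately show ?thesis by (intro vdvd_congruent[of f "g * k" 1 0]) auto
qed

lemma vdvd_1_mult:
  assumes "vdvd w f 1" "vdvd w g 1" shows "vdvd w (f * g) 1"
proof -
  obtain h where h: "w 1 < w (1 - f * h)" using assms(1) by (auto simp: vdvd_def)
  have "g \<noteq> 0" using assms(2) by (auto simp: vdvd_def)
  have "w (g * 1) < w (g * (1 - f * h))"
    using h mult_cancel_less[OF \<open>g \<noteq> 0\<close>] unfolding mult by blast
  then have "vdvd w (f * g) g" unfolding vdvd_def by (intro exI[of _ h]) (simp add: algebra_simps)
  then show ?thesis using assms(2) by (rule vdvd_1_trans)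
qed

end

text \<open>The only doubtful case is that both values agree. A sum of larger value would make
  \<open>- q\<close> a witness that \<phi> divides \<open>r\<close> approximately, against
  minimality.\<close>

lemma v_minimal_expand:
  assumes "valuation \<mu>" "v_minimal \<mu> \<phi>" "degree r < degree \<phi>"
  shows "\<mu> (q * \<phi> + r) = min (\<mu> (q * \<phi>)) (\<mu> r)"
proof -
  interpret is_valuation \<mu> by unfold_locales fact
  consider "r = 0" | "\<mu> (q * \<phi>) < \<mu> r" | "\<mu> r < \<mu> (q * \<phi>)" | "r \<noteq> 0" "\<mu> r = \<mu> (q * \<phi>)"
    by fastforce
  then show ?thesis
  proof cases
    case 1
    then show ?thesis by simp
  next
    case 2
    then show ?thesis using add_eq[of "q * \<phi>" r] by simp
  next
    case 3
    then show ?thesis using add_eq[of r "q * \<phi>"] by (simp add: add.commute)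
  next
    case 4
    then have "\<not> vdvd \<mu> \<phi> r" using assms unfolding v_minimal_def by blast
    then have "\<not> \<mu> r < \<mu> (r - \<phi> * (- q))" unfolding vdvd_def by blast
    then have "\<mu> (q * \<phi> + r) \<le> \<mu> r" by (simp add: algebra_simps)
    with add_ge[of "q * \<phi>" r] 4 show ?thesis by simp
  qed
qed

text \<open>Horner's scheme: the tail of the expansion is a multiple of \<phi>, and
  \<open>v_minimal_expand\<close> separates it from the term of index 0.\<close>

lemma v_minimal_expand_sum:
  assumes "valuation \<mu>" "v_minimal \<mu> \<phi>" "\<mu> \<phi> = Fin \<gamma>" "\<And>i. i \<le> n \<Longrightarrow> degree (f i) < degree \<phi>"
  shows "\<mu> (\<Sum>i\<le>n. f i * \<phi> ^ i) = Min ((\<lambda>i. \<mu> (f i) + Fin (nmul i \<gamma>)) ` {..n})"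
  using assms(4)
proof (induction n arbitrary: f)
  case 0
  then show ?case by (simp flip: zero_extended_def)
next
  case (Suc n)
  interpret is_valuation \<mu> by unfold_locales fact
  let ?g = "\<lambda>i. f (Suc i)"
  have "(\<Sum>i\<le>Suc n. f i * \<phi> ^ i) = (\<Sum>i\<le>n. ?g i * \<phi> ^ i) * \<phi> + f 0"
    by (simp add: sum.atMost_Suc_shift sum_distrib_left sum_distrib_right mult_ac del: sum.atMost_Suc)
  then have "\<mu> (\<Sum>i\<le>Suc n. f i * \<phi> ^ i) = min (\<mu> (\<Sum>i\<le>n. ?g i * \<phi> ^ i) + Fin \<gamma>) (\<mu> (f 0))"
    using v_minimal_expand[OF assms(1,2), of "f 0"] Suc.prems by (simp add: mult assms(3))
  also have "\<mu> (\<Sum>i\<le>n. ?g i * \<phi> ^ i) = Min ((\<lambda>i. \<mu> (?g i) + Fin (nmul i \<gamma>)) ` {..n})"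
    using Suc.prems by (intro Suc.IH) auto
  also have "\<dots> + Fin \<gamma> = Min ((\<lambda>x. x + Fin \<gamma>) ` (\<lambda>i. \<mu> (?g i) + Fin (nmul i \<gamma>)) ` {..n})"
    by (intro mono_Min_commute) (auto simp: mono_def add_mono)
  also have "(\<lambda>x. x + Fin \<gamma>) ` (\<lambda>i. \<mu> (?g i) + Fin (nmul i \<gamma>)) ` {..n} =
     (\<lambda>i. \<mu> (f i) + Fin (nmul i \<gamma>)) ` Suc ` {..n}"
    unfolding image_image by (intro image_cong) (auto simp: add.assoc nmul_Suc)
  finally have "\<mu> (\<Sum>i\<le>Suc n. f i * \<phi> ^ i) =
     min (Min ((\<lambda>i. \<mu> (f i) + Fin (nmul i \<gamma>)) ` Suc ` {..n})) (\<mu> (f 0))" .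
  also have "\<dots> = Min (insert (\<mu> (f 0)) ((\<lambda>i. \<mu> (f i) + Fin (nmul i \<gamma>)) ` Suc ` {..n}))"
    by (subst Min_insert) (auto simp: min.commute)
  also have "insert (\<mu> (f 0)) ((\<lambda>i. \<mu> (f i) + Fin (nmul i \<gamma>)) ` Suc ` {..n}) =
     (\<lambda>i. \<mu> (f i) + Fin (nmul i \<gamma>)) ` {..Suc n}"
    unfolding atMost_Suc_eq_insert_0 by (simp flip: zero_extended_def)
  finally show ?case .
qed

text \<open>A valuation is rebuilt from its values in degrees below \<phi> and at \<phi>. Any
  \<omega> agreeing with it in low degree serves as the base, be it a smaller valuation or a stable
  limit, so ordinary and limit augmentations come from the same argument.\<close>

lemma v_minimal_augments:
  assumes "valuation \<mu>" "v_minimal \<mu> \<phi>" "\<And>f. degree f < degree \<phi> \<Longrightarrow> \<omega> f = \<mu> f"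
  shows "augments \<omega> \<phi> (fin_val (\<mu> \<phi>)) \<mu>"
proof -
  interpret is_valuation \<mu> by unfold_locales fact
  have "\<mu> \<phi> = Fin (fin_val (\<mu> \<phi>))"
    using assms(2) Fin_fin_val_eq[of \<phi>] by (force simp: v_minimal_def)
  from v_minimal_expand_sum[OF assms(1,2) this] show ?thesis
    unfolding augments_def by (auto simp: assms(3) intro!: arg_cong[of _ _ Min] image_cong)
qed

text \<open>\<open>\<eta>\<close> may take the value \<open>\<infinity>\<close> at nonzero polynomials. This covers evaluation at an algebraic
  element, by which minimal polynomials are seen to be key polynomials.\<close>
lemma key_poly_if_tangent:
  assumes "valuation \<rho>" "pseudo_valuation \<eta>" "\<rho> \<le> \<eta>" and monic: "lead_coeff \<phi> = 1"
    and less: "\<rho> \<phi> < \<eta> \<phi>" and eq: "\<And>f. degree f < degree \<phi> \<Longrightarrow> \<eta> f = \<rho> f"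
  shows "key_poly \<rho> \<phi>"
proof -
  interpret is_valuation \<rho> by unfold_locales fact
  interpret E: pseudo_valuation \<eta> by fact
  have le: "\<rho> f \<le> \<eta> f" for f using assms(3) by (simp add: le_fun_def)
  have deg: "0 < degree \<phi>"
  proof (rule ccontr)
    assume "\<not> 0 < degree \<phi>"
    then have "\<phi> = 1" using monic by (auto elim!: degree_eq_zeroE)
    then show False using less by simp
  qed
  \<comment> \<open>The gain on \<phi> survives multiplication by \<open>h\<close> because \<rho> is
    finite at \<open>h\<close>.\<close>
  have mult_less: "\<rho> (\<phi> * h) < \<eta> (\<phi> * h)" if "h \<noteq> 0" for h
  proof -
    obtain a where "\<rho> h = Fin a" using finite_value \<open>h \<noteq> 0\<close> by blast
    then show ?thesis unfolding mult E.mult using less le[of h]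
      by (intro ext_add_less_le) auto
  qed
  have dvd_less: "\<rho> f < \<eta> f" if f: "vdvd \<rho> \<phi> f" for f
  proof -
    obtain h where h: "\<rho> f < \<rho> (f - \<phi> * h)" using f by (auto simp: vdvd_def)
    then have "h \<noteq> 0" by auto
    have "\<rho> f < \<eta> (f - \<phi> * h)" using h le less_le_trans by blast
    moreover have "\<rho> f < \<eta> (\<phi> * h)"
      using mult_less[OF \<open>h \<noteq> 0\<close>] vdvd_value[OF h] by (simp add: mult)
    ultimately have "\<rho> f < \<eta> ((f - \<phi> * h) + \<phi> * h)" by (rule E.add_gtI)
    then show ?thesis by simp
  qed
  have min: "v_minimal \<rho> \<phi>"
    unfolding v_minimal_def using monic deg dvd_less eq by fastforce
  have less_dvd: "vdvd \<rho> \<phi> f" if f: "\<rho> f < \<eta> f" for f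
  proof -
    define q r where "q = f div \<phi>" and "r = f mod \<phi>"
    have r: "degree r < degree \<phi>" unfolding r_def by (rule degree_mod_less_pos[OF deg])
    have f_eq: "f = q * \<phi> + r" by (simp add: q_def r_def)
    have v: "\<rho> f = min (\<rho> (q * \<phi>)) (\<rho> r)"
      unfolding f_eq by (rule v_minimal_expand[OF assms(1) min r])
    have "\<rho> f < \<rho> r"
    \<comment> \<open>If \<open>r\<close> had the value of \<open>f\<close>, then the gain of
      \<open>f\<close> would force \<eta> to give \<open>q * \<phi> = f - r\<close> the value
      \<open>\<rho> f\<close>. This is at most \<open>\<rho> (q * \<phi>)\<close>, although
      multiples of \<phi> gain strictly.\<close>
    proof (rule ccontr)
      assume "\<not> \<rho> f < \<rho> r"
      then have rf: "\<rho> r = \<rho> f" using v by (auto simp: min_def split: if_splits)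
      have "\<eta> r < \<eta> f" using rf f eq[OF r] by simp
      then have "\<eta> (f - r) = \<eta> r"
        using E.add_eq[of "- r" f] by simp
      then have *: "\<eta> (q * \<phi>) = \<rho> f" using f_eq eq[OF r] rf by simp
      then have "q \<noteq> 0" using f by (auto simp: less_le)
      then show False using mult_less[of q] * v by (simp add: mult.commute min_def split: if_splits)
    qed
    then show ?thesis unfolding vdvd_def by (intro exI[of _ q]) (simp add: f_eq mult.commute)
  qed
  \<comment> \<open>Approximate multiples of \<phi> are thus the polynomials whose value increases
    from \<rho> to \<eta>. Both functions are multiplicative, so a product can gain only if a factor
    does.\<close>
  have iff: "vdvd \<rho> \<phi> f \<longleftrightarrow> \<rho> f < \<eta> f" for f using dvd_less less_dvd by blast
  show ?thesis unfolding key_poly_def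
  proof (intro conjI min allI impI)
    fix f g assume "vdvd \<rho> \<phi> (f * g)"
    then have "\<rho> (f * g) < \<eta> (f * g)" by (simp add: iff)
    then have "\<not> (\<eta> f \<le> \<rho> f \<and> \<eta> g \<le> \<rho> g)"
      unfolding mult E.mult using add_mono[of "\<eta> f" "\<rho> f" "\<eta> g" "\<rho> g"] by auto
    then show "vdvd \<rho> \<phi> f \<or> vdvd \<rho> \<phi> g" unfolding iff by auto
  qed
qed

text \<open>A nonzero polynomial of least degree whose initial form is not a unit is a key polynomial.\<close>
lemma key_poly_exists_if_nonunit:
  fixes \<rho> :: "'f::field poly \<Rightarrow> 'v::linordered_ab_group_add extended"
  assumes "valuation \<rho>" "g \<noteq> 0" "\<not> vdvd \<rho> g 1"
  shows "\<exists>\<phi>. key_poly \<rho> \<phi> \<and> degree \<phi> \<le> degree g"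
proof -
  interpret is_valuation \<rho> by unfold_locales fact
  let ?P = "\<lambda>f. f \<noteq> 0 \<and> \<not> vdvd \<rho> f 1"
  obtain f0 where f0: "?P f0" and least: "\<And>h. ?P h \<Longrightarrow> degree f0 \<le> degree h"
    using exists_least_iff[of "\<lambda>n. \<exists>h. ?P h \<and> degree h = n"] assms(2,3)
    by (metis linorder_le_less_linear)
  define f where "f = smult (inverse (lead_coeff f0)) f0"
  have lc: "lead_coeff f0 \<noteq> 0" using f0 by simp
  then have monic: "lead_coeff f = 1" and deg_f: "degree f = degree f0" by (auto simp: f_def)
  have nonunit: "\<not> vdvd \<rho> f 1"
  proof
    assume "vdvd \<rho> f 1"
    then obtain h where "\<rho> 1 < \<rho> (1 - f * h)" by (auto simp: vdvd_def)
    also have "f * h = f0 * smult (inverse (lead_coeff f0)) h" by (simp add: f_def)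
    finally show False using f0 unfolding vdvd_def by blast
  qed
  have deg: "0 < degree f"
  proof (rule ccontr)
    assume "\<not> 0 < degree f"
    then have "f = 1" using monic by (auto elim!: degree_eq_zeroE)
    then have "vdvd \<rho> f 1" unfolding vdvd_def by (intro exI[of _ 1]) (auto simp: zero_extended_def)
    then show False using nonunit by simp
  qed
  have unit: "vdvd \<rho> h 1" if "h \<noteq> 0" "degree h < degree f" for h
    using least[of h] that deg_f by auto
  have min: "v_minimal \<rho> f"
    unfolding v_minimal_def
  proof (intro conjI allI impI deg monic)
    fix h :: "'f poly" assume h: "h \<noteq> 0 \<and> degree h < degree f"
    then show "\<not> vdvd \<rho> f h" using nonunit vdvd_1_trans[of f h] unit by blast
  qed
  \<comment> \<open>A polynomial that \<open>f\<close> does not divide approximately can be traded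
    for its remainder: the value is kept, and the discarded multiple of \<open>f\<close> has no
    smaller value.\<close>
  have rem: "\<exists>q r. h = q * f + r \<and> r \<noteq> 0 \<and> degree r < degree f \<and> \<rho> r = \<rho> h \<and> \<rho> h \<le> \<rho> (q * f)"
    if h: "h \<noteq> 0" "\<not> vdvd \<rho> f h" for h
  proof -
    define q r where "q = h div f" and "r = h mod f"
    have r: "degree r < degree f" unfolding r_def by (rule degree_mod_less_pos[OF deg])
    have h_eq: "h = q * f + r" by (simp add: q_def r_def)
    have v: "\<rho> h = min (\<rho> (q * f)) (\<rho> r)"
      unfolding h_eq by (rule v_minimal_expand[OF assms(1) min r])
    have "\<not> \<rho> h < \<rho> (h - f * q)" using h(2) unfolding vdvd_def by blast
    then have "\<not> \<rho> h < \<rho> r" by (simp add: h_eq mult.commute)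
    then have "\<rho> r = \<rho> h" "\<rho> h \<le> \<rho> (q * f)" using v by (auto simp: min_def split: if_splits)
    moreover from this have "r \<noteq> 0" using h(1) by (metis eq_Pinf_iff)
    ultimately show ?thesis using h_eq r by blast
  qed
  have "key_poly \<rho> f"
    unfolding key_poly_def
  proof (intro conjI min allI impI)
    fix g h assume gh: "vdvd \<rho> f (g * h)"
    show "vdvd \<rho> f g \<or> vdvd \<rho> f h"
    proof (rule ccontr)
      assume contra: "\<not> (vdvd \<rho> f g \<or> vdvd \<rho> f h)"
      have "g * h \<noteq> 0" using gh by (rule vdvd_nonzero)
      then obtain q r q' r' where
        g: "g = q * f + r" "r \<noteq> 0" "degree r < degree f" "\<rho> r = \<rho> g" and
        h: "h = q' * f + r'" "r' \<noteq> 0" "degree r' < degree f" "\<rho> r' = \<rho> h"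
        using rem[of g] rem[of h] contra by (metis mult_eq_0_iff)
      \<comment> \<open>The products \<open>g * h\<close> and \<open>r * r'\<close> differ by a
        multiple of \<open>f\<close>. The remainders are units because of their degree, so
        \<open>f\<close> would divide a unit.\<close>
      have "vdvd \<rho> f (r * r')"
      proof (rule vdvd_congruent[OF gh, of _ "q * q' * f + q * r' + q' * r"])
        have "g * h - r * r' - f * (q * q' * f + q * r' + q' * r) = 0"
          by (simp add: g(1) h(1) algebra_simps)
        then show "\<rho> (g * h) < \<rho> (g * h - r * r' - f * (q * q' * f + q * r' + q' * r))"
          using \<open>g * h \<noteq> 0\<close> by (simp add: less_le)
        show "\<rho> (r * r') \<le> \<rho> (g * h)" by (simp add: mult g(4) h(4))
      qed
      moreover have "vdvd \<rho> (r * r') 1"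
        using unit g h by (intro vdvd_1_mult) auto
      ultimately show False using nonunit vdvd_1_trans by blast
    qed
  qed
  moreover have "degree f \<le> degree g" using least[of g] assms deg_f by simp
  ultimately show ?thesis by blast
qed

lemma key_poly_not_unit:
  assumes "key_poly \<mu> \<phi>" shows "\<not> vdvd \<mu> \<phi> 1"
proof -
  have "0 < degree \<phi>" "\<forall>f. f \<noteq> 0 \<and> degree f < degree \<phi> \<longrightarrow> \<not> vdvd \<mu> \<phi> f"
    using assms by (auto simp: key_poly_def v_minimal_def)
  then show ?thesis by (metis degree_1 zero_neq_one)
qed

text \<open>A unit initial form stays a unit for a larger valuation, since
  \<open>0 < \<rho> (1 - \<psi> * h)\<close> persists. Hence \<psi>, a non-unit for \<sigma>, is a
  non-unit for \<rho> and bounds the degree of some key polynomial of \<rho>.\<close>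

lemma key_poly_degree_mono:
  assumes "valuation \<rho>" "valuation \<sigma>" "\<rho> \<le> \<sigma>" "key_poly \<sigma> \<psi>"
  shows "\<exists>\<phi>. key_poly \<rho> \<phi> \<and> degree \<phi> \<le> degree \<psi>"
proof (rule key_poly_exists_if_nonunit)
  interpret is_valuation \<rho> by unfold_locales fact
  interpret S: is_valuation \<sigma> by unfold_locales fact
  show "\<psi> \<noteq> 0" using assms(4) by (auto simp: key_poly_def v_minimal_def)
  show "\<not> vdvd \<rho> \<psi> 1"
  proof
    assume "vdvd \<rho> \<psi> 1"
    then obtain h where "\<rho> 1 < \<rho> (1 - \<psi> * h)" by (auto simp: vdvd_def)
    moreover have "\<rho> (1 - \<psi> * h) \<le> \<sigma> (1 - \<psi> * h)" using assms(3) by (simp add: le_fun_def)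
    ultimately have "\<sigma> 1 < \<sigma> (1 - \<psi> * h)" by simp
    then show False using key_poly_not_unit[OF assms(4)] unfolding vdvd_def by blast
  qed
qed fact

text \<open>Both valuations agree on constants, so dividing by the leading coefficient keeps a
  strict inequality. Minimality among monic polynomials therefore yields agreement on all
  polynomials of smaller degree.\<close>

lemma tangent_exists:
  fixes \<rho> \<mu> :: "'f::field poly \<Rightarrow> 'v::linordered_ab_group_add extended"
  assumes "\<rho> \<in> poly_exts v" "\<mu> \<in> poly_exts v" "\<rho> < \<mu>"
  obtains \<phi> where "\<phi> \<in> tangent \<rho> \<mu>" "\<And>f. degree f < degree \<phi> \<Longrightarrow> \<mu> f = \<rho> f"
proof -
  interpret is_valuation \<rho> using assms(1) by unfold_locales (simp add: poly_exts_def)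
  interpret M: is_valuation \<mu> using assms(2) by unfold_locales (simp add: poly_exts_def)
  have const: "\<mu> [:a:] = \<rho> [:a:]" for a using assms(1,2) by (simp add: poly_exts_def)
  have le: "\<rho> f \<le> \<mu> f" for f using assms(3) by (auto simp: less_le intro: le_funD)
  have monic: "\<exists>g. lead_coeff g = 1 \<and> degree g = degree f \<and> \<rho> g < \<mu> g" if "\<rho> f < \<mu> f" for f
  proof -
    have "f \<noteq> 0" using that by auto
    define g where "g = smult (inverse (lead_coeff f)) f"
    have f: "f = [:lead_coeff f:] * g" and g: "lead_coeff g = 1" "degree g = degree f"
      using \<open>f \<noteq> 0\<close> by (auto simp: g_def)
    have lc: "[:lead_coeff f:] \<noteq> 0" using \<open>f \<noteq> 0\<close> by simp
    have "\<rho> [:lead_coeff f:] + \<rho> g < \<rho> [:lead_coeff f:] + \<mu> g"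
      using that const mult[of "[:lead_coeff f:]" g] M.mult[of "[:lead_coeff f:]" g] f by metis
    then have "\<rho> g < \<mu> g" using mult_cancel_less[OF lc] by blast
    then show ?thesis using g by blast
  qed
  let ?P = "\<lambda>f. lead_coeff f = 1 \<and> \<rho> f < \<mu> f"
  have "\<exists>f. \<rho> f < \<mu> f" using assms(3) le by (metis le_funI leD linorder_le_less_linear)
  then obtain f where "?P f" using monic by blast
  then obtain \<phi> where \<phi>: "?P \<phi>" "\<And>h. ?P h \<Longrightarrow> degree \<phi> \<le> degree h"
    using exists_least_iff[of "\<lambda>n. \<exists>h. ?P h \<and> degree h = n"]
    by (metis linorder_le_less_linear)
  show thesis
  proof (rule that)
    show "\<phi> \<in> tangent \<rho> \<mu>" using \<phi> by (auto simp: tangent_def)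
    fix f :: "'f poly" assume "degree f < degree \<phi>"
    then show "\<mu> f = \<rho> f" using \<phi>(2) monic[of f] le[of f] by (fastforce simp: less_le)
  qed
qed

lemma key_poly_tangent:
  fixes \<rho> \<mu> :: "'f::field poly \<Rightarrow> 'v::linordered_ab_group_add extended"
  assumes "\<rho> \<in> poly_exts v" "\<mu> \<in> poly_exts v" "\<rho> \<le> \<mu>" "\<phi> \<in> tangent \<rho> \<mu>"
    "\<And>f. degree f < degree \<phi> \<Longrightarrow> \<mu> f = \<rho> f"
  shows "key_poly \<rho> \<phi>"
  using assms by (intro key_poly_if_tangent[of \<rho> \<mu>])
    (auto simp: poly_exts_def tangent_def intro: valuation_imp_pseudo)

text \<open>The value under \<sigma> is exactly the minimum over the \<phi>-expansion, while under
  \<rho> this minimum is only a lower bound; hence it suffices to compare coefficients and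
  \<phi>.\<close>

lemma v_minimal_le:
  assumes "valuation \<sigma>" "valuation \<rho>" "v_minimal \<sigma> \<phi>" "\<sigma> \<phi> \<le> \<rho> \<phi>"
    "\<And>f. degree f < degree \<phi> \<Longrightarrow> \<sigma> f \<le> \<rho> f"
  shows "\<sigma> \<le> \<rho>"
proof (rule le_funI)
  fix f
  interpret is_valuation \<sigma> by unfold_locales fact
  interpret R: is_valuation \<rho> by unfold_locales fact
  have deg: "0 < degree \<phi>" using assms(3) by (simp add: v_minimal_def)
  show "\<sigma> f \<le> \<rho> f"
  proof (induction "degree f" arbitrary: f rule: less_induct)
    case less
    show ?case
    proof (cases "degree f < degree \<phi>")
      case True
      then show ?thesis by (rule assms(5))
    next
      case False
      define q r where "q = f div \<phi>" and "r = f mod \<phi>"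
      have r: "degree r < degree \<phi>" unfolding r_def by (rule degree_mod_less_pos[OF deg])
      have f_eq: "f = q * \<phi> + r" by (simp add: q_def r_def)
      have "degree q < degree f"
        unfolding q_def using deg False by (intro degree_div_less) auto
      then have "\<sigma> (q * \<phi>) \<le> \<rho> (q * \<phi>)"
        unfolding mult R.mult by (intro add_mono less assms(4))
      moreover have "\<sigma> f = min (\<sigma> (q * \<phi>)) (\<sigma> r)"
        unfolding f_eq by (rule v_minimal_expand[OF assms(1,3) r])
      ultimately have "\<sigma> f \<le> \<rho> (q * \<phi> + r)"
        using assms(5)[OF r] by (intro R.add_geI) (auto simp: min_le_iff_disj)
      then show ?thesis by (simp flip: f_eq)
    qed
  qed
qed

text \<open>Take tangent polynomials \<phi> of \<sigma> and \<psi> of \<rho> towards \<mu>, with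
  \<phi> of the smaller degree. In degrees below \<phi> both valuations agree with \<mu>, so the
  values at \<phi> decide. If \<rho> is smaller there, then \<phi> is tangent for \<rho> as well,
  and the roles can be exchanged.\<close>

lemma comparable_below:
  assumes \<sigma>: "\<sigma> \<in> poly_exts v" and \<rho>: "\<rho> \<in> poly_exts v" and \<mu>: "\<mu> \<in> poly_exts v"
    and le: "\<sigma> \<le> \<mu>" "\<rho> \<le> \<mu>"
  shows "\<sigma> \<le> \<rho> \<or> \<rho> \<le> \<sigma>"
proof (cases "\<sigma> = \<mu> \<or> \<rho> = \<mu>")
  case True
  then show ?thesis using le by auto
next
  case False
  have *: "\<sigma> \<le> \<rho> \<or> \<rho> \<le> \<sigma>" if \<sigma>: "\<sigma> \<in> poly_exts v" "\<sigma> \<le> \<mu>" and \<rho>: "\<rho> \<in> poly_exts v" "\<rho> \<le> \<mu>"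
    and \<phi>: "\<phi> \<in> tangent \<sigma> \<mu>" "\<And>f. degree f < degree \<phi> \<Longrightarrow> \<mu> f = \<sigma> f"
    and \<psi>: "\<psi> \<in> tangent \<rho> \<mu>" "\<And>f. degree f < degree \<psi> \<Longrightarrow> \<mu> f = \<rho> f"
    and deg: "degree \<phi> \<le> degree \<psi>" for \<sigma> \<rho> \<phi> \<psi>
  proof -
    have val: "valuation \<sigma>" "valuation \<rho>" using \<sigma> \<rho> by (auto simp: poly_exts_def)
    have min: "v_minimal \<sigma> \<phi>"
      using key_poly_tangent[OF \<sigma>(1) \<mu> \<sigma>(2) \<phi>] by (simp add: key_poly_def)
    show ?thesis
    proof (cases "\<sigma> \<phi> \<le> \<rho> \<phi>")
      case True
      have "\<sigma> \<le> \<rho>"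
        using True \<phi> \<psi> deg by (intro v_minimal_le[OF val min]) force+
      then show ?thesis by simp
    next
      case False
      then have "\<rho> \<phi> < \<mu> \<phi>" using \<phi>(1) by (auto simp: tangent_def)
      then have "\<phi> \<in> tangent \<rho> \<mu>" and eq: "degree \<phi> = degree \<psi>"
        using deg \<psi>(1) \<phi>(1) by (auto simp: tangent_def intro: antisym dest: order_trans)
      then have "v_minimal \<rho> \<phi>"
        using key_poly_tangent[OF \<rho>(1) \<mu> \<rho>(2), of \<phi>] \<psi>(2) by (simp add: key_poly_def)
      then have "\<rho> \<le> \<sigma>"
        using False \<phi> \<psi> eq by (intro v_minimal_le[OF val(2,1)]) force+
      then show ?thesis by simp
    qed
  qed
  obtain \<phi> where \<phi>: "\<phi> \<in> tangent \<sigma> \<mu>" "\<And>f. degree f < degree \<phi> \<Longrightarrow> \<mu> f = \<sigma> f"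
    using tangent_exists[OF \<sigma> \<mu>] False le by (auto simp: less_le)
  obtain \<psi> where \<psi>: "\<psi> \<in> tangent \<rho> \<mu>" "\<And>f. degree f < degree \<psi> \<Longrightarrow> \<mu> f = \<rho> f"
    using tangent_exists[OF \<rho> \<mu>] False le by (auto simp: less_le)
  show ?thesis
    using *[OF \<sigma> le(1) \<rho> le(2) \<phi> \<psi>] *[OF \<rho> le(2) \<sigma> le(1) \<psi> \<phi>] by linarith
qed

section \<open>The graded algebra\<close>

lemma type_algebra_simps [simp]:
  "\<one>\<^bsub>ring_of_type_algebra\<^esub> = 1" "\<zero>\<^bsub>ring_of_type_algebra\<^esub> = 0"
  "x \<oplus>\<^bsub>ring_of_type_algebra\<^esub> y = x + y" "x \<otimes>\<^bsub>ring_of_type_algebra\<^esub> y = x * y"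
  by (auto simp: ring_of_type_algebra_def)

lemma cring_type_algebra_subset:
  fixes H :: "'a::comm_ring_1 set"
  assumes "1 \<in> H" "\<And>x. x \<in> H \<Longrightarrow> - x \<in> H" "\<And>x y. x \<in> H \<Longrightarrow> y \<in> H \<Longrightarrow> x * y \<in> H"
    "\<And>x y. x \<in> H \<Longrightarrow> y \<in> H \<Longrightarrow> x + y \<in> H"
  shows "cring (ring_of_type_algebra \<lparr>carrier := H\<rparr>)"
proof -
  let ?M = "ring_of_type_algebra :: 'a ring"
  interpret M: cring ?M by (rule cring_from_type_algebra)
  have inv: "\<ominus>\<^bsub>?M\<^esub> x = - x" for x
    by (rule M.minus_equality) (auto simp: ring_of_type_algebra_def)
  have "subring H ?M"
    by (rule M.subringI) (use assms in \<open>auto simp: inv\<close>, auto simp: ring_of_type_algebra_def)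
  then have "subcring H ?M" by (rule M.subcringI')
  then show ?thesis using M.subcring_iff[of H] by (simp add: ring_of_type_algebra_def)
qed

text \<open>Common frame for the two quotients that occur: the graded algebra and the residue field.
  Elements of the quotient are handled through representatives in the underlying type.\<close>

locale type_algebra_quotient =
  fixes H I :: "'a::comm_ring_1 set"
  assumes H: "1 \<in> H" "\<And>x. x \<in> H \<Longrightarrow> - x \<in> H" "\<And>x y. x \<in> H \<Longrightarrow> y \<in> H \<Longrightarrow> x * y \<in> H"
    "\<And>x y. x \<in> H \<Longrightarrow> y \<in> H \<Longrightarrow> x + y \<in> H"
  and I: "I \<subseteq> H" "0 \<in> I" "\<And>x y. x \<in> I \<Longrightarrow> y \<in> I \<Longrightarrow> x + y \<in> I"
    "\<And>x y. x \<in> H \<Longrightarrow> y \<in> I \<Longrightarrow> x * y \<in> I"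
begin

abbreviation S :: "'a ring" where "S \<equiv> ring_of_type_algebra \<lparr>carrier := H\<rparr>"

sublocale S: cring S
  by (rule cring_type_algebra_subset) (fact H)+

lemma minus_I: "x \<in> I \<Longrightarrow> - x \<in> I"
  using I(4)[of "- 1" x] H(1,2) by simp

lemma S_uminus [simp]: "x \<in> H \<Longrightarrow> \<ominus>\<^bsub>S\<^esub> x = - x"
  by (rule S.minus_equality) (auto simp: H)

lemma S_minus [simp]: "x \<in> H \<Longrightarrow> y \<in> H \<Longrightarrow> x \<ominus>\<^bsub>S\<^esub> y = x - y"
  by (simp add: a_minus_def)

sublocale ideal I S
proof (rule idealI)
  show "subgroup I (add_monoid S)"
  proof (rule subgroup.intro)
    fix x assume x: "x \<in> I"
    then have "x \<in> H" using I(1) by auto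
    then have "inv\<^bsub>add_monoid S\<^esub> x = - x" using S_uminus[of x] by (simp add: a_inv_def)
    then show "inv\<^bsub>add_monoid S\<^esub> x \<in> I" using minus_I[OF x] by simp
  qed (use I in auto)
next
  fix a x assume "a \<in> I" "x \<in> carrier S"
  then show "x \<otimes>\<^bsub>S\<^esub> a \<in> I" "a \<otimes>\<^bsub>S\<^esub> x \<in> I"
    using I(4)[of x a] by (simp_all add: mult.commute)
qed (rule S.ring_axioms)

abbreviation coset :: "'a \<Rightarrow> 'a set" where "coset x \<equiv> I +>\<^bsub>S\<^esub> x"

abbreviation Q :: "'a set ring" where "Q \<equiv> S Quot I"

sublocale Q: cring Q
  by (rule quotient_is_cring) (rule S.cring_axioms)

lemma coset_eq_iff: "x \<in> H \<Longrightarrow> y \<in> H \<Longrightarrow> coset x = coset y \<longleftrightarrow> x - y \<in> I"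
  using S.quotient_eq_iff_same_a_r_cos[OF is_ideal, of x y] by simp

lemma coset_mult: "x \<in> H \<Longrightarrow> y \<in> H \<Longrightarrow> coset x \<otimes>\<^bsub>Q\<^esub> coset y = coset (x * y)"
  using rcoset_mult_add[of x y] by (simp add: FactRing_def)

lemma coset_add: "x \<in> H \<Longrightarrow> y \<in> H \<Longrightarrow> coset x \<oplus>\<^bsub>Q\<^esub> coset y = coset (x + y)"
  using a_rcos_sum[of x y] by (simp add: FactRing_def)

lemma coset_1: "\<one>\<^bsub>Q\<^esub> = coset 1"
  by (simp add: FactRing_def)

lemma coset_0: "\<zero>\<^bsub>Q\<^esub> = coset 0"
  using S.a_coset_add_zero[of I] I by (simp add: FactRing_def)

lemma carrier_Q: "carrier Q = coset ` H"
  by (auto simp: FactRing_def A_RCOSETS_defs a_r_coset_def)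

lemma PIdl_iff:
  assumes "u \<in> H" "s \<in> H"
  shows "coset u \<in> PIdl\<^bsub>Q\<^esub> (coset s) \<longleftrightarrow> (\<exists>y\<in>H. u - y * s \<in> I)"
proof -
  have "coset u \<in> PIdl\<^bsub>Q\<^esub> (coset s) \<longleftrightarrow> (\<exists>y\<in>H. coset u = coset y \<otimes>\<^bsub>Q\<^esub> coset s)"
    unfolding cgenideal_def carrier_Q by auto
  also have "\<dots> \<longleftrightarrow> (\<exists>y\<in>H. coset u = coset (y * s))"
    using assms by (simp add: coset_mult cong: bex_cong)
  also have "\<dots> \<longleftrightarrow> (\<exists>y\<in>H. u - y * s \<in> I)"
    using assms H by (intro bex_cong refl coset_eq_iff) auto
  finally show ?thesis .
qed

end

abbreviation (input) lkp where "lkp \<equiv> Poly_Mapping.lookup"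
abbreviation (input) keys where "keys \<equiv> Poly_Mapping.keys"

text \<open>The exponents form a group, so the second index of each product is determined by the
  first and the convolution becomes a single sum.\<close>

lemma lookup_mult_keys:
  fixes u v :: "'a::ab_group_add \<Rightarrow>\<^sub>0 'b::semiring_0"
  shows "lkp (u * v) k =
    (\<Sum>l\<in>keys u. lkp u l * lkp v (k - l))"
proof -
  have "Sum_any (\<lambda>q. lkp v q when k = l + q) = lkp v (k - l)" for l
  proof -
    have "Sum_any (\<lambda>q. lkp v q when k = l + q) = Sum_any (\<lambda>q. lkp v q when q = k - l)"
      by (intro Sum_any.cong) (auto simp: when_def algebra_simps)
    then show ?thesis by simp
  qed
  then have "lkp (u * v) k = Sum_any (\<lambda>l. lkp u l * lkp v (k - l))"
    by (simp add: lookup_mult)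
  also have "\<dots> = (\<Sum>l\<in>keys u. lkp u l * lkp v (k - l))"
    by (rule Sum_any.expand_superset) (auto simp: in_keys_iff)
  finally show ?thesis .
qed

section \<open>Values of rational functions and homogeneous divisibility\<close>

lemma Fract_cases_nonzero:
  obtains f g where "z = Fract f g" "g \<noteq> 0"
  by (cases z) auto

locale poly_valuation = is_valuation w
  for w :: "'f::field poly \<Rightarrow> 'v::linordered_ab_group_add extended"
begin

lemma frac_val_Fract: "g \<noteq> 0 \<Longrightarrow> frac_val w (Fract f g) = w f - w g"
  unfolding frac_val_def
proof (rule the_equality)
  fix t assume g: "g \<noteq> 0" and "\<exists>f' g'. g' \<noteq> 0 \<and> Fract f g = Fract f' g' \<and> t = w f' - w g'"
  then obtain f' g' where g': "g' \<noteq> 0" "Fract f g = Fract f' g'" "t = w f' - w g'" by blast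
  then have "f * g' = f' * g" using g by (simp add: eq_fract)
  then have "w f + w g' = w f' + w g" using mult by metis
  moreover obtain a b where "w g = Fin a" "w g' = Fin b" using finite_value g g' by blast
  ultimately show "t = w f - w g" using g'(3)
    by (cases "w f"; cases "w f'") (auto simp: algebra_simps)
qed auto

lemma valuation_frac_val: "valuation (frac_val w)"
proof -
  have W: "frac_val w (Fract f g) = w f - w g" if "g \<noteq> 0" for f g
    using that by (rule frac_val_Fract)
  have "frac_val w z \<noteq> Minf" "frac_val w z = Pinf \<longleftrightarrow> z = 0" for z
  proof -
    obtain f g where z: "z = Fract f g" "g \<noteq> 0" by (rule Fract_cases_nonzero)
    have "w f \<noteq> Minf" by simp
    moreover obtain a where "w g = Fin a" using finite_value z by blast
    moreover have "z = 0 \<longleftrightarrow> f = 0" using z by (simp add: Zero_fract_def eq_fract)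
    moreover have "w f = Pinf \<longleftrightarrow> f = 0" by simp
    ultimately show "frac_val w z \<noteq> Minf" "frac_val w z = Pinf \<longleftrightarrow> z = 0"
      unfolding z(1) W[OF z(2)] by (cases "w f"; simp)+
  qed
  moreover have "frac_val w (x * y) = frac_val w x + frac_val w y \<and>
    min (frac_val w x) (frac_val w y) \<le> frac_val w (x + y)" for x y
  proof -
    obtain f g where x: "x = Fract f g" "g \<noteq> 0" by (rule Fract_cases_nonzero)
    obtain f' g' where y: "y = Fract f' g'" "g' \<noteq> 0" by (rule Fract_cases_nonzero)
    obtain a where a: "w g = Fin a" using finite_value x by blast
    obtain b where b: "w g' = Fin b" using finite_value y by blast
    have gg: "g * g' \<noteq> 0" using x y by simp
    have "frac_val w (x * y) = (w f + w f') - (w g + w g')"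
      unfolding x(1) y(1) mult_fract W[OF gg] by (simp add: mult)
    then have 1: "frac_val w (x * y) = frac_val w x + frac_val w y"
      unfolding x(1) y(1) W[OF x(2)] W[OF y(2)]
      using a b by (cases "w f"; cases "w f'") auto
    define c where "c = a + b"
    have mono: "mono (\<lambda>p :: 'v extended. p - Fin c)"
    proof (rule monoI)
      fix p q :: "'v extended" assume "p \<le> q"
      then show "p - Fin c \<le> q - Fin c" by (cases p; cases q) auto
    qed
    have "frac_val w x = w (f * g') - Fin c"
      unfolding x(1) W[OF x(2)] mult a b c_def by (cases "w f") auto
    moreover have "frac_val w y = w (f' * g) - Fin c"
      unfolding y(1) W[OF y(2)] mult a b c_def by (cases "w f'") auto
    moreover have "frac_val w (x + y) = w (f * g' + f' * g) - Fin c"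
      unfolding x(1) y(1) add_fract[OF x(2) y(2)] W[OF gg] by (simp add: mult a b c_def)
    ultimately have "min (frac_val w x) (frac_val w y) \<le> frac_val w (x + y)"
      using monoD[OF mono add_ge[of "f * g'" "f' * g"]] min_of_mono[OF mono, of "w (f * g')" "w (f' * g)"] by simp
    with 1 show ?thesis by simp
  qed
  ultimately show ?thesis unfolding valuation_def by blast
qed

sublocale W: is_valuation "frac_val w"
  by unfold_locales (rule valuation_frac_val)

lemma value_group_add:
  assumes "\<alpha> \<in> value_group w" "\<beta> \<in> value_group w" shows "\<alpha> + \<beta> \<in> value_group w"
proof -
  obtain x y where x: "x \<noteq> 0" "frac_val w x = Fin \<alpha>" and y: "y \<noteq> 0" "frac_val w y = Fin \<beta>"
    using assms by (auto simp: value_group_def)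
  then have "frac_val w (x * y) = Fin (\<alpha> + \<beta>)" by (simp add: W.mult)
  then show ?thesis unfolding value_group_def mem_Collect_eq
    by (intro exI[of _ "x * y"]) (use x y in auto)
qed

lemma value_group_uminus:
  assumes "\<alpha> \<in> value_group w" shows "- \<alpha> \<in> value_group w"
proof -
  obtain x where x: "x \<noteq> 0" "frac_val w x = Fin \<alpha>"
    using assms by (auto simp: value_group_def)
  have "Fin \<alpha> + frac_val w (inverse x) = 0"
    using W.mult[of x "inverse x"] x by simp
  moreover obtain b where b: "frac_val w (inverse x) = Fin b"
    using W.finite_value[of "inverse x"] x by auto
  ultimately have "\<alpha> + b = 0" by (simp add: zero_extended_def)
  then have "frac_val w (inverse x) = Fin (- \<alpha>)" using b by (metis minus_unique)
  then show ?thesis unfolding value_group_def mem_Collect_eq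
    by (intro exI[of _ "inverse x"]) (use x in auto)
qed

lemma value_group_0: "0 \<in> value_group w"
  unfolding value_group_def mem_Collect_eq
  by (intro exI[of _ 1]) (simp add: zero_extended_def[symmetric])

lemma value_group_diff: "\<alpha> \<in> value_group w \<Longrightarrow> \<beta> \<in> value_group w \<Longrightarrow> \<alpha> - \<beta> \<in> value_group w"
  using value_group_add[of \<alpha> "- \<beta>"] value_group_uminus by simp

lemma frac_val_poly: "frac_val w (Fract f 1) = w f"
  by (cases "w f") (auto simp: frac_val_Fract zero_extended_def)

lemma value_group_poly: "f \<noteq> 0 \<Longrightarrow> fin_val (w f) \<in> value_group w"
  unfolding value_group_def mem_Collect_eq
  by (intro exI[of _ "Fract f 1"]) (simp add: Zero_fract_def eq_fract frac_val_poly Fin_fin_val_eq)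

text \<open>\<open>graded_dvd \<phi> \<alpha> f\<close> says that the class of \<open>f\<close> in \<open>\<P>\<^sub>\<alpha> / \<P>\<^sub>\<alpha>\<^sup>+\<close> is a multiple of the initial form of \<open>\<phi>\<close>.\<close>
definition graded_dvd :: "'f poly \<Rightarrow> 'v \<Rightarrow> 'f poly \<Rightarrow> bool" where
  "graded_dvd \<phi> \<alpha> f \<longleftrightarrow> (\<exists>h. Fin \<alpha> < w (f - h * \<phi>) \<and> Fin (\<alpha> - fin_val (w \<phi>)) \<le> w h)"

lemma graded_dvd_small: "Fin \<alpha> < w f \<Longrightarrow> graded_dvd \<phi> \<alpha> f"
  unfolding graded_dvd_def by (intro exI[of _ 0]) auto

lemma graded_dvd_add: "graded_dvd \<phi> \<alpha> f \<Longrightarrow> graded_dvd \<phi> \<alpha> g \<Longrightarrow> graded_dvd \<phi> \<alpha> (f + g)"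
  unfolding graded_dvd_def
proof (elim exE conjE)
  fix h k assume *: "Fin \<alpha> < w (f - h * \<phi>)" "Fin (\<alpha> - fin_val (w \<phi>)) \<le> w h"
    "Fin \<alpha> < w (g - k * \<phi>)" "Fin (\<alpha> - fin_val (w \<phi>)) \<le> w k"
  have "Fin \<alpha> < w ((f - h * \<phi>) + (g - k * \<phi>))" using * by (intro add_gtI)
  also have "(f - h * \<phi>) + (g - k * \<phi>) = f + g - (h + k) * \<phi>" by (simp add: algebra_simps)
  finally show "\<exists>h. Fin \<alpha> < w (f + g - h * \<phi>) \<and> Fin (\<alpha> - fin_val (w \<phi>)) \<le> w h"
    using * add_geI by blast
qed

lemma graded_dvd_sum: "(\<And>i. i \<in> A \<Longrightarrow> graded_dvd \<phi> \<alpha> (f i)) \<Longrightarrow> graded_dvd \<phi> \<alpha> (sum f A)"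
  by (induction A rule: infinite_finite_induct) (auto intro: graded_dvd_add graded_dvd_small)

lemma graded_dvd_mult:
  assumes "graded_dvd \<phi> \<alpha> f" "Fin \<beta> \<le> w g" shows "graded_dvd \<phi> (\<alpha> + \<beta>) (f * g)"
proof -
  obtain h where h: "Fin \<alpha> < w (f - h * \<phi>)" "Fin (\<alpha> - fin_val (w \<phi>)) \<le> w h"
    using assms(1) unfolding graded_dvd_def by blast
  have "Fin \<alpha> + Fin \<beta> < w (f - h * \<phi>) + w g"
    using h(1) assms(2) by (intro ext_add_less_le) auto
  moreover have "Fin (\<alpha> - fin_val (w \<phi>)) + Fin \<beta> \<le> w h + w g"
    using h(2) assms(2) by (intro add_mono)
  ultimately show ?thesis unfolding graded_dvd_def
    by (intro exI[of _ "h * g"]) (simp add: algebra_simps flip: mult)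
qed

lemma graded_dvd_uminus: "graded_dvd \<phi> \<alpha> f \<Longrightarrow> graded_dvd \<phi> \<alpha> (- f)"
  using graded_dvd_mult[of \<phi> \<alpha> f 0 "- 1"] by (simp add: minus_one zero_extended_def)

text \<open>If \<open>f\<close> has value exactly \<alpha>, the bound on the cofactor is automatic:
  \<open>vdvd_value\<close> forces its value to be \<alpha> minus that of \<phi>.\<close>

lemma graded_dvd_iff_vdvd:
  assumes "w f = Fin \<alpha>" "\<phi> \<noteq> 0" shows "graded_dvd \<phi> \<alpha> f \<longleftrightarrow> vdvd w \<phi> f"
proof
  assume "vdvd w \<phi> f"
  then obtain h where h: "w f < w (f - \<phi> * h)" by (auto simp: vdvd_def)
  moreover obtain c where "w \<phi> = Fin c" using finite_value assms(2) by blast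
  moreover have "w \<phi> + w h = Fin \<alpha>" using vdvd_value[OF h] assms by simp
  ultimately show "graded_dvd \<phi> \<alpha> f" unfolding graded_dvd_def using assms
    by (intro exI[of _ h]) (cases "w h", auto simp: algebra_simps)
qed (auto simp: graded_dvd_def vdvd_def assms mult.commute)

sublocale G: type_algebra_quotient
  "{u. keys u \<subseteq> value_group w \<and> (\<forall>\<alpha>. Fin \<alpha> \<le> w (lkp u \<alpha>))}" "graded_kernel w"
proof -
  let ?H = "{u. keys u \<subseteq> value_group w \<and> (\<forall>\<alpha>. Fin \<alpha> \<le> w (lkp u \<alpha>))}"
  have keys_mult': "keys (x * y) \<subseteq> value_group w"
    if "keys x \<subseteq> value_group w" "keys y \<subseteq> value_group w"
    for x y :: "'v \<Rightarrow>\<^sub>0 'f poly"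
    using keys_mult[of x y] that value_group_add by fastforce
  have keys_add': "keys (x + y) \<subseteq> value_group w"
    if "keys x \<subseteq> value_group w" "keys y \<subseteq> value_group w"
    for x y :: "'v \<Rightarrow>\<^sub>0 'f poly"
    using Poly_Mapping.keys_add[of x y] that by fastforce
  have lookup_mult_ge: "Fin \<alpha> \<le> w (lkp (x * y) \<alpha>)"
    if "\<forall>\<alpha>. Fin \<alpha> \<le> w (lkp x \<alpha>)" "\<forall>\<alpha>. Fin \<alpha> \<le> w (lkp y \<alpha>)"
    for x y :: "'v \<Rightarrow>\<^sub>0 'f poly" and \<alpha>
    unfolding lookup_mult_keys
  proof (rule sum_geI)
    fix l
    have "Fin l + Fin (\<alpha> - l) \<le> w (lkp x l) + w (lkp y (\<alpha> - l))"
      using that by (intro add_mono) auto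
    then show "Fin \<alpha> \<le> w (lkp x l * lkp y (\<alpha> - l))"
      by (simp add: mult)
  qed
  have lookup_mult_gt: "Fin \<alpha> < w (lkp (x * y) \<alpha>)"
    if "\<forall>\<alpha>. Fin \<alpha> \<le> w (lkp x \<alpha>)" "\<forall>\<alpha>. Fin \<alpha> < w (lkp y \<alpha>)"
    for x y :: "'v \<Rightarrow>\<^sub>0 'f poly" and \<alpha>
    unfolding lookup_mult_keys
  proof (rule sum_gtI)
    fix l
    have "Fin l + Fin (\<alpha> - l) < w (lkp x l) + w (lkp y (\<alpha> - l))"
      using that by (intro ext_add_le_less) auto
    then show "Fin \<alpha> < w (lkp x l * lkp y (\<alpha> - l))"
      by (simp add: mult)
  qed auto
  show "type_algebra_quotient ?H (graded_kernel w)"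
  proof (unfold_locales, goal_cases)
    case 1
    show ?case using value_group_0 by (auto simp: lookup_one when_def zero_extended_def)
  next
    case (2 x)
    then show ?case by simp
  next
    case (3 x y)
    then show ?case using keys_mult'[of x y] lookup_mult_ge[of x y] by simp
  next
    case (4 x y)
    then show ?case using keys_add'[of x y] by (simp add: lookup_add add_geI)
  next
    case 5
    show ?case by (auto simp: graded_kernel_def less_imp_le)
  next
    case 6
    show ?case by (simp add: graded_kernel_def)
  next
    case (7 x y)
    then show ?case using keys_add'[of x y] by (simp add: graded_kernel_def lookup_add add_gtI)
  next
    case (8 x y)
    then show ?case using keys_mult'[of x y] lookup_mult_gt[of x y] by (simp add: graded_kernel_def)
  qed
qed

lemma graded_cover_eq: "graded_cover w = G.S"
  by (simp add: graded_cover_def)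

lemma graded_algebra_eq: "graded_algebra w = G.Q"
  by (simp add: graded_algebra_def graded_cover_eq)

lemma initial_form_eq: "initial_form w f = G.coset (Poly_Mapping.single (fin_val (w f)) f)"
  by (simp add: initial_form_def graded_cover_eq)

abbreviation GH where
 "GH \<equiv> {u. keys u \<subseteq> value_group w \<and> (\<forall>\<alpha>. Fin \<alpha> \<le> w (lkp u \<alpha>))}"

lemma single_carrier: "f \<noteq> 0 \<Longrightarrow> Poly_Mapping.single (fin_val (w f)) f \<in> GH"
  using value_group_poly[of f] Fin_fin_val_eq[of f] by (auto simp: lookup_single when_def)

text \<open>The generator is homogeneous, so membership is decided degree by degree and a cofactor
  can be assembled from homogeneous ones.\<close>

lemma coset_in_PIdl_iff:
  assumes "u \<in> GH" "\<phi> \<noteq> 0"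
  shows "G.coset u \<in> PIdl\<^bsub>G.Q\<^esub> (initial_form w \<phi>) \<longleftrightarrow> (\<forall>\<alpha>. graded_dvd \<phi> \<alpha> (lkp u \<alpha>))"
proof -
  define \<gamma> where "\<gamma> = fin_val (w \<phi>)"
  have \<gamma>: "w \<phi> = Fin \<gamma>" using Fin_fin_val_eq[OF assms(2)] by (simp add: \<gamma>_def)
  have \<gamma>_in: "\<gamma> \<in> value_group w" using value_group_poly[OF assms(2)] by (simp add: \<gamma>_def)
  let ?s = "Poly_Mapping.single \<gamma> \<phi>"
  have s: "?s \<in> GH" using single_carrier[OF assms(2)] by (simp add: \<gamma>_def)
  have lookup_s: "lkp (y * ?s) \<alpha> = lkp y (\<alpha> - \<gamma>) * \<phi>"
    for y :: "'v \<Rightarrow>\<^sub>0 'f poly" and \<alpha>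
  proof -
    have "lkp (?s * y) \<alpha> = \<phi> * lkp y (\<alpha> - \<gamma>)"
      using assms(2) by (simp add: lookup_mult_keys)
    then show ?thesis by (metis mult.commute)
  qed
  have "G.coset u \<in> PIdl\<^bsub>G.Q\<^esub> (initial_form w \<phi>) \<longleftrightarrow> (\<exists>y\<in>GH. u - y * ?s \<in> graded_kernel w)"
    unfolding initial_form_eq using G.PIdl_iff[OF assms(1) s] by (simp add: \<gamma>_def)
  also have "\<dots> \<longleftrightarrow> (\<forall>\<alpha>. graded_dvd \<phi> \<alpha> (lkp u \<alpha>))"
  proof safe
    fix y \<alpha> assume "u - y * ?s \<in> graded_kernel w" "\<forall>\<alpha>. Fin \<alpha> \<le> w (lkp y \<alpha>)"
    then show "graded_dvd \<phi> \<alpha> (lkp u \<alpha>)"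
      unfolding graded_dvd_def
      by (intro exI[of _ "lkp y (\<alpha> - \<gamma>)"])
        (auto simp: graded_kernel_def lookup_minus lookup_s \<gamma>)
  next
    assume "\<forall>\<alpha>. graded_dvd \<phi> \<alpha> (lkp u \<alpha>)"
    then obtain h where h: "\<And>\<alpha>. Fin \<alpha> < w (lkp u \<alpha> - h \<alpha> * \<phi>)"
       "\<And>\<alpha>. Fin (\<alpha> - \<gamma>) \<le> w (h \<alpha>)"
      unfolding graded_dvd_def \<gamma>_def by metis
    \<comment> \<open>The cofactor for degree \<alpha> sits in degree \<alpha> - \<gamma>.
      Restricting to the keys of \<open>u\<close> keeps the support finite; in the remaining degrees
      the component of \<open>u\<close> is 0 and cofactor 0 is enough.\<close>
    define y where "y = (\<Sum>\<alpha>\<in>keys u. Poly_Mapping.single (\<alpha> - \<gamma>) (h \<alpha>))"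
    have ly: "lkp y (\<beta> - \<gamma>) = (if \<beta> \<in> keys u then h \<beta> else 0)" for \<beta>
      by (simp add: y_def lookup_sum lookup_single when_def if_distrib cong: if_cong)
    have ly': "lkp y \<beta> = (if \<beta> + \<gamma> \<in> keys u then h (\<beta> + \<gamma>) else 0)" for \<beta>
      using ly[of "\<beta> + \<gamma>"] by simp
    have ku: "keys u \<subseteq> value_group w" using assms(1) by simp
    have "y \<in> GH"
    proof (intro CollectI conjI allI subsetI)
      fix \<beta> assume "\<beta> \<in> keys y"
      then have "\<beta> + \<gamma> \<in> value_group w" using ku by (auto simp: in_keys_iff ly' split: if_splits)
      then show "\<beta> \<in> value_group w" using value_group_diff[of "\<beta> + \<gamma>" \<gamma>] \<gamma>_in by simp
    next
      fix \<beta> show "Fin \<beta> \<le> w (lkp y \<beta>)" using h(2)[of "\<beta> + \<gamma>"] by (simp add: ly')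
    qed
    moreover have "u - y * ?s \<in> graded_kernel w"
    proof -
      have "u - y * ?s \<in> GH"
        using G.S.minus_closed[of u "y * ?s"] G.H(3)[OF \<open>y \<in> GH\<close> s] assms(1) by simp
      moreover have "Fin \<alpha> < w (lkp (u - y * ?s) \<alpha>)" for \<alpha>
        using h(1)[of \<alpha>] by (auto simp: lookup_minus lookup_s ly in_keys_iff)
      ultimately show ?thesis by (simp add: graded_kernel_def)
    qed
    ultimately show "\<exists>y\<in>GH. u - y * ?s \<in> graded_kernel w" by blast
  qed
  finally show ?thesis .
qed

lemma initial_form_in_PIdl_iff:
  assumes "f \<noteq> 0" "\<phi> \<noteq> 0"
  shows "initial_form w f \<in> PIdl\<^bsub>G.Q\<^esub> (initial_form w \<phi>) \<longleftrightarrow> vdvd w \<phi> f"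
proof -
  have "graded_dvd \<phi> \<alpha> 0" for \<alpha> by (rule graded_dvd_small) simp
  then have "initial_form w f \<in> PIdl\<^bsub>G.Q\<^esub> (initial_form w \<phi>) \<longleftrightarrow> graded_dvd \<phi> (fin_val (w f)) f"
    unfolding initial_form_eq[of f] coset_in_PIdl_iff[OF single_carrier[OF assms(1)] assms(2)]
    by (auto simp: lookup_single when_def)
  also have "\<dots> \<longleftrightarrow> vdvd w \<phi> f"
    by (rule graded_dvd_iff_vdvd) (simp_all add: assms Fin_fin_val_eq)
  finally show ?thesis .
qed

lemma key_poly_if_KP:
  assumes "\<phi> \<in> KP w" shows "key_poly w \<phi>"
proof -
  have monic: "lead_coeff \<phi> = 1" and prime: "primeideal (PIdl\<^bsub>G.Q\<^esub> (initial_form w \<phi>)) G.Q"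
    and nd': "\<And>f. f \<noteq> 0 \<Longrightarrow> degree f < degree \<phi> \<Longrightarrow> initial_form w f \<notin> PIdl\<^bsub>G.Q\<^esub> (initial_form w \<phi>)"
    using assms unfolding KP_def graded_algebra_eq by blast+
  interpret P: primeideal "PIdl\<^bsub>G.Q\<^esub> (initial_form w \<phi>)" G.Q by fact
  have \<phi>: "\<phi> \<noteq> 0" using monic by auto
  have nd: "\<not> vdvd w \<phi> f" if "f \<noteq> 0" "degree f < degree \<phi>" for f
    using nd'[OF that] initial_form_in_PIdl_iff[OF that(1) \<phi>] by simp
  \<comment> \<open>A monic constant would generate the whole algebra, which is not a prime
    ideal.\<close>
  have deg: "degree \<phi> \<noteq> 0"
  proof
    assume "degree \<phi> = 0"
    then have "\<phi> = 1" using monic by (auto elim!: degree_eq_zeroE)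
    then have "vdvd w \<phi> 1" unfolding vdvd_def by (intro exI[of _ 1]) (auto simp: zero_extended_def)
    then have "initial_form w 1 \<in> PIdl\<^bsub>G.Q\<^esub> (initial_form w \<phi>)"
      unfolding initial_form_in_PIdl_iff[OF one_neq_zero \<phi>] .
    moreover have "initial_form w 1 = \<one>\<^bsub>G.Q\<^esub>"
      unfolding initial_form_eq G.coset_1 by (simp add: zero_extended_def)
    ultimately show False using P.one_imp_carrier P.I_notcarr by simp
  qed
  have prm: "vdvd w \<phi> f \<or> vdvd w \<phi> g" if fg: "vdvd w \<phi> (f * g)" for f g
  proof -
    have nz: "f * g \<noteq> 0" using vdvd_nonzero[OF fg] .
    have f: "f \<noteq> 0" and g: "g \<noteq> 0" using nz by auto
    obtain a b where ab: "w f = Fin a" "w g = Fin b" using finite_value f g by blast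
    have "initial_form w f \<otimes>\<^bsub>G.Q\<^esub> initial_form w g = initial_form w (f * g)"
      unfolding initial_form_eq G.coset_mult[OF single_carrier[OF f] single_carrier[OF g]]
      by (simp add: mult_single mult ab)
    moreover have "initial_form w (f * g) \<in> PIdl\<^bsub>G.Q\<^esub> (initial_form w \<phi>)"
      using fg unfolding initial_form_in_PIdl_iff[OF nz \<phi>] .
    moreover have "initial_form w f \<in> carrier G.Q" "initial_form w g \<in> carrier G.Q"
      unfolding initial_form_eq G.carrier_Q by (rule imageI[OF single_carrier[OF f]], rule imageI[OF single_carrier[OF g]])
    ultimately show ?thesis using P.I_prime[of "initial_form w f" "initial_form w g"]
      unfolding initial_form_in_PIdl_iff[OF f \<phi>] initial_form_in_PIdl_iff[OF g \<phi>] by simp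
  qed
  show ?thesis unfolding key_poly_def v_minimal_def
    by (intro conjI allI impI monic prm) (use deg nd in auto)
qed

text \<open>Primality is given for homogeneous elements and has to be extended to sums. If neither
  factor lies in the ideal, take the highest degrees \<alpha> and \<beta> in which their components
  are not multiples of the generator. In degree \<alpha> + \<beta> of the product all other
  contributions are multiples, so the product of the two critical components is one too.\<close>

lemma KP_if_key_poly:
  assumes "key_poly w \<phi>" shows "\<phi> \<in> KP w"
proof -
  have monic: "lead_coeff \<phi> = 1" and deg: "0 < degree \<phi>"
    and nd: "\<And>f. f \<noteq> 0 \<Longrightarrow> degree f < degree \<phi> \<Longrightarrow> \<not> vdvd w \<phi> f"
    and prime: "\<And>f g. vdvd w \<phi> (f * g) \<Longrightarrow> vdvd w \<phi> f \<or> vdvd w \<phi> g"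
    using assms unfolding key_poly_def v_minimal_def by metis+
  have \<phi>: "\<phi> \<noteq> 0" using monic by auto
  have in_car: "initial_form w \<phi> \<in> carrier G.Q"
    unfolding initial_form_eq G.carrier_Q using single_carrier[OF \<phi>] by (rule imageI)
  have "primeideal (PIdl\<^bsub>G.Q\<^esub> (initial_form w \<phi>)) G.Q"
  proof (rule primeidealI)
    show "ideal (PIdl\<^bsub>G.Q\<^esub> (initial_form w \<phi>)) G.Q"
      using in_car by (rule G.Q.cgenideal_ideal)
    show "cring G.Q" by (rule G.Q.cring_axioms)
    have "\<not> vdvd w \<phi> 1" using nd[of 1] deg by simp
    then have "initial_form w 1 \<notin> PIdl\<^bsub>G.Q\<^esub> (initial_form w \<phi>)"
      unfolding initial_form_in_PIdl_iff[OF one_neq_zero \<phi>] .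
    moreover have "initial_form w 1 \<in> carrier G.Q"
      unfolding initial_form_eq G.carrier_Q using single_carrier[OF one_neq_zero] by (rule imageI)
    ultimately show "carrier G.Q \<noteq> PIdl\<^bsub>G.Q\<^esub> (initial_form w \<phi>)" by blast
    fix a b assume a: "a \<in> carrier G.Q" and b: "b \<in> carrier G.Q"
      and ab: "a \<otimes>\<^bsub>G.Q\<^esub> b \<in> PIdl\<^bsub>G.Q\<^esub> (initial_form w \<phi>)"
    obtain u where u: "a = G.coset u" "u \<in> GH" using a unfolding G.carrier_Q by (rule imageE)
    obtain v where v: "b = G.coset v" "v \<in> GH" using b unfolding G.carrier_Q by (rule imageE)
    have "G.coset (u * v) \<in> PIdl\<^bsub>G.Q\<^esub> (initial_form w \<phi>)"
      using ab unfolding u(1) v(1) G.coset_mult[OF u(2) v(2)] .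
    then have uv: "graded_dvd \<phi> \<alpha> (lkp (u * v) \<alpha>)" for \<alpha>
      using coset_in_PIdl_iff[OF G.H(3)[OF u(2) v(2)] \<phi>] by blast
    show "a \<in> PIdl\<^bsub>G.Q\<^esub> (initial_form w \<phi>) \<or> b \<in> PIdl\<^bsub>G.Q\<^esub> (initial_form w \<phi>)"
    proof (rule ccontr)
      assume contra: "\<not> ?thesis"
      let ?B = "\<lambda>u. {\<alpha>. \<not> graded_dvd \<phi> \<alpha> (lkp u \<alpha>)}"
      have fin: "finite (?B u)" for u
        by (rule finite_subset[OF _ finite_keys[of u]])
          (use graded_dvd_small[of _ 0 \<phi>] in \<open>auto simp: in_keys_iff\<close>)
      have ne: "?B u \<noteq> {}" "?B v \<noteq> {}"
        using contra unfolding u(1) v(1) coset_in_PIdl_iff[OF u(2) \<phi>] coset_in_PIdl_iff[OF v(2) \<phi>] by auto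
      define \<alpha> \<beta> where "\<alpha> = Max (?B u)" and "\<beta> = Max (?B v)"
      have \<alpha>: "\<not> graded_dvd \<phi> \<alpha> (lkp u \<alpha>)" "\<And>i. \<alpha> < i \<Longrightarrow> graded_dvd \<phi> i (lkp u i)"
        using Max_in[OF fin ne(1)] Max_ge[OF fin[of u]] unfolding \<alpha>_def by (blast, metis (mono_tags) leD mem_Collect_eq)
      have \<beta>: "\<not> graded_dvd \<phi> \<beta> (lkp v \<beta>)" "\<And>i. \<beta> < i \<Longrightarrow> graded_dvd \<phi> i (lkp v i)"
        using Max_in[OF fin ne(2)] Max_ge[OF fin[of v]] unfolding \<beta>_def by (blast, metis (mono_tags) leD mem_Collect_eq)
      have uge: "Fin i \<le> w (lkp u i)" and vge: "Fin i \<le> w (lkp v i)" for i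
        using u(2) v(2) by auto
      let ?t = "\<lambda>l. lkp u l * lkp v (\<alpha> + \<beta> - l)"
      \<comment> \<open>For any other index, one of the two degrees exceeds its critical value, so
        that factor is already a multiple.\<close>
      have other: "graded_dvd \<phi> (\<alpha> + \<beta>) (?t l)" if "l \<noteq> \<alpha>" for l
      proof (cases "\<alpha> < l")
        case True
        then show ?thesis using graded_dvd_mult[OF \<alpha>(2) vge, of l "\<alpha> + \<beta> - l"] by simp
      next
        case False
        then have "\<beta> < \<alpha> + \<beta> - l" using that by (simp add: algebra_simps)
        from graded_dvd_mult[OF \<beta>(2)[OF this] uge, of l] show ?thesis by (simp add: mult.commute)
      qed
      have ka: "\<alpha> \<in> keys u"
        using \<alpha>(1) graded_dvd_small[of \<alpha> 0 \<phi>] by (auto simp: in_keys_iff)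
      have "graded_dvd \<phi> (\<alpha> + \<beta>) (lkp (u * v) (\<alpha> + \<beta>) + - (\<Sum>l\<in>keys u - {\<alpha>}. ?t l))"
        using other by (intro graded_dvd_add uv graded_dvd_uminus graded_dvd_sum) auto
      also have "lkp (u * v) (\<alpha> + \<beta>) = ?t \<alpha> + (\<Sum>l\<in>keys u - {\<alpha>}. ?t l)"
        unfolding lookup_mult_keys using ka by (intro sum.remove) auto
      finally have dvd: "graded_dvd \<phi> (\<alpha> + \<beta>) (lkp u \<alpha> * lkp v \<beta>)" by simp
      have wu: "w (lkp u \<alpha>) = Fin \<alpha>"
        using uge[of \<alpha>] graded_dvd_small \<alpha>(1) by (metis less_le)
      have wv: "w (lkp v \<beta>) = Fin \<beta>"
        using vge[of \<beta>] graded_dvd_small \<beta>(1) by (metis less_le)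
      have "vdvd w \<phi> (lkp u \<alpha> * lkp v \<beta>)"
        using dvd by (subst (asm) graded_dvd_iff_vdvd) (auto simp: mult wu wv \<phi>)
      then show False using prime \<alpha>(1) \<beta>(1) graded_dvd_iff_vdvd[OF wu \<phi>] graded_dvd_iff_vdvd[OF wv \<phi>] by blast
    qed
  qed
  moreover have "initial_form w f \<notin> PIdl\<^bsub>G.Q\<^esub> (initial_form w \<phi>)" if "f \<noteq> 0" "degree f < degree \<phi>" for f
    using nd[OF that] unfolding initial_form_in_PIdl_iff[OF that(1) \<phi>] .
  ultimately show ?thesis unfolding KP_def graded_algebra_eq using monic by blast
qed

end

lemma KP_eq:
  assumes "valuation \<mu>" shows "KP \<mu> = {\<phi>. key_poly \<mu> \<phi>}"
proof -
  interpret poly_valuation \<mu> by unfold_locales fact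
  show ?thesis using key_poly_if_KP KP_if_key_poly by auto
qed

section \<open>Initial forms of products and powers\<close>

context is_valuation
begin

lemma mult_approx:
  assumes "w x < w (x - x')" "w y < w (y - y')" shows "w (x * y) < w (x * y - x' * y')"
proof -
  have nz: "x \<noteq> 0" "y \<noteq> 0" using assms by auto
  have "w y' = w y" using assms(2) by (rule eq_if_diff_gt)
  then have "y' \<noteq> 0" using nz by (metis eq_Pinf_iff)
  have "w (x * y) < w (x * (y - y'))" using assms(2) nz by (simp add: mult mult_cancel_less)
  moreover have "w (x * y) < w (y' * (x - x'))"
    using mult_cancel_less[OF \<open>y' \<noteq> 0\<close>, of "w x" "w (x - x')"] assms(1) \<open>w y' = w y\<close> by (simp add: mult add.commute)
  ultimately have "w (x * y) < w (x * (y - y') + y' * (x - x'))" by (rule add_gtI)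
  then show ?thesis by (simp add: algebra_simps)
qed

lemma power_approx:
  assumes "w x < w (x - x')" shows "w (x ^ n) < w (x ^ n - x' ^ n)"
proof (induction n)
  case (Suc n)
  then show ?case using mult_approx[OF assms Suc] by simp
qed (auto simp: zero_extended_def)

end

section \<open>Ball valuations\<close>

text \<open>Gauss extension giving the variable the value \<delta>. The coefficients range over a
  domain because the construction is also applied over a polynomial ring, to f(x + y) as a
  polynomial in y.\<close>

definition gauss_val ::
  "('r::idom \<Rightarrow> 'v::linordered_ab_group_add extended) \<Rightarrow> 'v \<Rightarrow> 'r poly \<Rightarrow> 'v extended" where
  "gauss_val w \<delta> f = Min ((\<lambda>k. w (coeff f k) + Fin (nmul k \<delta>)) ` {..degree f})"

lemma ball_val_eq_gauss_val: "ball_val w a \<delta> f = gauss_val w \<delta> (pcompose f [:a, 1:])"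
  by (simp add: ball_val_def gauss_val_def degree_pcompose)

locale domain_valuation = is_valuation w for w :: "'r::idom \<Rightarrow> 'v::linordered_ab_group_add extended"
begin

lemma gauss_val_le: "gauss_val w \<delta> f \<le> w (coeff f k) + Fin (nmul k \<delta>)"
proof (cases "k \<le> degree f")
  case True
  then show ?thesis unfolding gauss_val_def by (intro Min_le) auto
next
  case False
  then show ?thesis by (simp add: coeff_eq_0)
qed

lemma gauss_val_ge: "(\<And>k. t \<le> w (coeff f k) + Fin (nmul k \<delta>)) \<Longrightarrow> t \<le> gauss_val w \<delta> f"
  unfolding gauss_val_def by (intro Min.boundedI) auto

lemma gauss_val_attained: "\<exists>k\<le>degree f. gauss_val w \<delta> f = w (coeff f k) + Fin (nmul k \<delta>)"
proof -
  have "gauss_val w \<delta> f \<in> (\<lambda>k. w (coeff f k) + Fin (nmul k \<delta>)) ` {..degree f}"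
    unfolding gauss_val_def by (intro Min_in) auto
  then show ?thesis by auto
qed

lemma gauss_val_eq_Pinf_iff: "gauss_val w \<delta> f = Pinf \<longleftrightarrow> f = 0"
proof
  assume "gauss_val w \<delta> f = Pinf"
  then have "w (coeff f k) + Fin (nmul k \<delta>) = Pinf" for k
    using gauss_val_le[of \<delta> f k] by simp
  then show "f = 0" by (intro poly_eqI) (auto simp: ext_add_eq_Pinf)
qed (simp add: gauss_val_def)

lemma gauss_val_not_Minf: "gauss_val w \<delta> f \<noteq> Minf"
proof -
  obtain k where "gauss_val w \<delta> f = w (coeff f k) + Fin (nmul k \<delta>)"
    using gauss_val_attained by blast
  then show ?thesis by (cases "w (coeff f k)") auto
qed

lemma gauss_val_add: "min (gauss_val w \<delta> f) (gauss_val w \<delta> g) \<le> gauss_val w \<delta> (f + g)"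
proof (rule gauss_val_ge)
  fix k
  have "min (w (coeff f k)) (w (coeff g k)) + Fin (nmul k \<delta>) \<le> w (coeff (f + g) k) + Fin (nmul k \<delta>)"
    using add_ge by (intro add_mono) auto
  moreover have "min (gauss_val w \<delta> f) (gauss_val w \<delta> g) \<le> min (w (coeff f k)) (w (coeff g k)) + Fin (nmul k \<delta>)"
    using gauss_val_le[of \<delta> f k] gauss_val_le[of \<delta> g k] by (auto simp: min_def split: if_splits)
  ultimately show "min (gauss_val w \<delta> f) (gauss_val w \<delta> g) \<le> w (coeff (f + g) k) + Fin (nmul k \<delta>)"
    by (rule order_trans[rotated])
qed

lemma gauss_val_least:
  assumes "f \<noteq> 0"
  obtains i a where "w (coeff f i) + Fin (nmul i \<delta>) = gauss_val w \<delta> f" "gauss_val w \<delta> f = Fin a"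
    "\<And>l. l < i \<Longrightarrow> gauss_val w \<delta> f < w (coeff f l) + Fin (nmul l \<delta>)"
proof -
  let ?P = "\<lambda>i. w (coeff f i) + Fin (nmul i \<delta>) = gauss_val w \<delta> f"
  have ex: "\<exists>i. ?P i" using gauss_val_attained[of f \<delta>] by metis
  obtain a where "gauss_val w \<delta> f = Fin a"
    using gauss_val_eq_Pinf_iff[of \<delta> f] gauss_val_not_Minf assms by (cases "gauss_val w \<delta> f") auto
  moreover have "?P (LEAST i. ?P i)" using ex by (rule LeastI_ex)
  moreover have "gauss_val w \<delta> f < w (coeff f l) + Fin (nmul l \<delta>)" if "l < (LEAST i. ?P i)" for l
    using not_less_Least[OF that] gauss_val_le[of \<delta> f l] by (auto simp: less_le)
  ultimately show thesis using that by blast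
qed

text \<open>Gauss's lemma: let \<open>i\<close> and \<open>j\<close> be the least indices attaining
  the two minima. In the coefficient of index \<open>i + j\<close> the product of these two terms
  has strictly smallest value, so nothing cancels.\<close>

lemma gauss_val_mult: "gauss_val w \<delta> (f * g) = gauss_val w \<delta> f + gauss_val w \<delta> g"
proof (cases "f = 0 \<or> g = 0")
  case True
  then show ?thesis using gauss_val_eq_Pinf_iff[of \<delta> 0] gauss_val_not_Minf
    by (cases "gauss_val w \<delta> f"; cases "gauss_val w \<delta> g") auto
next
  case False
  let ?t = "\<lambda>f k. w (coeff f k) + Fin (nmul k \<delta>)"
  have split: "w (coeff f l * coeff g (k - l)) + Fin (nmul k \<delta>) = ?t f l + ?t g (k - l)" if "l \<le> k" for k l
    using nmul_add[of l "k - l" \<delta>] that mult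
    by (cases "w (coeff f l)"; cases "w (coeff g (k - l))") (auto simp: algebra_simps)
  obtain i a where i: "?t f i = gauss_val w \<delta> f" "gauss_val w \<delta> f = Fin a"
     "\<And>l. l < i \<Longrightarrow> gauss_val w \<delta> f < ?t f l" using gauss_val_least[of f \<delta>] False by metis
  obtain j b where j: "?t g j = gauss_val w \<delta> g" "gauss_val w \<delta> g = Fin b"
     "\<And>l. l < j \<Longrightarrow> gauss_val w \<delta> g < ?t g l" using gauss_val_least[of g \<delta>] False by metis
  have "gauss_val w \<delta> f + gauss_val w \<delta> g \<le> gauss_val w \<delta> (f * g)"
  proof (rule gauss_val_ge)
    fix k
    have "Fin (a + b - nmul k \<delta>) \<le> w (coeff (f * g) k)"
      unfolding coeff_mult
    proof (rule sum_geI)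
      fix l assume "l \<in> {..k}"
      then have "Fin (a + b) \<le> w (coeff f l * coeff g (k - l)) + Fin (nmul k \<delta>)"
        using add_mono[OF gauss_val_le[of \<delta> f l] gauss_val_le[of \<delta> g "k - l"]] i j by (simp add: split)
      then show "Fin (a + b - nmul k \<delta>) \<le> w (coeff f l * coeff g (k - l))"
        by (cases "w (coeff f l * coeff g (k - l))") (auto simp: algebra_simps)
    qed
    then show "gauss_val w \<delta> f + gauss_val w \<delta> g \<le> ?t (f * g) k"
      using i j by (cases "w (coeff (f * g) k)") (auto simp: algebra_simps)
  qed
  moreover have "w (coeff (f * g) (i + j)) = w (coeff f i * coeff g j)"
  proof -
    have "w (\<Sum>l\<le>i + j. coeff f l * coeff g (i + j - l)) = w (coeff f i * coeff g (i + j - i))"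
    proof (rule sum_eq)
      fix l assume l: "l \<in> {..i + j} - {i}"
      have "?t f i + ?t g j < ?t f l + ?t g (i + j - l)"
      proof (cases "l < i")
        case True
        then show ?thesis unfolding i(1) j(1) using i(2,3) j(2) gauss_val_le[of \<delta> g "i + j - l"]
          by (intro ext_add_less_le) (auto simp: ext_add_eq_Minf)
      next
        case False
        then have "i + j - l < j" using l by auto
        then show ?thesis unfolding i(1) j(1) using i(2) j(2,3) gauss_val_le[of \<delta> f l]
          by (intro ext_add_le_less) (auto simp: ext_add_eq_Minf)
      qed
      then have "w (coeff f i * coeff g (i + j - i)) + Fin (nmul (i + j) \<delta>) <
          w (coeff f l * coeff g (i + j - l)) + Fin (nmul (i + j) \<delta>)"
        using split[of i "i + j"] split[of l "i + j"] l by simp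
      then show "w (coeff f i * coeff g (i + j - i)) < w (coeff f l * coeff g (i + j - l))"
        by (cases "w (coeff f i * coeff g (i + j - i))"; cases "w (coeff f l * coeff g (i + j - l))") auto
    qed auto
    then show ?thesis by (simp add: coeff_mult)
  qed
  then have "gauss_val w \<delta> (f * g) \<le> gauss_val w \<delta> f + gauss_val w \<delta> g"
    using gauss_val_le[of \<delta> "f * g" "i + j"] split[of i "i + j"] i j by simp
  ultimately show ?thesis by (intro antisym)
qed

lemma gauss_val_const: "gauss_val w \<delta> [:c:] = w c"
  by (cases "w c") (auto simp: gauss_val_def)

text \<open>The largest index at which the minimum is attained grows under multiplication by \<open>X + c\<close>.\<close>
lemma gauss_val_attained_pos:
  assumes "f \<noteq> 0" "w c = Fin \<delta>"
  shows "\<exists>s\<ge>1. w (coeff ([:c, 1:] * f) s) + Fin (nmul s \<delta>) = gauss_val w \<delta> ([:c, 1:] * f)"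
proof -
  let ?t = "\<lambda>k. w (coeff f k) + Fin (nmul k \<delta>)"
  let ?S = "{k. k \<le> degree f \<and> gauss_val w \<delta> f = ?t k}"
  have fin: "finite ?S" by simp
  have ne: "?S \<noteq> {}" using gauss_val_attained[of f \<delta>] by auto
  define i where "i = Max ?S"
  have i: "gauss_val w \<delta> f = ?t i" using Max_in[OF fin ne] by (simp add: i_def)
  obtain a where a: "gauss_val w \<delta> f = Fin a"
    using gauss_val_eq_Pinf_iff[of \<delta> f] gauss_val_not_Minf assms by (cases "gauss_val w \<delta> f") auto
  have "gauss_val w \<delta> f < ?t (Suc i)"
  proof (cases "Suc i \<le> degree f")
    case True
    have "\<not> Suc i \<in> ?S" using Max_ge[OF fin, of "Suc i"] unfolding i_def[symmetric] by auto
    then have "gauss_val w \<delta> f \<noteq> ?t (Suc i)" using True by simp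
    then show ?thesis using gauss_val_le[of \<delta> f "Suc i"] by (simp add: less_le)
  next
    case False
    then show ?thesis using a by (simp add: coeff_eq_0)
  qed
  \<comment> \<open>By maximality of \<open>i\<close> the next term of \<open>f\<close> lies
    strictly above the minimum. Since \<open>c\<close> has value \<delta>, the coefficient of index
    \<open>Suc i\<close> in the product keeps the value of \<open>coeff f i\<close>.\<close>
  then have "w (coeff f i) < w (c * coeff f (Suc i))"
    using i a unfolding mult assms(2)
    by (cases "w (coeff f i)"; cases "w (coeff f (Suc i))") (auto simp: nmul_Suc algebra_simps)
  from add_eq[OF this] have "w (coeff ([:c, 1:] * f) (Suc i)) = w (coeff f i)"
    by (simp add: add.commute)
  moreover have "gauss_val w \<delta> [:c, 1:] = Fin \<delta>"
  proof -
    have "{..degree [:c, 1:]} = {0, Suc 0}" by auto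
    moreover have "w 1 + Fin \<delta> = Fin \<delta>" by (simp flip: zero_extended_def)
    ultimately show ?thesis by (simp add: gauss_val_def assms(2))
  qed
  ultimately have "w (coeff ([:c, 1:] * f) (Suc i)) + Fin (nmul (Suc i) \<delta>) = gauss_val w \<delta> ([:c, 1:] * f)"
    unfolding gauss_val_mult i using a by (cases "w (coeff f i)") (auto simp: nmul_Suc algebra_simps)
  then show ?thesis by (intro exI[of _ "Suc i"]) auto
qed

end

locale field_valuation = domain_valuation w for w :: "'l::field \<Rightarrow> 'v::linordered_ab_group_add extended"
begin

lemma ball_val_poly_exts: "ball_val w a \<delta> \<in> poly_exts w"
  unfolding poly_exts_def mem_Collect_eq valuation_def ball_val_eq_gauss_val
  using gauss_val_not_Minf gauss_val_eq_Pinf_iff gauss_val_mult gauss_val_add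
  by (auto simp: pcompose_mult pcompose_add gauss_val_const pcompose_eq_0_iff)

lemma ball_val_linear: "ball_val w a \<delta> [:- r, 1:] = min (w (a - r)) (Fin \<delta>)"
proof -
  have "pcompose [:- r, 1:] [:a, 1:] = [:a - r, 1:]" by (simp add: pcompose_pCons)
  moreover have "{..degree [:a - r, 1:]} = {0, Suc 0}" by auto
  moreover have "w (a - r) + Fin 0 = w (a - r)" "w 1 + Fin \<delta> = Fin \<delta>"
    by (simp_all flip: zero_extended_def)
  ultimately show ?thesis by (simp add: ball_val_eq_gauss_val gauss_val_def)
qed

lemma poly_exts_const: "\<eta> \<in> poly_exts w \<Longrightarrow> \<eta> [:c:] = w c"
  by (simp add: poly_exts_def)

lemma poly_exts_valuation: "\<eta> \<in> poly_exts w \<Longrightarrow> is_valuation \<eta>"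
  by unfold_locales (simp add: poly_exts_def)

lemma poly_exts_linear_ge:
  assumes "\<eta> \<in> poly_exts w" shows "min (\<eta> [:- a, 1:]) (w (a - r)) \<le> \<eta> [:- r, 1:]"
proof -
  interpret E: is_valuation \<eta> using assms by (rule poly_exts_valuation)
  show ?thesis using E.add_ge[of "[:- a, 1:]" "[:a - r:]"] poly_exts_const[OF assms] by simp
qed

lemma poly_exts_linear_diff:
  assumes "\<eta> \<in> poly_exts w" shows "min (\<eta> [:- a, 1:]) (\<eta> [:- r, 1:]) \<le> w (a - r)"
proof -
  interpret E: is_valuation \<eta> using assms by (rule poly_exts_valuation)
  show ?thesis using E.diff_ge[of "[:- r, 1:]" "[:- a, 1:]"] poly_exts_const[OF assms, of "a - r"]
    by (simp add: min.commute)
qed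

end

locale alg_closed_valuation = field_valuation w
  for w :: "'l::alg_closed_field \<Rightarrow> 'v::linordered_ab_group_add extended"
begin

lemma root_factorization:
  fixes f :: "'l poly"
  assumes "f \<noteq> 0"
  obtains A where "set_mset A = {r. poly f r = 0}" "f = smult (lead_coeff f) (\<Prod>r\<in>#A. [:- r, 1:])"
proof -
  obtain A where A: "size A = degree f" "f = smult (lead_coeff f) (\<Prod>r\<in>#A. [:- r, 1:])"
    using alg_closed_imp_factorization[OF assms] by blast
  have "poly f r = 0 \<longleftrightarrow> r \<in># A" for r
    using assms by (subst A(2)) (auto simp: poly_prod_mset prod_mset_zero_iff)
  then show thesis using that A by blast
qed

lemma poly_exts_factor:
  assumes "\<eta> \<in> poly_exts w"
  shows "\<eta> (smult c (\<Prod>r\<in>#A. [:- r, 1:])) = w c + (\<Sum>r\<in>#A. \<eta> [:- r, 1:])"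
proof -
  interpret E: is_valuation \<eta> using assms by (rule poly_exts_valuation)
  have "\<eta> (smult c (\<Prod>r\<in>#A. [:- r, 1:])) = \<eta> ([:c:] * (\<Prod>r\<in>#A. [:- r, 1:]))" by simp
  then show ?thesis unfolding E.mult poly_exts_const[OF assms] E.prod_mset .
qed

lemma poly_exts_le:
  assumes "\<eta> \<in> poly_exts w" "\<eta>' \<in> poly_exts w"
    "\<And>r. poly f r = 0 \<Longrightarrow> \<eta> [:- r, 1:] \<le> \<eta>' [:- r, 1:]"
  shows "\<eta> f \<le> \<eta>' f"
proof (cases "f = 0")
  case True
  interpret E: is_valuation \<eta>' using assms by (intro poly_exts_valuation)
  show ?thesis using True by simp
next
  case False
  obtain A where A: "set_mset A = {r. poly f r = 0}" "f = smult (lead_coeff f) (\<Prod>r\<in>#A. [:- r, 1:])"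
    using root_factorization[OF False] .
  have "\<eta> [:- r, 1:] \<le> \<eta>' [:- r, 1:]" if "r \<in># A" for r using assms(3) A(1) that by auto
  then have "(\<Sum>r\<in>#A. \<eta> [:- r, 1:]) \<le> (\<Sum>r\<in>#A. \<eta>' [:- r, 1:])"
    by (induction A) (auto intro: add_mono)
  then show ?thesis
    by (subst (1 2) A(2)) (simp add: poly_exts_factor assms add_mono)
qed

lemma poly_exts_eq:
  assumes "\<eta> \<in> poly_exts w" "\<eta>' \<in> poly_exts w"
    "\<And>r. poly f r = 0 \<Longrightarrow> \<eta> [:- r, 1:] = \<eta>' [:- r, 1:]"
  shows "\<eta> f = \<eta>' f"
  using poly_exts_le[of \<eta> \<eta>' f] poly_exts_le[of \<eta>' \<eta> f] assms by fastforce

text \<open>One linear factor gains strictly and the cofactor loses nothing; strictness survives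
  because the cofactor has finite value.\<close>

lemma poly_exts_less:
  assumes "\<eta> \<in> poly_exts w" "\<eta>' \<in> poly_exts w" "f \<noteq> 0"
    "\<And>r. poly f r = 0 \<Longrightarrow> \<eta> [:- r, 1:] \<le> \<eta>' [:- r, 1:]"
    "poly f s = 0" "\<eta> [:- s, 1:] < \<eta>' [:- s, 1:]"
  shows "\<eta> f < \<eta>' f"
proof -
  interpret E: is_valuation \<eta> using assms(1) by (rule poly_exts_valuation)
  interpret E': is_valuation \<eta>' using assms(2) by (rule poly_exts_valuation)
  obtain g where g: "f = [:- s, 1:] * g" using assms(5) unfolding poly_eq_0_iff_dvd by (rule dvdE)
  have "g \<noteq> 0" using g assms(3) by auto
  then obtain a where "\<eta> g = Fin a" using E.finite_value by blast
  moreover have "\<eta> g \<le> \<eta>' g"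
  proof (rule poly_exts_le[OF assms(1,2)])
    fix r assume "poly g r = 0"
    then have "poly f r = 0" unfolding g by simp
    then show "\<eta> [:- r, 1:] \<le> \<eta>' [:- r, 1:]" by (rule assms(4))
  qed
  ultimately show ?thesis unfolding g E.mult E'.mult using assms(6)
    by (intro ext_add_less_le) auto
qed

text \<open>On linear polynomials the ball valuation is the lower bound that the ultrametric
  inequality forces on any extension whose value at \<open>x - a\<close> is at least
  \<delta>.\<close>

lemma ball_val_le_iff:
  assumes "\<eta> \<in> poly_exts w" shows "ball_val w a \<delta> \<le> \<eta> \<longleftrightarrow> Fin \<delta> \<le> \<eta> [:- a, 1:]"
proof
  assume "ball_val w a \<delta> \<le> \<eta>"
  then have "ball_val w a \<delta> [:- a, 1:] \<le> \<eta> [:- a, 1:]" by (rule le_funD)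
  then show "Fin \<delta> \<le> \<eta> [:- a, 1:]" by (simp add: ball_val_linear)
next
  assume *: "Fin \<delta> \<le> \<eta> [:- a, 1:]"
  show "ball_val w a \<delta> \<le> \<eta>"
  proof (rule le_funI, rule poly_exts_le[OF ball_val_poly_exts assms])
    fix f r
    show "ball_val w a \<delta> [:- r, 1:] \<le> \<eta> [:- r, 1:]" unfolding ball_val_linear
      using poly_exts_linear_ge[OF assms, of a r] * by (auto simp: min_def split: if_splits)
  qed
qed

text \<open>Each factor \<open>x - r\<close> differs from the constant \<open>a - r\<close> by
  \<open>x - a\<close>, which has larger value. So both have the same initial form, and initial
  forms multiply.\<close>

lemma poly_exts_eval:
  assumes \<eta>: "\<eta> \<in> poly_exts w" and "f \<noteq> 0" and less: "\<And>r. poly f r = 0 \<Longrightarrow> \<eta> [:- r, 1:] < \<eta> [:- a, 1:]"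
  shows "\<eta> f < \<eta> (f - [:poly f a:])"
proof -
  interpret E: is_valuation \<eta> using \<eta> by (rule poly_exts_valuation)
  have const: "\<eta> [:c:] = w c" for c using \<eta> by (rule poly_exts_const)
  obtain A where A: "set_mset A = {r. poly f r = 0}" "f = smult (lead_coeff f) (\<Prod>r\<in>#A. [:- r, 1:])"
    using root_factorization[OF assms(2)] .
  have lc: "lead_coeff f \<noteq> 0" using assms(2) by simp
  define c where "c = lead_coeff f"
  have c: "[:c:] \<noteq> 0" using lc by (simp add: c_def)
  have less': "\<eta> [:- r, 1:] < \<eta> [:- a, 1:]" if "r \<in># A" for r using less A(1) that by auto
  have "\<eta> (smult c (\<Prod>r\<in>#A. [:- r, 1:])) < \<eta> (smult c (\<Prod>r\<in>#A. [:- r, 1:]) - [:poly (smult c (\<Prod>r\<in>#A. [:- r, 1:])) a:])"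
    using less'
  proof (induction A)
    case empty
    have "\<eta> [:c:] \<noteq> Pinf" using c by simp
    then show ?case by (simp add: top.not_eq_extremum less_le)
  next
    case (add r A)
    let ?g = "smult c (\<Prod>r\<in>#A. [:- r, 1:])"
    have eq: "smult c (\<Prod>r\<in>#add_mset r A. [:- r, 1:]) = [:- r, 1:] * ?g"
      unfolding image_mset_add_mset prod_mset.add_mset by (simp only: mult_smult_right)
    have "\<eta> [:- r, 1:] < \<eta> ([:- r, 1:] - [:a - r:])" using add.prems[of r] by simp
    from E.mult_approx[OF this add.IH] add.prems
    have "\<eta> ([:- r, 1:] * ?g) < \<eta> ([:- r, 1:] * ?g - [:a - r:] * [:poly ?g a:])" by simp
    also have "[:a - r:] * [:poly ?g a:] = [:poly ([:- r, 1:] * ?g) a:]" by (simp add: left_diff_distrib mult_ac)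
    finally show ?case unfolding eq .
  qed
  then show ?thesis using A(2) by (simp add: c_def)
qed

end

section \<open>Minimal polynomials\<close>

locale algebraic_closure_of =
  fixes \<iota> :: "'k::field \<Rightarrow> 'l::alg_closed_field"
  assumes embedding: "algebraic_closure_embedding \<iota>"
begin

abbreviation lift :: "'k poly \<Rightarrow> 'l poly" where "lift \<equiv> map_poly \<iota>"
abbreviation mp :: "'l \<Rightarrow> 'k poly" where "mp \<equiv> min_polynomial \<iota>"

lemma \<iota>_add: "\<iota> (x + y) = \<iota> x + \<iota> y" and \<iota>_mult: "\<iota> (x * y) = \<iota> x * \<iota> y" and \<iota>_1 [simp]: "\<iota> 1 = 1"
  and algebraic: "\<exists>p. p \<noteq> 0 \<and> poly (lift p) c = 0"
  using embedding by (auto simp: algebraic_closure_embedding_def)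

lemma \<iota>_0 [simp]: "\<iota> 0 = 0"
  by (metis add.right_neutral add_left_imp_eq \<iota>_add)

lemma \<iota>_uminus: "\<iota> (- x) = - \<iota> x"
  using \<iota>_add[of x "- x"] by (simp add: eq_neg_iff_add_eq_0 add.commute)

lemma \<iota>_eq_0_iff [simp]: "\<iota> x = 0 \<longleftrightarrow> x = 0"
proof
  assume "\<iota> x = 0"
  then have "\<iota> (x * inverse x) = 0" by (simp add: \<iota>_mult)
  then show "x = 0" by (cases "x = 0") auto
qed simp

lemma coeff_lift [simp]: "coeff (lift f) n = \<iota> (coeff f n)"
  by (simp add: coeff_map_poly)

lemma lift_add: "lift (f + g) = lift f + lift g"
  by (intro poly_eqI) (simp add: \<iota>_add)

lemma lift_uminus: "lift (- f) = - lift f"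
  by (intro poly_eqI) (simp add: \<iota>_uminus)

lemma lift_diff: "lift (f - g) = lift f - lift g"
  using lift_add[of f "- g"] by (simp add: lift_uminus)

lemma \<iota>_sum: "\<iota> (sum f A) = (\<Sum>x\<in>A. \<iota> (f x))"
  by (induction A rule: infinite_finite_induct) (auto simp: \<iota>_add)

lemma lift_mult: "lift (f * g) = lift f * lift g"
  by (intro poly_eqI) (simp add: coeff_mult \<iota>_sum \<iota>_mult)

lemma lift_1 [simp]: "lift 1 = 1"
  by (rule map_poly_1') simp

lemma lift_power: "lift (f ^ n) = lift f ^ n"
  by (induction n) (auto simp: lift_mult)

lemma lift_sum: "lift (sum f A) = (\<Sum>x\<in>A. lift (f x))"
  by (induction A rule: infinite_finite_induct) (auto simp: lift_add)

lemma lift_pCons: "lift (pCons a p) = pCons (\<iota> a) (lift p)"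
  by (intro poly_eqI) (auto simp: coeff_pCons split: nat.splits)

lemma lift_smult: "lift (smult a p) = smult (\<iota> a) (lift p)"
  by (intro poly_eqI) (simp add: \<iota>_mult)

lemma degree_lift [simp]: "degree (lift f) = degree f"
  by (rule degree_map_poly) simp

lemma lift_eq_0_iff [simp]: "lift f = 0 \<longleftrightarrow> f = 0"
  by (auto simp: poly_eq_iff)

lemma min_polynomial_exists:
  "\<exists>p. lead_coeff p = 1 \<and> poly (lift p) c = 0 \<and> (\<forall>q. q \<noteq> 0 \<and> poly (lift q) c = 0 \<longrightarrow> degree p \<le> degree q)"
proof -
  let ?P = "\<lambda>q. q \<noteq> 0 \<and> poly (lift q) c = 0"
  obtain q where q: "?P q" "\<And>r. ?P r \<Longrightarrow> degree q \<le> degree r"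
    using algebraic[of c] exists_least_iff[of "\<lambda>n. \<exists>h. ?P h \<and> degree h = n"]
    by (metis linorder_le_less_linear)
  then show ?thesis
    by (intro exI[of _ "smult (inverse (lead_coeff q)) q"]) (auto simp: lift_smult)
qed

lemma min_polynomial_eqI:
  assumes "lead_coeff p = 1" "poly (lift p) c = 0" "\<And>q. q \<noteq> 0 \<Longrightarrow> poly (lift q) c = 0 \<Longrightarrow> degree p \<le> degree q"
  shows "mp c = p"
  unfolding min_polynomial_def
proof (rule the_equality)
  fix q :: "'k poly"
  assume q: "lead_coeff q = 1 \<and> poly (lift q) c = 0 \<and> (\<forall>r. r \<noteq> 0 \<and> poly (lift r) c = 0 \<longrightarrow> degree q \<le> degree r)"
  then have deg: "degree p = degree q"
    using assms by (intro antisym) (metis leading_coeff_0_iff zero_neq_one)+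
  show "q = p"
  proof (rule ccontr)
    assume "q \<noteq> p"
    then have nz: "p - q \<noteq> 0" by simp
    then have "degree p \<le> degree (p - q)" using assms(2) q by (intro assms(3)) (auto simp: lift_diff)
    moreover have "coeff (p - q) (degree p) = 0" using assms(1) q deg by simp
    ultimately have "degree (p - q) = degree p" using degree_diff_le[of p "degree p" q] deg by simp
    then show False using \<open>coeff (p - q) (degree p) = 0\<close> nz by (metis leading_coeff_0_iff)
  qed
qed (use assms in blast)

lemma min_polynomial:
  shows monic_min_polynomial: "lead_coeff (mp c) = 1" and poly_min_polynomial: "poly (lift (mp c)) c = 0"
    and deg_elt_le: "q \<noteq> 0 \<Longrightarrow> poly (lift q) c = 0 \<Longrightarrow> deg_elt \<iota> c \<le> degree q"
proof -
  obtain p where p: "lead_coeff p = 1" "poly (lift p) c = 0"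
    "\<And>q. q \<noteq> 0 \<Longrightarrow> poly (lift q) c = 0 \<Longrightarrow> degree p \<le> degree q"
    using min_polynomial_exists[of c] by blast
  have "mp c = p" using p by (rule min_polynomial_eqI)
  then show "lead_coeff (mp c) = 1" "poly (lift (mp c)) c = 0"
     "q \<noteq> 0 \<Longrightarrow> poly (lift q) c = 0 \<Longrightarrow> deg_elt \<iota> c \<le> degree q"
    using p by (auto simp: deg_elt_def)
qed

lemma min_polynomial_nonzero [simp]: "mp c \<noteq> 0"
  using monic_min_polynomial[of c] by auto

lemma deg_elt_pos: "0 < deg_elt \<iota> c"
proof (rule ccontr)
  assume "\<not> 0 < deg_elt \<iota> c"
  then have "mp c = 1" using monic_min_polynomial[of c] by (auto simp: deg_elt_def elim!: degree_eq_zeroE)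
  then show False using poly_min_polynomial[of c] by simp
qed

lemma deg_elt_base: "deg_elt \<iota> (\<iota> a) = 1"
proof -
  have "deg_elt \<iota> (\<iota> a) \<le> degree [:- a, 1:]"
    by (rule deg_elt_le) (auto simp: lift_pCons \<iota>_uminus)
  then show ?thesis using deg_elt_pos[of "\<iota> a"] by simp
qed

lemma deg_elt_conjugate_le: "poly (lift (mp c)) c' = 0 \<Longrightarrow> deg_elt \<iota> c' \<le> deg_elt \<iota> c"
  using deg_elt_le[of "mp c" c'] by (simp add: deg_elt_def[of _ c])

lemma min_polynomial_conjugate:
  assumes "poly (lift (mp c)) c' = 0" "deg_elt \<iota> c \<le> deg_elt \<iota> c'" shows "mp c' = mp c"
  by (rule min_polynomial_eqI)
    (use assms deg_elt_le[of _ c'] in \<open>auto simp: monic_min_polynomial deg_elt_def intro: order_trans\<close>)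

lemma poly_lift_nonzero:
  assumes "f \<noteq> 0" "degree f < deg_elt \<iota> c" shows "poly (lift f) c \<noteq> 0"
  using deg_elt_le[of f c] assms by auto

text \<open>Inversion in K(c) by Euclidean descent: writing \<open>mp c = q * f + r\<close>
  expresses \<open>f\<close> at \<open>c\<close> through \<open>q\<close> and \<open>r\<close>, and
  an inverse for \<open>r\<close> gives one for \<open>f\<close>. The remainder is nonzero, since
  otherwise \<open>q\<close> or \<open>f\<close> would vanish at \<open>c\<close> in too small a
  degree.\<close>

lemma inverse_mod_min_polynomial:
  assumes "f \<noteq> 0" "degree f < deg_elt \<iota> c"
  shows "\<exists>a. degree a < deg_elt \<iota> c \<and> poly (lift (a * f)) c = 1"
proof -
  have "\<exists>a. poly (lift (a * f)) c = 1"
    using assms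
  proof (induction "degree f" arbitrary: f rule: less_induct)
    case less
    show ?case
    proof (cases "degree f = 0")
      case True
      then obtain b where b: "f = [:b:]" by (auto elim: degree_eq_zeroE)
      then show ?thesis using less.prems by (intro exI[of _ "[:inverse b:]"]) (simp flip: one_pCons)
    next
      case False
      define q r where "q = mp c div f" and "r = mp c mod f"
      have eq: "mp c = q * f + r" by (simp add: q_def r_def)
      have rdeg: "degree r < degree f" unfolding r_def using False by (intro degree_mod_less_pos) simp
      have q_deg: "degree q < deg_elt \<iota> c"
        unfolding q_def deg_elt_def using False less.prems by (intro degree_div_less) (auto simp: deg_elt_def)
      have 0: "poly (lift q) c * poly (lift f) c + poly (lift r) c = 0"
        using poly_min_polynomial[of c] unfolding eq by (simp add: lift_add lift_mult)
      have "r \<noteq> 0"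
      proof
        assume "r = 0"
        then have "q \<noteq> 0" using eq min_polynomial_nonzero[of c] by auto
        then show False using 0 \<open>r = 0\<close> poly_lift_nonzero[of q c] poly_lift_nonzero[of f c] q_deg less.prems by simp
      qed
      then obtain a where "poly (lift (a * r)) c = 1"
        using less.hyps[of r] rdeg less.prems by auto
      moreover have "poly (lift r) c = - (poly (lift q) c * poly (lift f) c)"
        using 0 by (simp add: eq_neg_iff_add_eq_0 add.commute)
      ultimately have "poly (lift ((- (a * q)) * f)) c = 1"
        by (simp add: lift_mult lift_uminus mult.assoc)
      then show ?thesis by blast
    qed
  qed
  then obtain a where a: "poly (lift (a * f)) c = 1" by blast
  have "lift a = lift (a div mp c * mp c + a mod mp c)" by (simp only: div_mult_mod_eq)
  also have "\<dots> = lift (a div mp c) * lift (mp c) + lift (a mod mp c)" by (simp only: lift_add lift_mult)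
  finally have "lift a = lift (a div mp c) * lift (mp c) + lift (a mod mp c)" .
  then have "poly (lift (a mod mp c)) c = poly (lift a) c" by (simp add: poly_min_polynomial)
  moreover have "degree (a mod mp c) < deg_elt \<iota> c"
    unfolding deg_elt_def using deg_elt_pos[of c] by (intro degree_mod_less_pos) (simp add: deg_elt_def)
  ultimately show ?thesis using a by (intro exI[of _ "a mod mp c"]) (simp add: lift_mult)
qed

lemma deg_set_least: "c \<in> S \<Longrightarrow> deg_set \<iota> S \<le> deg_elt \<iota> c"
  unfolding deg_set_def by (rule Least_le) blast

lemma Min_deg_nonempty:
  assumes "S \<noteq> {}" shows "\<exists>c. c \<in> Min_deg \<iota> S"
proof -
  have "\<exists>n. \<exists>c\<in>S. n = deg_elt \<iota> c" using assms by auto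
  from LeastI_ex[OF this] show ?thesis unfolding Min_deg_def deg_set_def by auto
qed

end

section \<open>Hasse-Schmidt derivatives and Taylor expansion\<close>

lemma hasse_pCons:
  "hasse s (pCons a p) = (if s = 0 then [:a:] else 0) + pCons 0 (hasse s p) + (case s of 0 \<Rightarrow> 0 | Suc t \<Rightarrow> hasse t p)"
proof -
  have "map_poly (\<lambda>a. [:a:]) (pCons a p) = pCons [:a:] (map_poly (\<lambda>a. [:a:]) p)"
    by (simp add: map_poly_pCons)
  then show ?thesis unfolding hasse_def by (auto simp: pcompose_pCons coeff_pCons split: nat.splits)
qed

lemma hasse_0 [simp]: "hasse s 0 = 0"
  by (simp add: hasse_def)

lemma hasse_smult: "hasse s (smult c f) = smult c (hasse s f)"
  by (induction f arbitrary: s) (auto simp: hasse_pCons smult_add_right split: nat.splits)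

lemma hasse_add: "hasse s (f + g) = hasse s f + hasse s g"
  by (induction f g arbitrary: s rule: poly_induct2) (auto simp: hasse_pCons algebra_simps split: nat.splits)

lemma hasse_zeroth: "hasse 0 f = f"
  by (induction f) (auto simp: hasse_pCons)

lemma hasse_eq_0: "degree f < s \<Longrightarrow> hasse s f = 0"
  by (induction f arbitrary: s) (auto simp: hasse_pCons split: nat.splits if_splits)

definition taylor :: "'f::field poly \<Rightarrow> 'f poly poly" where
  "taylor f = pcompose (map_poly (\<lambda>a. [:a:]) f) [:[:0, 1:], 1:]"

lemma coeff_taylor: "coeff (taylor f) s = hasse s f"
  by (simp add: taylor_def hasse_def)

text \<open>The factor \<open>x - r\<close> becomes \<open>(x - r) + y\<close>, so a split
  polynomial has a Taylor expansion that splits into linear polynomials in y.\<close>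

lemma taylor_linear_mult: "taylor ([:- r, 1:] * f) = [:[:- r, 1:], 1:] * taylor f"
proof (rule poly_eqI)
  fix s
  have "[:- r, 1:] * f = pCons 0 f + smult (- r) f" by simp
  then have "hasse s ([:- r, 1:] * f) = hasse s (pCons 0 f) + smult (- r) (hasse s f)"
    by (simp only: hasse_add hasse_smult)
  then show "coeff (taylor ([:- r, 1:] * f)) s = coeff ([:[:- r, 1:], 1:] * taylor f) s"
    by (cases s) (simp_all add: coeff_taylor hasse_pCons)
qed

context algebraic_closure_of
begin

lemma lift_hasse: "lift (hasse s f) = hasse s (lift f)"
  by (induction f arbitrary: s) (auto simp: hasse_pCons lift_add lift_pCons split: nat.splits)

end

section \<open>Values of polynomials over the base field\<close>

locale valued_closure = algebraic_closure_of \<iota> + alg_closed_valuation w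
  for \<iota> :: "'k::field \<Rightarrow> 'l::alg_closed_field" and w :: "'l \<Rightarrow> 'v::linordered_ab_group_add extended"
begin

lemma restr_poly_exts:
  assumes "\<eta> \<in> poly_exts w" shows "restr \<iota> \<eta> \<in> poly_exts (w \<circ> \<iota>)"
proof -
  interpret E: is_valuation \<eta> using assms by (rule poly_exts_valuation)
  have "restr \<iota> \<eta> [:a:] = w (\<iota> a)" for a
    using poly_exts_const[OF assms] by (simp add: restr_def lift_pCons)
  moreover have "valuation (restr \<iota> \<eta>)"
    unfolding valuation_def restr_def using E.add_ge by (auto simp: lift_mult lift_add E.mult)
  ultimately show ?thesis by (simp add: poly_exts_def)
qed

lemma restr_valuation: "\<eta> \<in> poly_exts w \<Longrightarrow> valuation (restr \<iota> \<eta>)"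
  using restr_poly_exts by (auto simp: poly_exts_def)

lemma restr_mono: "\<eta> \<le> \<eta>' \<Longrightarrow> restr \<iota> \<eta> \<le> restr \<iota> \<eta>'"
  by (auto simp: restr_def le_fun_def)

text \<open>Give y the value \<gamma> in f(x + y), a product of factors \<open>(x - r) + y\<close>.
  Since \<gamma> bounds the values of all \<open>x - r\<close>, the Gauss valuation of this product
  equals the value of \<open>f\<close>. So every derivative satisfies \<mu>(f) \<le>
  \<mu>(\<partial>_s f) + s\<gamma>, which is the upper bound for the quotients in
  \<open>eps\<close>; equality for some positive order comes from the root attaining
  \<gamma>.\<close>

lemma eps_eqI:
  assumes \<eta>: "\<eta> \<in> poly_exts w" and "f \<noteq> 0" and le: "\<And>r. poly (lift f) r = 0 \<Longrightarrow> \<eta> [:- r, 1:] \<le> Fin \<gamma>"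
    and s: "poly (lift f) s = 0" "\<eta> [:- s, 1:] = Fin \<gamma>"
  shows "eps (restr \<iota> \<eta>) f = \<gamma>"
proof -
  interpret E: is_valuation \<eta> using \<eta> by (rule poly_exts_valuation)
  interpret E: domain_valuation \<eta> by unfold_locales
  interpret R: is_valuation "restr \<iota> \<eta>" using restr_valuation[OF \<eta>] by unfold_locales
  let ?F = "lift f"
  have F: "?F \<noteq> 0" using assms(2) by simp
  let ?G = "gauss_val \<eta> \<gamma>"
  have factor: "?G (taylor g) = \<eta> g" if "g \<noteq> 0" "\<And>r. poly g r = 0 \<Longrightarrow> \<eta> [:- r, 1:] \<le> Fin \<gamma>" for g
    using that
  proof (induction "degree g" arbitrary: g rule: less_induct)
    case less
    show ?case
    proof (cases "degree g = 0")
      case True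
      then obtain a where "g = [:a:]" by (auto elim: degree_eq_zeroE)
      then have "taylor g = [:[:a:]:]" by (simp add: taylor_def map_poly_pCons)
      then show ?thesis using \<open>g = [:a:]\<close> E.gauss_val_const by simp
    next
      case False
      then obtain r where r: "poly g r = 0" using alg_closed_imp_poly_has_root[of g] by auto
      then obtain h where h: "g = [:- r, 1:] * h" unfolding poly_eq_0_iff_dvd by (rule dvdE)
      have "h \<noteq> 0" using h less.prems(1) by auto
      then have "degree g = Suc (degree h)" unfolding h by (subst degree_mult_eq) auto
      moreover have "\<eta> [:- r', 1:] \<le> Fin \<gamma>" if "poly h r' = 0" for r'
        by (rule less.prems(2)) (unfold h, simp add: that)
      ultimately have IH: "?G (taylor h) = \<eta> h" using less.hyps[of h] \<open>h \<noteq> 0\<close> by simp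
      have "?G [:[:- r, 1:], 1:] = \<eta> [:- r, 1:]"
      proof -
        have "{..degree [:[:- r, 1:], 1:]} = {0, Suc 0}" by auto
        moreover have "\<eta> [:- r, 1:] + Fin 0 = \<eta> [:- r, 1:]" "\<eta> 1 + Fin \<gamma> = Fin \<gamma>"
          by (simp_all flip: zero_extended_def)
        ultimately show ?thesis using less.prems(2)[OF r] by (simp add: gauss_val_def min_absorb1)
      qed
      then show ?thesis unfolding h taylor_linear_mult E.gauss_val_mult IH E.mult by simp
    qed
  qed
  have G: "?G (taylor ?F) = \<eta> ?F" using factor[OF F le] .
  obtain H where H: "?F = [:- s, 1:] * H" using s(1) unfolding poly_eq_0_iff_dvd by (rule dvdE)
  have "H \<noteq> 0" using H F by auto
  then have tH: "taylor H \<noteq> 0" using coeff_taylor[of H 0] by (auto simp: hasse_zeroth)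
  \<comment> \<open>The constant term \<open>x - s\<close> of the factor belonging to
    \<open>s\<close> has value exactly \<gamma>, so the minimum is attained at a positive
    index.\<close>
  obtain m where m: "m \<ge> 1" "\<eta> (coeff (taylor ?F) m) + Fin (nmul m \<gamma>) = ?G (taylor ?F)"
    using E.gauss_val_attained_pos[OF tH s(2)] unfolding H taylor_linear_mult by blast
  define \<rho> where "\<rho> = restr \<iota> \<eta>"
  have val: "\<rho> (hasse k f) = \<eta> (coeff (taylor ?F) k)" for k
    by (simp add: \<rho>_def restr_def lift_hasse coeff_taylor)
  have val0: "\<rho> f = \<eta> ?F" by (simp add: \<rho>_def restr_def)
  obtain a where a: "\<rho> f = Fin a" using R.finite_value[OF assms(2)] by (auto simp: \<rho>_def)
  let ?T = "{t. \<exists>k\<ge>1. hasse k f \<noteq> 0 \<and> nmul k t = fin_val (\<rho> f) - fin_val (\<rho> (hasse k f))}"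
  have "Max ?T = \<gamma>"
  proof (rule Max_eqI)
    \<comment> \<open>Finiteness, without which \<open>Max\<close> carries no information:
      derivatives vanish beyond the degree, and division by a positive integer has at most one
      result.\<close>
    have "?T \<subseteq> (\<Union>k\<in>{1..degree f}. {t. nmul k t = fin_val (\<rho> f) - fin_val (\<rho> (hasse k f))})"
      using hasse_eq_0[of f] by (fastforce simp: not_less[symmetric])
    moreover have "finite {t. nmul k t = u}" if "k \<in> {1..degree f}" for k and u :: 'v
    proof (rule finite_subset)
      show "{t. nmul k t = u} \<subseteq> {THE t. nmul k t = u}"
        using that nmul_inject[of k] by (auto intro!: the_equality[symmetric])
    qed simp
    ultimately show "finite ?T" by (meson finite_UN_I finite_atLeastAtMost finite_subset)
    fix t assume "t \<in> ?T"
    then obtain k where k: "k \<ge> 1" "hasse k f \<noteq> 0" "nmul k t = fin_val (\<rho> f) - fin_val (\<rho> (hasse k f))" by blast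
    obtain b where b: "\<rho> (hasse k f) = Fin b" using R.finite_value[OF k(2)] by (auto simp: \<rho>_def)
    have "Fin a \<le> Fin b + Fin (nmul k \<gamma>)"
      using E.gauss_val_le[of \<gamma> "taylor ?F" k] a b unfolding G val val0 by simp
    then have "b + nmul k t \<le> b + nmul k \<gamma>" using k(3) a b by simp
    then have "nmul k t \<le> nmul k \<gamma>" by simp
    then show "t \<le> \<gamma>" using nmul_strict_mono[of k \<gamma> t] k(1) by (meson less_le_trans linorder_not_le zero_less_one order.strict_trans1 less_irrefl)
  next
    have eq: "\<rho> (hasse m f) + Fin (nmul m \<gamma>) = Fin a" using m(2) a unfolding G val val0 by simp
    then obtain b where b: "\<rho> (hasse m f) = Fin b" by (cases "\<rho> (hasse m f)") auto
    then have "hasse m f \<noteq> 0" by (auto simp: \<rho>_def)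
    moreover have "nmul m \<gamma> = a - b" using eq b by (simp add: algebra_simps)
    ultimately show "\<gamma> \<in> ?T" using m(1) a b by auto
  qed
  then show ?thesis by (simp add: eps_def \<rho>_def)
qed

lemma poly_exts_linear_finite:
  assumes "\<eta> \<in> poly_exts w" obtains a where "\<eta> [:- r, 1:] = Fin a"
proof -
  interpret E: is_valuation \<eta> using assms by (rule poly_exts_valuation)
  show thesis using E.finite_value[of "[:- r, 1:]"] that by auto
qed

lemma max_root:
  assumes \<eta>: "\<eta> \<in> poly_exts w" and f: "0 < degree f"
  obtains s where "poly (lift f) s = 0" "\<And>r. poly (lift f) r = 0 \<Longrightarrow> \<eta> [:- r, 1:] \<le> \<eta> [:- s, 1:]"
    "\<eta> [:- s, 1:] = Fin (eps (restr \<iota> \<eta>) f)"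
proof -
  let ?R = "{r. poly (lift f) r = 0}"
  have nz: "f \<noteq> 0" using f by auto
  have fin: "finite ?R" using nz by (intro poly_roots_finite) simp
  have ne: "?R \<noteq> {}" using alg_closed_imp_poly_has_root[of "lift f"] f by auto
  let ?V = "(\<lambda>r. \<eta> [:- r, 1:]) ` ?R"
  have "Max ?V \<in> ?V" "\<And>r. r \<in> ?R \<Longrightarrow> \<eta> [:- r, 1:] \<le> Max ?V"
    using fin ne by (intro Max_in Max_ge; simp)+
  then obtain s where s: "s \<in> ?R" "\<And>r. r \<in> ?R \<Longrightarrow> \<eta> [:- r, 1:] \<le> \<eta> [:- s, 1:]" by auto
  obtain a where a: "\<eta> [:- s, 1:] = Fin a" using \<eta> by (rule poly_exts_linear_finite)
  have "eps (restr \<iota> \<eta>) f = a" using s a by (intro eps_eqI[OF \<eta> nz, of a s]) auto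
  then show thesis using that s a by auto
qed

lemma ball_val_root_less:
  assumes "\<And>r. Fin \<gamma> \<le> w (r - c) \<Longrightarrow> deg_elt \<iota> c \<le> deg_elt \<iota> r"
    and "f \<noteq> 0" "degree f < deg_elt \<iota> c" "poly (lift f) r = 0"
  shows "ball_val w c \<gamma> [:- r, 1:] < ball_val w c \<gamma> [:- c, 1:]"
proof -
  have "deg_elt \<iota> r < deg_elt \<iota> c" using deg_elt_le[OF assms(2,4)] assms(3) by simp
  then have "w (c - r) < Fin \<gamma>" using assms(1)[of r] by (auto simp: diff_commute[of c r] not_le[symmetric])
  then show ?thesis by (simp add: ball_val_linear)
qed

text \<open>The larger function is evaluation at \<open>c\<close>. It agrees with the ball valuation
  in degrees below that of \<open>c\<close>, where no root lies in the ball, and it is infinite at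
  the minimal polynomial.\<close>

lemma key_poly_min_polynomial:
  assumes "\<And>r. Fin \<gamma> \<le> w (r - c) \<Longrightarrow> deg_elt \<iota> c \<le> deg_elt \<iota> r"
  shows "key_poly (restr \<iota> (ball_val w c \<gamma>)) (mp c)"
proof (rule key_poly_if_tangent)
  let ?\<eta> = "ball_val w c \<gamma>"
  interpret E: is_valuation ?\<eta> using ball_val_poly_exts by (rule poly_exts_valuation)
  interpret R: is_valuation "restr \<iota> ?\<eta>" using restr_valuation[OF ball_val_poly_exts] by unfold_locales
  show "valuation (restr \<iota> ?\<eta>)" by (rule R.valuation)
  show "pseudo_valuation (\<lambda>f. w (poly (lift f) c))"
    by unfold_locales (auto simp: lift_mult mult lift_add add_ge)
  show "restr \<iota> ?\<eta> \<le> (\<lambda>f. w (poly (lift f) c))"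
  proof (rule le_funI)
    fix f
    have "coeff (pcompose (lift f) [:c, 1:]) 0 = poly (lift f) c"
      by (simp add: coeff_pcompose_0)
    then show "restr \<iota> ?\<eta> f \<le> w (poly (lift f) c)"
      using gauss_val_le[of \<gamma> "pcompose (lift f) [:c, 1:]" 0]
      by (simp add: restr_def ball_val_eq_gauss_val flip: zero_extended_def)
  qed
  show "lead_coeff (mp c) = 1" by (rule monic_min_polynomial)
  have "restr \<iota> ?\<eta> (mp c) \<noteq> Pinf" by simp
  then show "restr \<iota> ?\<eta> (mp c) < w (poly (lift (mp c)) c)"
    using R.not_Minf[of "mp c"] by (cases "restr \<iota> ?\<eta> (mp c)") (auto simp: poly_min_polynomial)
  fix f :: "'k poly" assume f: "degree f < degree (mp c)"
  show "w (poly (lift f) c) = restr \<iota> ?\<eta> f"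
  proof (cases "f = 0")
    case False
    have "?\<eta> (lift f) < ?\<eta> (lift f - [:poly (lift f) c:])"
      using False f ball_val_root_less[OF assms False] by (intro poly_exts_eval ball_val_poly_exts) (auto simp: deg_elt_def)
    from E.eq_if_diff_gt[OF this] show ?thesis
      using poly_exts_const[OF ball_val_poly_exts] by (simp add: restr_def)
  qed simp
qed

text \<open>In smaller degree \<psi> has an inverse modulo the minimal polynomial of
  \<open>c\<close>, again of small degree. Both have the initial forms of their constants at
  \<open>c\<close>, whose product is 1, so \<psi> would be a unit.\<close>

lemma degree_key_poly_ge:
  assumes min: "\<And>r. Fin \<gamma> \<le> w (r - c) \<Longrightarrow> deg_elt \<iota> c \<le> deg_elt \<iota> r"
    and key: "key_poly (restr \<iota> (ball_val w c \<gamma>)) \<psi>"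
  shows "deg_elt \<iota> c \<le> degree \<psi>"
proof (rule ccontr)
  let ?\<eta> = "ball_val w c \<gamma>"
  interpret E: is_valuation ?\<eta> using ball_val_poly_exts by (rule poly_exts_valuation)
  assume "\<not> deg_elt \<iota> c \<le> degree \<psi>"
  then have deg: "degree \<psi> < deg_elt \<iota> c" by simp
  have nz: "\<psi> \<noteq> 0" using key by (auto simp: key_poly_def v_minimal_def)
  obtain a where a: "degree a < deg_elt \<iota> c" "poly (lift (a * \<psi>)) c = 1"
    using inverse_mod_min_polynomial[OF nz deg] by blast
  have "a \<noteq> 0" using a by auto
  have approx: "?\<eta> (lift f) < ?\<eta> (lift f - [:poly (lift f) c:])" if "f \<noteq> 0" "degree f < deg_elt \<iota> c" for f
    using that ball_val_root_less[OF min that] by (intro poly_exts_eval ball_val_poly_exts) auto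
  have "?\<eta> (lift a * lift \<psi>) < ?\<eta> (lift a * lift \<psi> - [:poly (lift a) c:] * [:poly (lift \<psi>) c:])"
    by (intro E.mult_approx approx nz deg a \<open>a \<noteq> 0\<close>)
  also have "[:poly (lift a) c:] * [:poly (lift \<psi>) c:] = 1" using a(2) by (simp add: lift_mult one_pCons mult.commute)
  finally have *: "?\<eta> (lift a * lift \<psi>) < ?\<eta> (lift a * lift \<psi> - 1)" .
  from E.eq_if_diff_gt[OF *] have "?\<eta> (lift a * lift \<psi>) = 0" by simp
  then have "restr \<iota> ?\<eta> 1 < restr \<iota> ?\<eta> (1 - \<psi> * a)"
    using * E.diff_commute[of "lift a * lift \<psi>" 1] by (simp add: restr_def lift_diff lift_mult mult.commute)
  then have "vdvd (restr \<iota> ?\<eta>) \<psi> 1" unfolding vdvd_def by blast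
  then show False using key_poly_not_unit[OF key] by simp
qed

lemma trans_deg_ball_val:
  assumes min: "\<And>r. Fin \<gamma> \<le> w (r - c) \<Longrightarrow> deg_elt \<iota> c \<le> deg_elt \<iota> r"
  shows "trans_deg (restr \<iota> (ball_val w c \<gamma>)) = deg_elt \<iota> c"
  unfolding trans_deg_def KP_eq[OF restr_valuation[OF ball_val_poly_exts]]
proof (rule Least_equality)
  show "\<exists>\<phi>\<in>{\<phi>. key_poly (restr \<iota> (ball_val w c \<gamma>)) \<phi>}. deg_elt \<iota> c = degree \<phi>"
    using key_poly_min_polynomial[OF min] by (auto simp: deg_elt_def)
qed (use degree_key_poly_ge[OF min] in auto)

end

section \<open>Valuation-transcendental valuations\<close>

lemma map_poly_hom_add:
  fixes h :: "'a::comm_ring_1 \<Rightarrow> 'b::comm_ring_1"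
  assumes "h 0 = 0" "\<And>x y. h (x + y) = h x + h y"
  shows "map_poly h (p + q) = map_poly h p + map_poly h q"
  by (intro poly_eqI) (simp add: coeff_map_poly assms)

section \<open>Transcendence of residues in terms of values\<close>

context poly_valuation
begin

definition const_fract :: "'f \<Rightarrow> 'f poly fract" where "const_fract a = Fract [:a:] 1"

lemma const_fract_0 [simp]: "const_fract 0 = 0"
  by (simp add: const_fract_def Zero_fract_def)

lemma const_fract_add: "const_fract (a + b) = const_fract a + const_fract b"
  by (simp add: const_fract_def)

lemma const_fract_diff: "const_fract (a - b) = const_fract a - const_fract b"
  by (simp add: const_fract_def)

lemma frac_val_const [simp]: "frac_val w (const_fract a) = w [:a:]"
  by (simp add: const_fract_def frac_val_poly)

definition eval_fract :: "'f poly \<Rightarrow> 'f poly fract \<Rightarrow> 'f poly fract" where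
  "eval_fract P z = poly (map_poly const_fract P) z"

lemma eval_fract_0 [simp]: "eval_fract 0 z = 0"
  by (simp add: eval_fract_def)

lemma eval_fract_pCons: "eval_fract (pCons a P) z = const_fract a + z * eval_fract P z"
  by (simp add: eval_fract_def map_poly_pCons)

lemma eval_fract_add: "eval_fract (P + Q) z = eval_fract P z + eval_fract Q z"
  unfolding eval_fract_def by (subst map_poly_hom_add) (auto simp: const_fract_add)

lemma eval_fract_diff: "eval_fract (P - Q) z = eval_fract P z - eval_fract Q z"
  using eval_fract_add[of "P - Q" Q z] by simp

sublocale R: type_algebra_quotient "{z. 0 \<le> frac_val w z}" "val_max_ideal w"
proof (unfold_locales, goal_cases)
  case (3 x y)
  then show ?case using add_mono[of 0 "frac_val w x" 0 "frac_val w y"] by (simp add: W.mult)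
next
  case (8 x y)
  then have "0 + 0 < frac_val w x + frac_val w y"
    by (intro ext_add_le_less) (auto simp: val_max_ideal_def zero_extended_def)
  then show ?case by (simp add: W.mult val_max_ideal_def)
qed (auto simp: val_max_ideal_def zero_extended_def intro: W.add_geI W.add_gtI)

lemma residue_field_eq: "residue_field w = R.Q"
  by (simp add: residue_field_def val_ring_def)

abbreviation res :: "'f \<Rightarrow> 'f poly fract set" where "res a \<equiv> R.coset (const_fract a)"

lemma base_residue_field_eq: "base_residue_field w = res ` {a. 0 \<le> w [:a:]}"
  by (auto simp: base_residue_field_def val_ring_def const_fract_def)

lemma res_0_iff: "0 \<le> w [:a:] \<Longrightarrow> res a = \<zero>\<^bsub>R.Q\<^esub> \<longleftrightarrow> 0 < w [:a:]"
  unfolding R.coset_0 by (subst R.coset_eq_iff) (auto simp: val_max_ideal_def)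

lemma res_in_carrier: "0 \<le> w [:a:] \<Longrightarrow> res a \<in> carrier R.Q"
  unfolding R.carrier_Q by (rule imageI) simp

text \<open>Polynomials of the algebra library are lists with the leading coefficient in front,
  whereas \<open>Poly\<close> expects the constant coefficient in front; hence
  \<open>rev\<close>.\<close>

lemma eval_res:
  assumes "set xs \<subseteq> {a. 0 \<le> w [:a:]}" "0 \<le> frac_val w z"
  shows "0 \<le> frac_val w (eval_fract (Poly xs) z) \<and>
    R.Q.eval (map res (rev xs)) (R.coset z) = R.coset (eval_fract (Poly xs) z)"
  using assms(1)
proof (induction xs)
  case Nil
  then show ?case by (simp add: R.coset_0)
next
  case (Cons x xs)
  let ?e = "eval_fract (Poly xs) z"
  have IH: "0 \<le> frac_val w ?e" "R.Q.eval (map res (rev xs)) (R.coset z) = R.coset ?e"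
    using Cons by auto
  have x: "0 \<le> w [:x:]" using Cons.prems by simp
  have H: "z * ?e \<in> {z. 0 \<le> frac_val w z}" by (rule R.H(3)) (use assms IH in auto)
  have "R.Q.eval (map res (rev (x # xs))) (R.coset z) =
      R.Q.eval (map res (rev xs)) (R.coset z) \<otimes>\<^bsub>R.Q\<^esub> R.coset z \<oplus>\<^bsub>R.Q\<^esub> res x"
  proof -
    have "set (map res (rev xs)) \<subseteq> carrier R.Q" using Cons.prems res_in_carrier by auto
    moreover have "R.coset z \<in> carrier R.Q" unfolding R.carrier_Q using assms(2) by (intro imageI) simp
    ultimately show ?thesis
      using R.Q.eval_append_aux[of "map res (rev xs)" "res x" "R.coset z"] res_in_carrier[OF x] by simp
  qed
  also have "\<dots> = R.coset (?e * z + const_fract x)"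
    unfolding IH(2) using assms(2) IH(1) H x
    by (subst R.coset_mult) (auto simp: R.coset_add mult.commute)
  finally show ?case using H x
    by (auto simp: eval_fract_pCons algebra_simps intro: W.add_geI)
qed

text \<open>A relation for the residue of \<open>z\<close> lifts to a polynomial with integral
  coefficients whose value at \<open>z\<close> is positive; the relation is trivial when all
  coefficients have positive value. \<open>ring.transcendental\<close> asks for injectivity of
  evaluation, so a difference of two lifts appears in one direction.\<close>

lemma transcendental_iff:
  assumes "0 \<le> frac_val w z"
  shows "ring.transcendental (residue_field w) (base_residue_field w) (R.coset z) \<longleftrightarrow>
    (\<forall>P. (\<forall>i. 0 \<le> w [:coeff P i:]) \<and> 0 < frac_val w (eval_fract P z) \<longrightarrow> (\<forall>i. 0 < w [:coeff P i:]))"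
    (is "?T \<longleftrightarrow> ?E")
proof -
  let ?K = "base_residue_field w"
  have T: "?T \<longleftrightarrow> inj_on (\<lambda>p. R.Q.eval p (R.coset z)) (carrier (univ_poly R.Q ?K))"
    unfolding residue_field_eq R.Q.transcendental_def ..
  have carrier: "carrier (univ_poly R.Q ?K) = {p. polynomial\<^bsub>R.Q\<^esub> ?K p}"
    by (simp add: univ_poly_def)
  have zc: "R.coset z \<in> carrier R.Q" unfolding R.carrier_Q using assms by (intro imageI) simp
  have K: "?K \<subseteq> carrier R.Q" unfolding base_residue_field_eq using res_in_carrier by auto
  have lift: "\<exists>xs. p = map res (rev xs) \<and> set xs \<subseteq> {a. 0 \<le> w [:a:]}" if "polynomial\<^bsub>R.Q\<^esub> ?K p" for p
  proof -
    have "set p \<subseteq> ?K" using that by (auto simp: polynomial_def)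
    then have "p \<in> lists (res ` {a. 0 \<le> w [:a:]})" by (simp add: base_residue_field_eq in_listsI subset_iff)
    then obtain ys where "p = map res ys" "ys \<in> lists {a. 0 \<le> w [:a:]}" by (auto simp: lists_image)
    then show ?thesis by (intro exI[of _ "rev ys"]) (auto simp: in_lists_conv_set)
  qed
  have coeff_p: "R.Q.coeff (map res (rev xs)) i = res (coeff (Poly xs) i)" for xs i
  proof (cases "i < length xs")
    case True
    then have 1: "rev xs ! (length xs - Suc i) = xs ! i" by (subst rev_nth) auto
    have "R.Q.coeff (map res (rev xs)) i = map res (rev xs) ! (length xs - Suc i)"
      using R.Q.coeff_nth[of i "map res (rev xs)"] True by simp
    also have "\<dots> = res (rev xs ! (length xs - Suc i))" using True by (intro nth_map) simp
    also have "\<dots> = res (coeff (Poly xs) i)" unfolding 1 using True by (simp add: nth_default_def)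
    finally show ?thesis .
  next
    case False
    then show ?thesis by (simp add: R.Q.coeff_length nth_default_def R.coset_0)
  qed
  show ?thesis
  proof
    assume E: ?E
    show ?T unfolding T carrier
    proof (rule inj_onI, clarify)
      fix p q assume p: "polynomial\<^bsub>R.Q\<^esub> ?K p" and q: "polynomial\<^bsub>R.Q\<^esub> ?K q"
        and eq: "R.Q.eval p (R.coset z) = R.Q.eval q (R.coset z)"
      obtain xs where xs: "p = map res (rev xs)" "set xs \<subseteq> {a. 0 \<le> w [:a:]}" using lift[OF p] by blast
      obtain ys where ys: "q = map res (rev ys)" "set ys \<subseteq> {a. 0 \<le> w [:a:]}" using lift[OF q] by blast
      let ?P = "Poly xs - Poly ys"
      have nonneg: "0 \<le> w [:coeff (Poly xs) i:]" if "set xs \<subseteq> {a. 0 \<le> w [:a:]}" for xs i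
      proof (cases "i < length xs")
        case True
        then have "xs ! i \<in> {a. 0 \<le> w [:a:]}" using that nth_mem[OF True] by blast
        then show ?thesis using True by (simp add: nth_default_def)
      qed (simp add: nth_default_def)
      have "R.coset (eval_fract (Poly xs) z) = R.coset (eval_fract (Poly ys) z)"
        using eq eval_res[OF xs(2) assms] eval_res[OF ys(2) assms] unfolding xs(1) ys(1) by simp
      then have "0 < frac_val w (eval_fract ?P z)"
        using R.coset_eq_iff eval_res[OF xs(2) assms] eval_res[OF ys(2) assms]
        by (simp add: eval_fract_diff val_max_ideal_def)
      moreover have "0 \<le> w [:coeff ?P i:]" for i
        using diff_geI[OF nonneg[OF xs(2)] nonneg[OF ys(2)], of i i] by simp
      ultimately have pos: "0 < w [:coeff ?P i:]" for i using E by blast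
      have "res (coeff (Poly xs) i) = res (coeff (Poly ys) i)" for i
        using pos[of i] nonneg[OF xs(2)] nonneg[OF ys(2)]
        by (subst R.coset_eq_iff) (auto simp: val_max_ideal_def simp flip: const_fract_diff)
      then have "R.Q.coeff p = R.Q.coeff q" unfolding xs(1) ys(1) by (intro ext) (simp only: coeff_p)
      then show "p = q" using R.Q.coeff_iff_polynomial_cond[OF p q] by simp
    qed
  next
    assume ?T
    then have inj: "inj_on (\<lambda>p. R.Q.eval p (R.coset z)) {p. polynomial\<^bsub>R.Q\<^esub> ?K p}"
      unfolding T carrier .
    show ?E
    proof (intro allI impI, elim conjE)
      fix P i assume nonneg: "\<forall>i. 0 \<le> w [:coeff P i:]" and pos: "0 < frac_val w (eval_fract P z)"
      define p where "p = map res (rev (coeffs P))"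
      have coeffs: "set (coeffs P) \<subseteq> {a. 0 \<le> w [:a:]}"
        using nonneg by (auto simp: coeffs_def)
      have set_p: "set p \<subseteq> ?K" using coeffs by (auto simp: p_def base_residue_field_eq)
      have "R.Q.eval p (R.coset z) = R.coset (eval_fract P z)"
        using eval_res[OF coeffs assms] by (simp add: p_def)
      also have "\<dots> = \<zero>\<^bsub>R.Q\<^esub>"
        unfolding R.coset_0 using pos by (subst R.coset_eq_iff) (auto simp: val_max_ideal_def less_imp_le)
      \<comment> \<open>The list \<open>p\<close> may start with vanishing residues, and only its
        normalisation belongs to the domain on which evaluation is injective.\<close>
      finally have "R.Q.eval (R.Q.normalize p) (R.coset z) = R.Q.eval [] (R.coset z)"
        using R.Q.eval_normalize[of p "R.coset z"] set_p K zc by simp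
      moreover have "polynomial\<^bsub>R.Q\<^esub> ?K (R.Q.normalize p)"
        using set_p by (rule R.Q.normalize_gives_polynomial)
      moreover have "polynomial\<^bsub>R.Q\<^esub> ?K []" by (simp add: polynomial_def)
      ultimately have "R.Q.normalize p = []" using inj unfolding inj_on_def by blast
      moreover have "R.Q.normalize p = [] \<Longrightarrow> set p \<subseteq> {\<zero>\<^bsub>R.Q\<^esub>}" for p
        by (induction p) (auto split: if_splits)
      ultimately have p0: "set p \<subseteq> {\<zero>\<^bsub>R.Q\<^esub>}" by blast
      show "0 < w [:coeff P i:]"
      proof (cases "coeff P i = 0")
        case False
        then have "coeff P i \<in> set (coeffs P)" by (metis coeff_0 coeff_in_coeffs le_degree)
        then have "res (coeff P i) = \<zero>\<^bsub>R.Q\<^esub>" using p0 unfolding p_def by auto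
        then show ?thesis using res_0_iff nonneg by blast
      qed (simp add: zero_extended_def)
    qed
  qed
qed

lemma valuation_transcendental_iff:
  "valuation_transcendental w \<longleftrightarrow>
     (\<exists>\<alpha>\<in>value_group w. \<forall>n>0. nmul n \<alpha> \<notin> base_value_group w) \<or>
     (\<exists>z. 0 \<le> frac_val w z \<and> (\<forall>P. (\<forall>i. 0 \<le> w [:coeff P i:]) \<and> 0 < frac_val w (eval_fract P z) \<longrightarrow>
        (\<forall>i. 0 < w [:coeff P i:])))"
proof -
  have "(\<exists>\<xi>\<in>carrier (residue_field w). ring.transcendental (residue_field w) (base_residue_field w) \<xi>) \<longleftrightarrow>
    (\<exists>z. 0 \<le> frac_val w z \<and> ring.transcendental (residue_field w) (base_residue_field w) (R.coset z))"
    unfolding residue_field_eq R.carrier_Q by blast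
  also have "\<dots> \<longleftrightarrow> (\<exists>z. 0 \<le> frac_val w z \<and> (\<forall>P. (\<forall>i. 0 \<le> w [:coeff P i:]) \<and> 0 < frac_val w (eval_fract P z) \<longrightarrow>
        (\<forall>i. 0 < w [:coeff P i:])))"
    using transcendental_iff by blast
  finally show ?thesis unfolding valuation_transcendental_def by simp
qed

lemma eval_fract_poly: "eval_fract P (Fract h 1) = Fract (pcompose P h) 1"
  by (induction P) (auto simp: eval_fract_pCons pcompose_pCons const_fract_def Zero_fract_def)

lemma Fract_1_sum: "Fract (sum f A) 1 = (\<Sum>x\<in>A. Fract (f x :: 'f poly) 1)"
proof (induction A rule: infinite_finite_induct)
  case (insert x A)
  have "Fract (f x + sum f A) 1 = Fract (f x) 1 + Fract (sum f A) 1" by simp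
  then show ?case unfolding sum.insert[OF insert.hyps] insert.IH .
qed (auto simp: Zero_fract_def)

lemma degree_map_const_fract: "degree (map_poly const_fract P) = degree P"
  by (rule degree_map_poly) (simp add: const_fract_def Zero_fract_def eq_fract)

end

section \<open>Ball valuations as the valuation-transcendental extensions\<close>

context valued_closure
begin

lemma restr_poly_valuation: "\<eta> \<in> poly_exts w \<Longrightarrow> poly_valuation (restr \<iota> \<eta>)"
  using restr_valuation by (simp add: poly_valuation_def is_valuation_def)

lemma restr_const: "\<eta> \<in> poly_exts w \<Longrightarrow> restr \<iota> \<eta> [:a:] = w (\<iota> a)"
  using poly_exts_const by (simp add: restr_def lift_pCons)

lemma base_value_group_restr:
  assumes "\<eta> \<in> poly_exts w" shows "base_value_group (restr \<iota> \<eta>) = {\<alpha>. \<exists>a. a \<noteq> 0 \<and> w (\<iota> a) = Fin \<alpha>}"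
  unfolding base_value_group_def restr_const[OF assms] ..

text \<open>Two terms of the equation of \<open>e\<close> over \<open>K\<close> must have the same value.\<close>
lemma algebraic_value_torsion:
  assumes "e \<noteq> 0" "w e = Fin \<alpha>"
  obtains n a where "0 < n" "a \<noteq> 0" "w (\<iota> a) = Fin (nmul n \<alpha>)"
proof -
  note found = that
  let ?f = "lift (mp e)"
  have root: "(\<Sum>i\<le>degree ?f. coeff ?f i * e ^ i) = 0"
    using poly_min_polynomial[of e] by (simp add: poly_altdef)
  let ?t = "\<lambda>i. w (coeff ?f i * e ^ i)"
  have fin: "finite (?t ` {..degree ?f})" and ne: "?t ` {..degree ?f} \<noteq> {}" by auto
  obtain i where i: "i \<le> degree ?f" "?t i = Min (?t ` {..degree ?f})"
    using Min_in[OF fin ne] by fastforce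
  have le: "?t i \<le> ?t j" if "j \<le> degree ?f" for j unfolding i(2) using that by (intro Min_le) auto
  have "?t (degree ?f) \<noteq> Pinf" using assms(1) monic_min_polynomial[of e] by simp
  then have ti: "?t i \<noteq> Pinf" using le[OF order_refl] by (metis Pinf_le)
  \<comment> \<open>A term of strictly smallest value would determine the value of the sum, but the
    sum is 0.\<close>
  have "\<exists>j\<in>{..degree ?f} - {i}. \<not> ?t i < ?t j"
  proof (rule ccontr)
    assume "\<not> ?thesis"
    then have "w (\<Sum>i\<le>degree ?f. coeff ?f i * e ^ i) = ?t i" using i(1) by (intro sum_eq) auto
    then show False using root ti by (metis zero)
  qed
  then obtain j where j: "j \<le> degree ?f" "j \<noteq> i" "?t j = ?t i" using le by fastforce
  \<comment> \<open>Equality of the terms of index \<open>i\<close> and \<open>j\<close> makes the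
    multiple of \<alpha> by \<open>j - i\<close> the value of a quotient of two coefficients in
    K.\<close>
  have *: thesis if ij: "i < j" "coeff ?f i * e ^ i \<noteq> 0" "coeff ?f j * e ^ j \<noteq> 0" "?t i = ?t j" for i j
  proof -
    define p q where "p = coeff (mp e) i" and "q = coeff (mp e) j"
    have nz: "p \<noteq> 0" "q \<noteq> 0" using ij by (auto simp: p_def q_def)
    obtain x y where xy: "w (\<iota> p) = Fin x" "w (\<iota> q) = Fin y" using finite_value nz by (metis \<iota>_eq_0_iff)
    have "Fin x + Fin (nmul i \<alpha>) = Fin y + Fin (nmul j \<alpha>)"
      using ij(4) xy power_Fin[OF assms(2)] by (simp add: mult p_def q_def)
    then have eq: "nmul (j - i) \<alpha> = x - y"
      using nmul_add[of "j - i" i \<alpha>] ij(1) by (simp add: algebra_simps)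
    have "w (\<iota> (p / q)) + w (\<iota> q) = w (\<iota> p)" using nz by (simp flip: mult \<iota>_mult)
    then have "w (\<iota> (p / q)) = Fin (nmul (j - i) \<alpha>)" unfolding eq xy
      by (cases "w (\<iota> (p / q))") (auto simp: algebra_simps)
    then show thesis using ij(1) nz by (intro found[of "j - i" "p / q"]) auto
  qed
  have nzi: "coeff ?f i * e ^ i \<noteq> 0" "coeff ?f j * e ^ j \<noteq> 0" using ti j(3) by (metis zero)+
  show thesis
  proof (cases "i < j")
    case True
    then show thesis using *[OF True nzi] j(3) by simp
  next
    case False
    then have "j < i" using j(2) by simp
    then show thesis using *[OF _ nzi(2,1)] j(3) by simp
  qed
qed

lemma ball_val_eval_le: "ball_val w a \<delta> f \<le> w (poly f a)"
  using gauss_val_le[of \<delta> "pcompose f [:a, 1:]" 0]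
  by (simp add: ball_val_eq_gauss_val coeff_pcompose_0 flip: zero_extended_def)

text \<open>The expansion at a root \<open>a\<close> has no constant term, so the minimum is
  attained at a positive power of \<open>x - a\<close>.\<close>

lemma ball_val_root_value:
  assumes "f \<noteq> 0" "poly f a = 0"
  obtains k e \<epsilon> where "1 \<le> k" "e \<noteq> 0" "w e = Fin \<epsilon>" "ball_val w a \<delta> f = Fin (\<epsilon> + nmul k \<delta>)"
proof -
  let ?g = "pcompose f [:a, 1:]"
  obtain k where k: "gauss_val w \<delta> ?g = w (coeff ?g k) + Fin (nmul k \<delta>)" using gauss_val_attained by blast
  have "?g \<noteq> 0" using assms(1) by (simp add: pcompose_eq_0_iff)
  then have fin: "gauss_val w \<delta> ?g \<noteq> Pinf" by (simp add: gauss_val_eq_Pinf_iff)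
  then have nz: "coeff ?g k \<noteq> 0" using k by auto
  then obtain \<epsilon> where \<epsilon>: "w (coeff ?g k) = Fin \<epsilon>" using finite_value by blast
  have "k \<noteq> 0" using nz assms(2) by (metis coeff_pcompose_0 add_0 coeff_pCons_0 poly_0_coeff_0)
  then show thesis using that[of k "coeff ?g k" \<epsilon>] nz \<epsilon> k by (simp add: ball_val_eq_gauss_val)
qed

text \<open>In other words, the residue of \<open>h\<close> is transcendental.\<close>
lemma ball_val_pcompose:
  assumes h: "ball_val w a \<delta> h = 0" "poly h a = 0"
  shows "ball_val w a \<delta> (pcompose P h) = ball_val w 0 0 P"
proof -
  let ?\<eta> = "ball_val w a \<delta>"
  interpret E: is_valuation ?\<eta> using ball_val_poly_exts by (rule poly_exts_valuation)
  have "h \<noteq> 0" using h(1) by (auto simp: zero_extended_def)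
  have "degree h \<noteq> 0"
  proof
    assume "degree h = 0"
    then show False using h(2) \<open>h \<noteq> 0\<close> by (auto elim!: degree_eq_zeroE)
  qed
  \<comment> \<open>Composition with a nonconstant \<open>h\<close> is again an extension of
    \<open>w\<close>, so comparison with the Gauss valuation needs only linear polynomials.\<close>
  have ext: "(\<lambda>P. ?\<eta> (pcompose P h)) \<in> poly_exts w"
    unfolding poly_exts_def valuation_def mem_Collect_eq
    using \<open>degree h \<noteq> 0\<close> E.add_ge poly_exts_const[OF ball_val_poly_exts]
    by (auto simp: pcompose_mult pcompose_add E.mult pcompose_eq_0_iff)
  show ?thesis
  proof (rule poly_exts_eq[OF ext ball_val_poly_exts])
    fix t
    have const: "?\<eta> [:t:] = w t" by (rule poly_exts_const[OF ball_val_poly_exts])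
    have comp: "pcompose [:- t, 1:] h = h - [:t:]" by (simp add: pcompose_pCons)
    have "?\<eta> (h - [:t:]) = min (w t) 0"
    proof (cases "w t < 0")
      case True
      then show ?thesis using E.add_eq[of "[:t:]" "- h"] h(1) const E.diff_commute[of h "[:t:]"]
        by (simp add: min_absorb1 less_imp_le)
    next
      case False
      then have "0 \<le> ?\<eta> (h - [:t:])" using h const by (intro E.diff_geI) auto
      \<comment> \<open>Evaluation at \<open>a\<close> sends \<open>h - t\<close> to
        \<open>- t\<close>. So a positive value of \<open>h - t\<close> would make \<open>t\<close>
        itself of positive value, while \<open>h\<close> has value 0.\<close>
      moreover have "\<not> 0 < ?\<eta> (h - [:t:])"
      proof
        assume *: "0 < ?\<eta> (h - [:t:])"
        also have "\<dots> \<le> w t" using ball_val_eval_le[of a \<delta> "h - [:t:]"] h(2) by simp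
        finally have "?\<eta> h < ?\<eta> [:t:]" using h(1) const by simp
        then have "?\<eta> (h - [:t:]) = ?\<eta> h" by (rule E.diff_eq)
        then show False using * h(1) by simp
      qed
      ultimately show ?thesis using False by (simp add: min_def)
    qed
    then show "?\<eta> (pcompose [:- t, 1:] h) = ball_val w 0 0 [:- t, 1:]"
      by (simp add: comp ball_val_linear zero_extended_def)
  qed
qed

lemma lift_pcompose: "lift (pcompose P f) = pcompose (lift P) (lift f)"
  by (induction P) (auto simp: pcompose_pCons lift_add lift_mult lift_pCons)

text \<open>Consider the value of the minimal polynomial of \<open>a\<close>. If no positive
  multiple lies in the base value group, the value group is not torsion over it. Otherwise a power
  of this polynomial can be scaled to value 0; it still vanishes at \<open>a\<close>, so its residue
  is transcendental.\<close>

lemma valuation_transcendental_ball_val: "valuation_transcendental (restr \<iota> (ball_val w a \<delta>))"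
proof -
  let ?\<eta> = "ball_val w a \<delta>"
  define \<rho> where "\<rho> = restr \<iota> ?\<eta>"
  interpret E: is_valuation ?\<eta> using ball_val_poly_exts by (rule poly_exts_valuation)
  interpret P: poly_valuation \<rho> unfolding \<rho>_def using ball_val_poly_exts by (rule restr_poly_valuation)
  have val: "\<rho> f = ?\<eta> (lift f)" for f by (simp add: \<rho>_def restr_def)
  let ?f = "mp a"
  obtain k e \<epsilon> where k: "1 \<le> k" and e: "e \<noteq> 0" "w e = Fin \<epsilon>" and f: "?\<eta> (lift ?f) = Fin (\<epsilon> + nmul k \<delta>)"
    using ball_val_root_value[of "lift ?f" a \<delta>] by (auto simp: poly_min_polynomial)
  define \<alpha> where "\<alpha> = \<epsilon> + nmul k \<delta>"
  have f\<alpha>: "\<rho> ?f = Fin \<alpha>" using f by (simp add: val \<alpha>_def)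
  have \<alpha>_in: "\<alpha> \<in> value_group \<rho>" using P.value_group_poly[of ?f] f\<alpha> by simp
  show ?thesis
  proof (cases "\<exists>n>0. nmul n \<alpha> \<in> base_value_group \<rho>")
    case False
    then show ?thesis using \<alpha>_in unfolding valuation_transcendental_def \<rho>_def by blast
  next
    case True
    then obtain n b where n: "n > 0" "b \<noteq> 0" "w (\<iota> b) = Fin (nmul n \<alpha>)"
      unfolding \<rho>_def base_value_group_restr[OF ball_val_poly_exts] by blast
    define F where "F = smult (inverse b) (?f ^ n)"
    have "\<rho> [:inverse b:] + \<rho> [:b:] = \<rho> ([:inverse b:] * [:b:])" by (rule P.mult[symmetric])
    also have "[:inverse b:] * [:b:] = 1" using n(2) by (simp flip: one_pCons)
    finally have sum0: "\<rho> [:inverse b:] + \<rho> [:b:] = 0" by simp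
    have b: "\<rho> [:b:] = Fin (nmul n \<alpha>)" using n(3) unfolding \<rho>_def restr_const[OF ball_val_poly_exts] .
    obtain x where x: "\<rho> [:inverse b:] = Fin x" using P.finite_value[of "[:inverse b:]"] n(2) by auto
    have "x + nmul n \<alpha> = 0" using sum0 unfolding x b by (simp add: zero_extended_def)
    then have "\<rho> [:inverse b:] = Fin (- nmul n \<alpha>)" using x by (simp add: eq_neg_iff_add_eq_0)
    moreover have "\<rho> (?f ^ n) = Fin (nmul n \<alpha>)" using f\<alpha> by (rule P.power_Fin)
    moreover have "F = [:inverse b:] * ?f ^ n" by (simp add: F_def)
    ultimately have "\<rho> F = Fin (- nmul n \<alpha>) + Fin (nmul n \<alpha>)" by (simp only: P.mult)
    then have F0: "\<rho> F = 0" by (simp add: zero_extended_def)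
    have Fa: "poly (lift F) a = 0"
      using n(1) by (simp add: F_def lift_smult lift_power poly_min_polynomial)
    have "0 < \<rho> [:coeff P i:]"
      if P: "\<forall>i. 0 \<le> \<rho> [:coeff P i:]" "0 < frac_val \<rho> (P.eval_fract P (Fract F 1))" for P i
    proof -
      have "0 < \<rho> (pcompose P F)" using P(2) by (simp add: P.eval_fract_poly P.frac_val_poly)
      also have "\<dots> = ball_val w 0 0 (lift P)"
        unfolding val lift_pcompose using F0 Fa by (intro ball_val_pcompose) (simp_all add: val)
      also have "\<dots> \<le> w (coeff (lift P) i)"
        using gauss_val_le[of 0 "lift P" i] by (simp add: ball_val_eq_gauss_val flip: zero_extended_def)
      finally show ?thesis unfolding \<rho>_def restr_const[OF ball_val_poly_exts] by simp
    qed
    moreover have "0 \<le> frac_val \<rho> (Fract F 1)" using F0 by (simp add: P.frac_val_poly)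
    ultimately have "valuation_transcendental \<rho>" unfolding P.valuation_transcendental_iff by blast
    then show ?thesis by (simp add: \<rho>_def)
  qed
qed

text \<open>Without a closest element, values and residues are those of elements of the algebraic closure.\<close>
lemma not_valuation_transcendental:
  assumes \<eta>: "\<eta> \<in> poly_exts w" and no_max: "\<And>a. \<exists>b. \<eta> [:- a, 1:] < \<eta> [:- b, 1:]"
  shows "\<not> valuation_transcendental (restr \<iota> \<eta>)"
proof -
  define \<rho> where "\<rho> = restr \<iota> \<eta>"
  interpret E: is_valuation \<eta> using \<eta> by (rule poly_exts_valuation)
  interpret P: poly_valuation \<rho> unfolding \<rho>_def using \<eta> by (rule restr_poly_valuation)
  have val: "\<rho> f = \<eta> (lift f)" for f by (simp add: \<rho>_def restr_def)
  have const: "\<eta> [:c:] = w c" for c by (rule poly_exts_const[OF \<eta>])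
  have const': "\<rho> [:c:] = w (\<iota> c)" for c unfolding \<rho>_def by (rule restr_const[OF \<eta>])
  \<comment> \<open>A polynomial has finitely many roots, so some element is strictly closer than
    all of them; near it the polynomial has the initial form of a constant.\<close>
  have close: "\<exists>a. \<forall>r. poly h r = 0 \<longrightarrow> \<eta> [:- r, 1:] < \<eta> [:- a, 1:]" if "h \<noteq> 0" for h
  proof (cases "{r. poly h r = 0} = {}")
    case False
    let ?V = "(\<lambda>r. \<eta> [:- r, 1:]) ` {r. poly h r = 0}"
    have fin: "finite {r. poly h r = 0}" using that by (rule poly_roots_finite)
    have "Max ?V \<in> ?V" using False fin by (intro Max_in) auto
    then obtain s where s: "\<eta> [:- s, 1:] = Max ?V" by auto
    have "\<eta> [:- r, 1:] \<le> \<eta> [:- s, 1:]" if "poly h r = 0" for r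
      unfolding s using that fin by (intro Max_ge) auto
    then show ?thesis using no_max[of s] by (meson order.strict_trans1)
  qed auto
  \<comment> \<open>Closeness is applied to the product, so that one element serves numerator and
    denominator.\<close>
  have approx: "\<exists>c d. c \<noteq> 0 \<and> d \<noteq> 0 \<and> w c = \<rho> f \<and> w d = \<rho> g \<and>
      \<eta> (lift f) < \<eta> (lift f - [:c:]) \<and> \<eta> (lift g) < \<eta> (lift g - [:d:])"
    if fg: "f \<noteq> 0" "g \<noteq> 0" for f g
  proof -
    have "lift f * lift g \<noteq> 0" using fg by simp
    then obtain a where a: "\<forall>r. poly (lift f * lift g) r = 0 \<longrightarrow> \<eta> [:- r, 1:] < \<eta> [:- a, 1:]"
      using close by blast
    have 1: "\<eta> (lift f) < \<eta> (lift f - [:poly (lift f) a:])" "\<eta> (lift g) < \<eta> (lift g - [:poly (lift g) a:])"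
      using fg a by (intro poly_exts_eval[OF \<eta>]; simp)+
    have 2: "w (poly (lift f) a) = \<rho> f" "w (poly (lift g) a) = \<rho> g"
      using E.eq_if_diff_gt[OF 1(1)] E.eq_if_diff_gt[OF 1(2)] unfolding const val .
    have "\<rho> f \<noteq> Pinf" "\<rho> g \<noteq> Pinf" using fg by simp_all
    then have "poly (lift f) a \<noteq> 0" "poly (lift g) a \<noteq> 0" unfolding 2[symmetric] by auto
    with 1 2 show ?thesis by blast
  qed
  have no_value: "\<exists>n>0. nmul n \<alpha> \<in> base_value_group \<rho>" if \<alpha>: "\<alpha> \<in> value_group \<rho>" for \<alpha>
  proof -
    obtain z where z: "z \<noteq> 0" "frac_val \<rho> z = Fin \<alpha>" using \<alpha> by (auto simp: value_group_def)
    obtain f g where fg: "z = Fract f g" "g \<noteq> 0" by (rule Fract_cases_nonzero)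
    have "f \<noteq> 0" using z(1) fg by (auto simp: Zero_fract_def eq_fract)
    obtain c d where nz: "c \<noteq> 0" "d \<noteq> 0" and cd: "w c = \<rho> f" "w d = \<rho> g"
      and a: "\<eta> (lift f) < \<eta> (lift f - [:c:])" "\<eta> (lift g) < \<eta> (lift g - [:d:])"
      using approx[OF \<open>f \<noteq> 0\<close> fg(2)] by blast
    have "w (c / d) + w d = w c" using nz by (simp flip: mult)
    moreover have "\<rho> f - \<rho> g = Fin \<alpha>" using z(2) fg P.frac_val_Fract by simp
    moreover obtain x y where "\<rho> f = Fin x" "\<rho> g = Fin y"
      using P.finite_value[OF \<open>f \<noteq> 0\<close>] P.finite_value[OF fg(2)] by blast
    ultimately have "w (c / d) = Fin \<alpha>" using cd
      by (cases "w (c / d)") (auto simp: algebra_simps)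
    moreover have "c / d \<noteq> 0" using nz by simp
    ultimately obtain n b where "0 < n" "b \<noteq> 0" "w (\<iota> b) = Fin (nmul n \<alpha>)"
      using algebraic_value_torsion by blast
    then show ?thesis unfolding \<rho>_def base_value_group_restr[OF \<eta>] by blast
  qed
  have no_residue: "\<exists>P. (\<forall>i. 0 \<le> \<rho> [:coeff P i:]) \<and> 0 < frac_val \<rho> (P.eval_fract P z) \<and> (\<exists>i. \<not> 0 < \<rho> [:coeff P i:])"
    if z: "0 \<le> frac_val \<rho> z" for z
  proof (cases "frac_val \<rho> z = 0")
    case False
    \<comment> \<open>Here \<open>z\<close> has positive value and zero residue, so the polynomial X
      is a nontrivial relation.\<close>
    have "P.const_fract 1 = 1" by (simp add: P.const_fract_def flip: One_fract_def one_pCons)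
    then have "P.eval_fract [:0, 1:] z = z"
      unfolding P.eval_fract_pCons P.eval_fract_0 P.const_fract_0 by simp
    then have "0 < frac_val \<rho> (P.eval_fract [:0, 1:] z)" using z False by simp
    moreover have "0 \<le> \<rho> [:coeff [:0, 1:] i:]" for i by (cases i) (auto simp: coeff_pCons zero_extended_def simp flip: one_pCons split: nat.splits)
    moreover have "\<not> 0 < \<rho> [:coeff [:0, 1:] 1:]" by (simp flip: one_pCons)
    ultimately show ?thesis by blast
  next
    case True
    obtain f g where fg: "z = Fract f g" "g \<noteq> 0" by (rule Fract_cases_nonzero)
    have "f \<noteq> 0"
    proof
      assume "f = 0"
      then have "z = 0" using fg by (simp add: Zero_fract_def eq_fract)
      then show False using True by (simp add: zero_extended_def)
    qed
    obtain c d where nz: "c \<noteq> 0" "d \<noteq> 0" and cd: "w c = \<rho> f" "w d = \<rho> g"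
      and a: "\<eta> (lift f) < \<eta> (lift f - [:c:])" "\<eta> (lift g) < \<eta> (lift g - [:d:])"
      using approx[OF \<open>f \<noteq> 0\<close> fg(2)] by blast
    obtain x y where xy: "\<rho> f = Fin x" "\<rho> g = Fin y"
      using P.finite_value[OF \<open>f \<noteq> 0\<close>] P.finite_value[OF fg(2)] by blast
    have "\<rho> f - \<rho> g = 0" using True fg P.frac_val_Fract by simp
    then have "x = y" using xy by (simp add: zero_extended_def)
    \<comment> \<open>The constant \<open>t\<close> has the same residue as \<open>z\<close>, and it
      is algebraic over K.\<close>
    define t where "t = c / d"
    have td: "t * d = c" using nz by (simp add: t_def)
    have "w t + w d = w c" by (simp flip: mult add: td)
    then have wt: "w t = 0" using cd xy \<open>x = y\<close> by (cases "w t") (auto simp: zero_extended_def)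
    have small: "\<eta> (lift f) < \<eta> (lift f - [:t:] * lift g)"
    proof -
      have "\<eta> (lift f) < \<eta> ([:t:] * (lift g - [:d:]))"
        using a(2) wt xy \<open>x = y\<close> unfolding E.mult const by (simp flip: val)
      then have "\<eta> (lift f) < \<eta> ((lift f - [:c:]) - [:t:] * (lift g - [:d:]))"
        by (rule E.diff_gtI[OF a(1)])
      also have "(lift f - [:c:]) - [:t:] * (lift g - [:d:]) = lift f - [:t:] * lift g"
        using td by (simp add: algebra_simps)
      finally show ?thesis .
    qed
    let ?m = "mp t"
    \<comment> \<open>Dividing the minimal polynomial of \<open>t\<close> by a coefficient of least
      value makes all coefficients integral and one of them a unit; this is the nontrivial relation
      sought.\<close>
    let ?V = "(\<lambda>i. w (\<iota> (coeff ?m i))) ` {..degree ?m}"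
    have "Min ?V \<in> ?V" by (intro Min_in) auto
    then obtain j where "Min ?V = w (\<iota> (coeff ?m j))" by (rule imageE)
    then have j: "w (\<iota> (coeff ?m j)) = Min ?V" by (rule sym)
    have minj: "w (\<iota> (coeff ?m j)) \<le> w (\<iota> (coeff ?m i))" for i
    proof (cases "i \<le> degree ?m")
      case True
      then show ?thesis unfolding j by (intro Min_le) auto
    qed (simp add: coeff_eq_0)
    have mj: "coeff ?m j \<noteq> 0"
    proof
      assume "coeff ?m j = 0"
      then have "w (\<iota> (coeff ?m (degree ?m))) = Pinf" using minj[of "degree ?m"] by simp
      then show False using monic_min_polynomial[of t] by (simp add: zero_extended_def)
    qed
    define P where "P = smult (inverse (coeff ?m j)) ?m"
    have coeffP: "w (\<iota> (coeff P i)) + w (\<iota> (coeff ?m j)) = w (\<iota> (coeff ?m i))" for i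
    proof -
      have "coeff P i * coeff ?m j = coeff ?m i" using mj by (simp add: P_def)
      then show ?thesis by (metis mult \<iota>_mult)
    qed
    obtain u where u: "w (\<iota> (coeff ?m j)) = Fin u" using finite_value mj by (metis \<iota>_eq_0_iff)
    have P_nonneg: "0 \<le> w (\<iota> (coeff P i))" for i
      using minj[of i] coeffP[of i] unfolding u
      by (cases "w (\<iota> (coeff P i))"; cases "w (\<iota> (coeff ?m i))") (auto simp: zero_extended_def)
    have Pj: "w (\<iota> (coeff P j)) = 0" using mj by (simp add: P_def)
    have Pt: "poly (lift P) t = 0" by (simp add: P_def lift_smult poly_min_polynomial)
    define n where "n = degree P"
    \<comment> \<open>Homogenisation of \<open>P\<close>: it clears the denominators of
      \<open>P\<close> at \<open>z = f / g\<close>.\<close>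
    define H where "H = (\<Sum>i\<le>n. smult (coeff P i) (f ^ i * g ^ (n - i)))"
    have gn: "g ^ n \<noteq> 0" using fg(2) by simp
    have zg: "z * Fract g 1 = Fract f 1" using fg by (simp add: eq_fract)
    have pow: "Fract h 1 ^ i = Fract (h ^ i) 1" for h :: "'k poly" and i
      by (induction i) (auto simp: One_fract_def)
    have "P.eval_fract P z * Fract (g ^ n) 1 = (\<Sum>i\<le>n. P.const_fract (coeff P i) * z ^ i * Fract g 1 ^ n)"
      unfolding P.eval_fract_def poly_altdef n_def
      by (simp add: sum_distrib_right coeff_map_poly pow P.degree_map_const_fract)
    also have "\<dots> = (\<Sum>i\<le>n. Fract (smult (coeff P i) (f ^ i * g ^ (n - i))) 1)"
    proof (rule sum.cong)
      fix i assume "i \<in> {..n}"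
      then have "Fract g 1 ^ n = Fract g 1 ^ i * Fract g 1 ^ (n - i)" by (simp flip: power_add)
      then have "P.const_fract (coeff P i) * z ^ i * Fract g 1 ^ n =
          P.const_fract (coeff P i) * (z * Fract g 1) ^ i * Fract g 1 ^ (n - i)"
        by (simp add: power_mult_distrib mult_ac)
      then show "P.const_fract (coeff P i) * z ^ i * Fract g 1 ^ n = Fract (smult (coeff P i) (f ^ i * g ^ (n - i))) 1"
        unfolding zg by (simp add: P.const_fract_def pow)
    qed simp
    also have "\<dots> = Fract H 1" unfolding H_def P.Fract_1_sum ..
    finally have evH: "P.eval_fract P z * Fract (g ^ n) 1 = Fract H 1" .
    have gpow: "\<eta> (lift g ^ i) = Fin (nmul i y)" for i using xy by (intro E.power_Fin) (simp add: val)
    have fpow: "\<eta> (lift f ^ i) = Fin (nmul i y)" for i using xy \<open>x = y\<close> by (intro E.power_Fin) (simp add: val)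
    have "Fin (nmul n y) < \<eta> (lift H)"
    proof -
      \<comment> \<open>Since \<open>P\<close> vanishes at \<open>t\<close>, this sum is 0 and may
        be subtracted from \<open>H\<close>. The difference is then estimated term by term, with
        \<open>f\<close> close to \<open>t\<close> times \<open>g\<close>.\<close>
      have "(\<Sum>i\<le>n. smult (\<iota> (coeff P i)) ([:t:] ^ i * lift g ^ n)) = [:poly (lift P) t:] * lift g ^ n"
      proof -
        have "[:t:] ^ i = [:t ^ i:]" for i by (induction i) (auto simp: one_pCons)
        then have "smult (\<iota> (coeff P i)) ([:t:] ^ i * lift g ^ n) = [:\<iota> (coeff P i) * t ^ i:] * lift g ^ n" for i by simp
        moreover have "(\<Sum>i\<le>n. [:c i:]) = [:\<Sum>i\<le>n. c i:]" for c :: "nat \<Rightarrow> 'l"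
          by (induction n) (auto simp: numeral_2_eq_2)
        ultimately show ?thesis by (simp only: poly_altdef degree_lift coeff_lift n_def[symmetric] flip: sum_distrib_right)
      qed
      then have "lift H = (\<Sum>i\<le>n. smult (\<iota> (coeff P i)) (lift f ^ i * lift g ^ (n - i))) -
         (\<Sum>i\<le>n. smult (\<iota> (coeff P i)) ([:t:] ^ i * lift g ^ n))"
        using Pt by (simp add: H_def lift_sum lift_smult lift_mult lift_power)
      also have "\<dots> = (\<Sum>i\<le>n. [:\<iota> (coeff P i):] * (lift g ^ (n - i) * (lift f ^ i - ([:t:] * lift g) ^ i)))"
      proof -
        have "smult c (lift f ^ i * lift g ^ (n - i)) - smult c ([:t:] ^ i * lift g ^ n) =
            [:c:] * (lift g ^ (n - i) * (lift f ^ i - ([:t:] * lift g) ^ i))" if "i \<in> {..n}" for i c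
        proof -
          have 1: "lift g ^ n = lift g ^ i * lift g ^ (n - i)" using that by (simp flip: power_add)
          have 2: "[:c:] * p = smult c p" for p by simp
          show ?thesis unfolding 1 2 power_mult_distrib smult_diff_right[symmetric]
            by (simp only: algebra_simps)
        qed
        then show ?thesis unfolding sum_subtractf[symmetric] by (intro sum.cong refl)
      qed
      also have "Fin (nmul n y) < \<eta> \<dots>"
      proof (rule E.sum_gtI)
        fix i assume i: "i \<in> {..n}"
        have "Fin (nmul i y) < \<eta> (lift f ^ i - ([:t:] * lift g) ^ i)" using E.power_approx[OF small, of i] by (simp add: fpow)
        then have "Fin (nmul (n - i) y) + Fin (nmul i y) < \<eta> (lift g ^ (n - i)) + \<eta> (lift f ^ i - ([:t:] * lift g) ^ i)"
          by (intro ext_add_le_less) (auto simp: gpow)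
        then have "0 + Fin (nmul n y) < \<eta> [:\<iota> (coeff P i):] + (\<eta> (lift g ^ (n - i)) + \<eta> (lift f ^ i - ([:t:] * lift g) ^ i))"
          using P_nonneg[of i] i nmul_add[of "n - i" i y]
          by (intro ext_add_le_less) (auto simp: const ext_add_eq_Minf zero_extended_def)
        then show "Fin (nmul n y) < \<eta> ([:\<iota> (coeff P i):] * (lift g ^ (n - i) * (lift f ^ i - ([:t:] * lift g) ^ i)))"
          unfolding E.mult by simp
      qed simp
      finally show ?thesis .
    qed
    then have "Fin (nmul n y) < frac_val \<rho> (P.eval_fract P z * Fract (g ^ n) 1)"
      unfolding evH P.frac_val_poly val .
    moreover have "\<rho> (g ^ n) = Fin (nmul n y)" by (simp add: val lift_power gpow)
    ultimately have "0 < frac_val \<rho> (P.eval_fract P z)"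
      unfolding P.W.mult P.frac_val_poly
      by (cases "frac_val \<rho> (P.eval_fract P z)") (auto simp: zero_extended_def)
    moreover have "\<not> 0 < w (\<iota> (coeff P j))" using Pj by simp
    ultimately show ?thesis using P_nonneg unfolding const' by blast
  qed
  show ?thesis unfolding \<rho>_def[symmetric] P.valuation_transcendental_iff
    using no_value no_residue by blast
qed

text \<open>There must be a closest element \<open>a\<close>. The ultrametric inequality then
  determines the value of every \<open>x - r\<close> from \<open>w (a - r)\<close> and the value of
  \<open>x - a\<close>.\<close>

lemma ball_val_if_valuation_transcendental:
  assumes \<eta>: "\<eta> \<in> poly_exts w" and "valuation_transcendental (restr \<iota> \<eta>)"
  obtains a \<delta> where "\<eta> = ball_val w a \<delta>"
proof -
  obtain a where a: "\<And>b. \<eta> [:- b, 1:] \<le> \<eta> [:- a, 1:]"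
    using not_valuation_transcendental[OF \<eta>] assms(2) by (meson not_le)
  obtain \<delta> where \<delta>: "\<eta> [:- a, 1:] = Fin \<delta>" using \<eta> by (rule poly_exts_linear_finite)
  have "\<eta> = ball_val w a \<delta>"
  proof
    fix f show "\<eta> f = ball_val w a \<delta> f"
    proof (rule poly_exts_eq[OF \<eta> ball_val_poly_exts])
      fix r
      have "\<eta> [:- r, 1:] \<le> w (a - r)" using poly_exts_linear_diff[OF \<eta>, of a r] a[of r] by (simp add: min_absorb2)
      then show "\<eta> [:- r, 1:] = ball_val w a \<delta> [:- r, 1:]" unfolding ball_val_linear
        using poly_exts_linear_ge[OF \<eta>, of a r] a[of r] \<delta> by (auto simp: min_def split: if_splits)
    qed
  qed
  then show thesis by (rule that)
qed

end

section \<open>Optimal balls and their centres\<close>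

lemma stable_value_eqI:
  assumes "Complete_Partial_Order.chain (\<le>) C" "\<rho> \<in> C" "\<And>\<sigma>. \<sigma> \<in> C \<Longrightarrow> \<rho> \<le> \<sigma> \<Longrightarrow> \<sigma> f = t"
  shows "stable_value C f = t"
  unfolding stable_value_def
proof (rule the_equality)
  fix t' assume "\<exists>\<rho>\<in>C. \<forall>\<sigma>\<in>C. \<rho> \<le> \<sigma> \<longrightarrow> \<sigma> f = t'"
  then obtain \<rho>' where \<rho>': "\<rho>' \<in> C" "\<forall>\<sigma>\<in>C. \<rho>' \<le> \<sigma> \<longrightarrow> \<sigma> f = t'" by blast
  from chainD[OF assms(1,2) \<rho>'(1)] show "t' = t"
  proof
    assume "\<rho> \<le> \<rho>'"
    then show ?thesis using assms(3)[OF \<rho>'(1)] \<rho>' by simp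
  next
    assume "\<rho>' \<le> \<rho>"
    then show ?thesis using assms(2) assms(3)[OF assms(2)] \<rho>'(2) by simp
  qed
qed (use assms in blast)

lemma is_stable_limitI:
  assumes "Complete_Partial_Order.chain (\<le>) C"
    "\<And>f. \<exists>\<rho>\<in>C. \<forall>\<sigma>\<in>C. \<rho> \<le> \<sigma> \<longrightarrow> \<sigma> f = \<mu> f"
  shows "is_stable_limit \<mu> C"
  unfolding is_stable_limit_def
proof (intro conjI allI ext)
  fix f
  obtain \<rho> where \<rho>: "\<rho> \<in> C" "\<forall>\<sigma>\<in>C. \<rho> \<le> \<sigma> \<longrightarrow> \<sigma> f = \<mu> f" using assms(2) by blast
  have eq: "\<rho> f = \<mu> f" using \<rho> by simp
  have "\<forall>\<sigma>\<in>C. \<rho> \<le> \<sigma> \<longrightarrow> \<sigma> f = \<rho> f" unfolding eq by (rule \<rho>(2))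
  then show "stable C f" unfolding stable_def using \<rho>(1) by blast
  show "\<mu> f = stable_value C f" using \<rho>(2) by (intro stable_value_eqI[OF assms(1) \<rho>(1), symmetric]) simp
qed

lemma stable_limit_attained:
  assumes "Complete_Partial_Order.chain (\<le>) C" "is_stable_limit \<mu> C"
  shows "\<exists>\<rho>\<in>C. \<forall>\<sigma>\<in>C. \<rho> \<le> \<sigma> \<longrightarrow> \<sigma> f = \<mu> f"
proof -
  have "stable C f" and \<mu>: "\<mu> = stable_value C" using assms(2) unfolding is_stable_limit_def by simp_all
  then obtain \<rho> where \<rho>: "\<rho> \<in> C" "\<forall>\<sigma>\<in>C. \<rho> \<le> \<sigma> \<longrightarrow> \<sigma> f = \<rho> f" unfolding stable_def by blast
  have eq: "\<mu> f = \<rho> f" unfolding \<mu> using \<rho>(2) by (intro stable_value_eqI[OF assms(1) \<rho>(1)]) simp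
  show ?thesis unfolding eq using \<rho> by blast
qed

lemma stable_limit_ge:
  assumes "Complete_Partial_Order.chain (\<le>) C" "is_stable_limit \<mu> C" "\<rho> \<in> C"
  shows "\<rho> \<le> \<mu>"
proof (rule le_funI)
  fix f
  obtain \<sigma> where \<sigma>: "\<sigma> \<in> C" "\<forall>\<tau>\<in>C. \<sigma> \<le> \<tau> \<longrightarrow> \<tau> f = \<mu> f"
    using stable_limit_attained[OF assms(1,2)] by blast
  from chainD[OF assms(1,3) \<sigma>(1)] show "\<rho> f \<le> \<mu> f"
  proof
    assume "\<rho> \<le> \<sigma>"
    then have "\<rho> f \<le> \<sigma> f" by (rule le_funD)
    then show ?thesis using \<sigma> by simp
  next
    assume "\<sigma> \<le> \<rho>"
    then show ?thesis using \<sigma>(2) assms(3) by simp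
  qed
qed

text \<open>Serves to carry the well-order of a family of balls over to the valuations attached to
  them.\<close>

lemma well_order_on_relation_of_image:
  assumes wo: "well_order_on A (relation_of P A)" and inj: "inj_on g A"
    and iff: "\<And>x y. x \<in> A \<Longrightarrow> y \<in> A \<Longrightarrow> Q (g x) (g y) \<longleftrightarrow> P x y"
  shows "well_order_on (g ` A) (relation_of Q (g ` A))"
proof -
  note * = well_order_on_Well_order[OF wo]
  have F: "Field (relation_of P A) = A" using conjunct1[OF *] by (rule sym)
  have "Well_order (dir_image (relation_of P A) g)"
    by (rule Well_order_dir_image[OF conjunct2[OF *]]) (simp add: F inj)
  moreover have "Field (dir_image (relation_of P A) g) = g ` A" unfolding dir_image_Field F ..
  moreover have "relation_of Q (g ` A) = dir_image (relation_of P A) g"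
    unfolding relation_of_def dir_image_def using iff by blast
  ultimately show ?thesis by simp
qed

text \<open>\<open>F\<close> generates the nest in both cases: it is \<open>\<mu>'\<close> alone or
  the fixed family. Its last three properties allow one argument for both.\<close>

locale ball_nest = valued_closure \<iota> w
  for \<iota> :: "'k::field \<Rightarrow> 'l::alg_closed_field" and w :: "'l \<Rightarrow> 'v::linordered_ab_group_add extended" +
  fixes \<mu>' :: "'l poly \<Rightarrow> 'v extended" and \<mu> :: "'k poly \<Rightarrow> 'v extended" and F D
  assumes \<mu>': "\<mu>' \<in> poly_exts w" and \<mu>: "restr \<iota> \<mu>' = \<mu>"
    and F: "F = (if valuation_transcendental \<mu> then {\<mu>'} else D)"
    and F_le: "\<rho> \<in> F \<Longrightarrow> \<rho> \<le> \<mu>'" and F_ball: "\<rho> \<in> F \<Longrightarrow> \<exists>a \<delta>. \<rho> = ball_val w a \<delta>"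
    and F_approx: "\<exists>\<rho>\<in>F. \<rho> f = \<mu>' f"
begin

definition closeness :: "'l \<Rightarrow> 'v extended" ("L") where "L r = \<mu>' [:- r, 1:]"

definition rad :: "'l \<Rightarrow> 'v" where "rad c = fin_val (L c)"

definition centre :: "'l \<Rightarrow> bool" where
  "centre c \<longleftrightarrow> (\<forall>r. poly (lift (mp c)) r = 0 \<longrightarrow> L r \<le> L c) \<and> (\<forall>r. L c \<le> L r \<longrightarrow> deg_elt \<iota> c \<le> deg_elt \<iota> r)"

definition ball :: "'l \<Rightarrow> 'l set" where "ball c = vball w c (rad c)"

definition cval :: "'l \<Rightarrow> 'k poly \<Rightarrow> 'v extended" where "cval c = restr \<iota> (ball_val w c (rad c))"

lemma Fin_rad [simp]: "Fin (rad c) = L c"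
proof -
  obtain a where "L c = Fin a" using poly_exts_linear_finite[OF \<mu>', of c] by (auto simp: closeness_def)
  then show ?thesis by (simp add: rad_def)
qed

lemma L_ge: "min (L a) (w (a - r)) \<le> L r"
  unfolding closeness_def by (rule poly_exts_linear_ge[OF \<mu>'])

lemma L_diff: "min (L a) (L r) \<le> w (a - r)"
  unfolding closeness_def by (rule poly_exts_linear_diff[OF \<mu>'])

lemma L_geI: "t \<le> L a \<Longrightarrow> t \<le> w (a - r) \<Longrightarrow> t \<le> L r"
  using L_ge[of a r] by (auto simp: min_def split: if_splits)

lemma w_diff_geI: "t \<le> L a \<Longrightarrow> t \<le> L r \<Longrightarrow> t \<le> w (a - r)"
  using L_diff[of a r] by (auto simp: min_def split: if_splits)

lemma mem_ball_iff: "r \<in> ball c \<longleftrightarrow> L c \<le> L r"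
  unfolding ball_def vball_def using L_geI[of "L c" c r] w_diff_geI[of "L c" c r] diff_commute[of r c] by auto

lemma ball_subset_iff: "ball c \<subseteq> ball d \<longleftrightarrow> L d \<le> L c"
  unfolding subset_iff mem_ball_iff by (meson order_refl order_trans)

lemma ball_eq_iff: "ball c = ball d \<longleftrightarrow> L c = L d"
  unfolding set_eq_subset ball_subset_iff by auto

lemma vball_eq:
  assumes "Fin \<gamma> \<le> w (c - b)" shows "vball w b \<gamma> = vball w c \<gamma>"
proof -
  have "Fin \<gamma> \<le> w (x - b) \<longleftrightarrow> Fin \<gamma> \<le> w (x - c)" for x
    using assms add_geI[of "Fin \<gamma>" "x - c" "c - b"] diff_geI[of "Fin \<gamma>" "x - b" "c - b"] by auto
  then show ?thesis by (auto simp: vball_def)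
qed

lemma ball_val_eq:
  assumes "Fin \<gamma> \<le> w (c - b)" shows "ball_val w b \<gamma> = ball_val w c \<gamma>"
  using assms diff_commute[of c b]
  by (intro antisym) (auto simp: ball_val_le_iff ball_val_poly_exts ball_val_linear)

lemma cval_cong:
  assumes "L c = L d" shows "cval c = cval d"
proof -
  have "Fin (rad c) \<le> w (d - c)" using w_diff_geI[of "L c" d c] assms by simp
  from ball_val_eq[OF this] show ?thesis using assms by (simp add: cval_def rad_def)
qed

lemma deg_set_ball: "centre c \<Longrightarrow> deg_set \<iota> (ball c) = deg_elt \<iota> c"
proof -
  assume c: "centre c"
  have "c \<in> ball c" by (simp add: mem_ball_iff)
  then obtain d where "d \<in> Min_deg \<iota> (ball c)" using Min_deg_nonempty[of "ball c"] by auto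
  then have "deg_elt \<iota> c \<le> deg_set \<iota> (ball c)"
    using c by (auto simp: Min_deg_def mem_ball_iff centre_def)
  then show ?thesis using deg_set_least[OF \<open>c \<in> ball c\<close>] by simp
qed

text \<open>The radius \<gamma> is the largest \<open>L\<close> on the conjugates of a minimal
  \<open>c\<close>, and nothing says at once that \<open>c\<close> itself attains it. This is where
  the radius could depend on the presentation; membership in the nest excludes it.\<close>

lemma optimal_presentation_centre:
  assumes nest: "A \<in> nest w \<mu> \<mu>' D" and opt: "optimal_presentation w \<iota> \<mu> A b \<gamma>"
  obtains c where "centre c" "A = ball c" "rad c = \<gamma>" "ball_val w b \<gamma> = ball_val w c (rad c)"
proof -
  obtain c where A: "A = vball w b \<gamma>" and c: "c \<in> A" "deg_elt \<iota> c = deg_set \<iota> A"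
    and eps: "eps \<mu> (mp c) = \<gamma>"
    using opt by (auto simp: optimal_presentation_def Min_deg_def)
  have "0 < degree (mp c)" using deg_elt_pos[of c] by (simp add: deg_elt_def)
  then obtain s where s: "poly (lift (mp c)) s = 0" "\<And>r. poly (lift (mp c)) r = 0 \<Longrightarrow> L r \<le> L s"
    "L s = Fin \<gamma>"
    by (rule max_root[OF \<mu>', of "mp c", folded closeness_def, unfolded \<mu> eps]) blast
  have le: "L c \<le> Fin \<gamma>" using s poly_min_polynomial[of c] by metis
  obtain a \<delta> where a: "ball_val w a \<delta> \<in> F" "vball w a \<delta> \<subseteq> A"
    using nest F by (auto simp: nest_def)
  have La: "Fin \<delta> \<le> L a" using F_le[OF a(1)] ball_val_le_iff[OF \<mu>'] by (simp add: closeness_def)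
  have mem: "Fin \<gamma> \<le> w (x - y)" if "x \<in> A" "y \<in> A" for x y
    using that diff_geI[of "Fin \<gamma>" "x - b" "y - b"] by (auto simp: A vball_def)
  have "a \<in> A" using a(2) by (auto simp: vball_def)
  text \<open>A strict inequality would give two elements at distance in \<open>[\<delta>, \<gamma>)\<close>, but the balls of radii
    \<open>\<delta>\<close> and \<open>\<gamma>\<close> coincide in that case.\<close>
  have Lc: "L c = Fin \<gamma>"
  proof (rule ccontr)
    assume "L c \<noteq> Fin \<gamma>"
    then have less: "L c < Fin \<gamma>" using le by simp
    interpret M: is_valuation \<mu>' using \<mu>' by (rule poly_exts_valuation)
    have "\<mu>' ([:- c, 1:] - [:- s, 1:]) = L c"
      using less s(3) by (subst M.diff_eq) (auto simp: closeness_def)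
    then have ws: "w (s - c) = L c" using poly_exts_const[OF \<mu>', of "s - c"] by simp
    have "\<not> Fin \<gamma> \<le> L c" using less by simp
    then have "\<not> Fin \<gamma> \<le> L a" using L_geI[of "Fin \<gamma>" a c] mem[OF \<open>a \<in> A\<close> c(1)] by blast
    then have "Fin \<delta> \<le> Fin \<gamma>" using La by (meson le_cases order_trans)
    then have "Fin \<delta> \<le> L c" using L_geI[OF La, of c] mem[OF \<open>a \<in> A\<close> c(1)] by (meson order_trans)
    then have "a + (s - c) \<in> vball w a \<delta>" by (simp add: vball_def ws)
    then have "Fin \<gamma> \<le> w (a + (s - c) - a)" using a(2) \<open>a \<in> A\<close> by (intro mem) auto
    then show False using less ws by simp
  qed
  then have rad: "rad c = \<gamma>" by (simp add: rad_def)
  have cb: "Fin \<gamma> \<le> w (c - b)" using c(1) by (simp add: A vball_def)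
  have A': "A = ball c" unfolding A ball_def rad by (rule vball_eq[OF cb])
  have "centre c" unfolding centre_def
    using s Lc c(2) deg_set_least[of _ A] by (auto simp: A' mem_ball_iff)
  then show thesis using that A' rad ball_val_eq[OF cb] by simp
qed

text \<open>A member of \<open>F\<close> that has reached the final value at \<open>x - c\<close>
  comes from a ball inside \<open>ball c\<close>; this puts \<open>ball c\<close> into the
  nest.\<close>

lemma centre_optimal_presentation:
  assumes "centre c" shows "ball c \<in> nest w \<mu> \<mu>' D" "optimal_presentation w \<iota> \<mu> (ball c) c (rad c)"
proof -
  obtain \<rho> where \<rho>: "\<rho> \<in> F" "\<rho> [:- c, 1:] = L c" using F_approx by (auto simp: closeness_def)
  obtain a \<delta> where a: "\<rho> = ball_val w a \<delta>" using F_ball[OF \<rho>(1)] by blast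
  have le: "L c \<le> w (a - c)" "L c \<le> Fin \<delta>" using \<rho>(2) by (auto simp: a ball_val_linear min_def split: if_splits)
  have "vball w a \<delta> \<subseteq> ball c"
  proof
    fix x assume "x \<in> vball w a \<delta>"
    then have "L c \<le> w (x - a)" using le(2) by (auto simp: vball_def)
    then show "x \<in> ball c" using add_geI[of "L c" "x - a" "a - c"] le(1) by (simp add: ball_def vball_def)
  qed
  then show "ball c \<in> nest w \<mu> \<mu>' D"
    using \<rho>(1) a unfolding nest_def F[symmetric] ball_def by blast
  have "eps (restr \<iota> \<mu>') (mp c) = rad c"
    using assms poly_min_polynomial[of c] by (intro eps_eqI[OF \<mu>', of _ _ c]) (auto simp: centre_def closeness_def)
  moreover have "c \<in> Min_deg \<iota> (ball c)" using deg_set_ball[OF assms] by (simp add: Min_deg_def mem_ball_iff)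
  ultimately show "optimal_presentation w \<iota> \<mu> (ball c) c (rad c)"
    unfolding optimal_presentation_def \<mu> by (auto simp: ball_def)
qed

lemma opt_balls_eq: "opt_balls w \<iota> \<mu> \<mu>' D = ball ` {c. centre c}"
proof
  show "opt_balls w \<iota> \<mu> \<mu>' D \<subseteq> ball ` {c. centre c}"
    unfolding opt_balls_def by (auto elim!: optimal_presentation_centre)
  show "ball ` {c. centre c} \<subseteq> opt_balls w \<iota> \<mu> \<mu>' D"
    unfolding opt_balls_def using centre_optimal_presentation by blast
qed

text \<open>Whatever presentation is chosen, it belongs to a centre of the same ball, hence with the
  same \<open>L\<close>, and \<open>cval\<close> depends only on \<open>L\<close>.\<close>

lemma opt_ball_val_ball:
  assumes "centre c" shows "opt_ball_val w \<iota> \<mu> (ball c) = cval c"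
proof -
  let ?p = "SOME p. optimal_presentation w \<iota> \<mu> (ball c) (fst p) (snd p)"
  have "optimal_presentation w \<iota> \<mu> (ball c) (fst (c, rad c)) (snd (c, rad c))"
    using centre_optimal_presentation(2)[OF assms] by simp
  then have "optimal_presentation w \<iota> \<mu> (ball c) (fst ?p) (snd ?p)"
    by (rule someI[of "\<lambda>p. optimal_presentation w \<iota> \<mu> (ball c) (fst p) (snd p)"])
  then obtain d where d: "centre d" "ball c = ball d" "rad d = snd ?p"
      "ball_val w (fst ?p) (snd ?p) = ball_val w d (rad d)"
    by (rule optimal_presentation_centre[OF centre_optimal_presentation(1)[OF assms]]) blast
  have 1: "opt_ball_val w \<iota> \<mu> (ball c) = cval d"
    unfolding opt_ball_val_def Let_def cval_def d(4) ..
  have "L d = L c" using d(2) unfolding ball_eq_iff by (rule sym)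
  then have "cval d = cval c" by (rule cval_cong)
  with 1 show ?thesis by (rule trans)
qed

section \<open>Valuations attached to centres\<close>

lemma cval_poly_exts: "cval c \<in> poly_exts (w \<circ> \<iota>)"
  unfolding cval_def by (rule restr_poly_exts[OF ball_val_poly_exts])

lemma cval_valuation: "valuation (cval c)"
  using cval_poly_exts by (simp add: poly_exts_def)

lemma cval_le: "cval c \<le> \<mu>"
  unfolding cval_def \<mu>[symmetric] by (intro restr_mono) (simp add: ball_val_le_iff \<mu>' flip: closeness_def)

lemma ball_val_mono: "L c \<le> L d \<Longrightarrow> ball_val w c (rad c) \<le> ball_val w d (rad d)"
  using w_diff_geI[of "L c" d c] by (simp add: ball_val_le_iff ball_val_poly_exts ball_val_linear)

lemma cval_mono: "L c \<le> L d \<Longrightarrow> cval c \<le> cval d"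
  unfolding cval_def by (intro restr_mono ball_val_mono)

text \<open>The value of \<open>x - d\<close> is at most \<open>L c\<close> for the larger ball and
  at least \<open>L c'\<close> for the smaller one, while no other root loses.\<close>

lemma cval_less_min_polynomial:
  assumes "L c < L c'" "L c' \<le> L d" shows "cval c (mp d) < cval c' (mp d)"
  unfolding cval_def restr_def
proof (rule poly_exts_less[OF ball_val_poly_exts ball_val_poly_exts, where s = d])
  have "ball_val w c (rad c) [:- d, 1:] \<le> L c" by (simp add: ball_val_linear)
  also have "L c < L c'" by fact
  also have "L c' \<le> ball_val w c' (rad c') [:- d, 1:]"
    using w_diff_geI[of "L c'" c' d] assms(2) by (simp add: ball_val_linear)
  finally show "ball_val w c (rad c) [:- d, 1:] < ball_val w c' (rad c') [:- d, 1:]" .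
qed (use assms ball_val_mono[of c c'] in \<open>auto simp: poly_min_polynomial le_fun_def\<close>)

lemma cval_less: "L c < L d \<Longrightarrow> cval c < cval d"
  using cval_less_min_polynomial[of c d d] cval_mono[of c d] by (metis less_imp_le less_irrefl less_le order_refl)

lemma cval_le_iff: "cval c \<le> cval d \<longleftrightarrow> L c \<le> L d"
  using cval_less[of d c] cval_mono[of c d] by (metis leD not_le)

text \<open>Truncation at the radius \<open>L c\<close> leaves \<open>x - r\<close> unchanged when
  \<open>L r\<close> does not exceed it.\<close>

lemma cval_eq_\<mu>:
  assumes "\<And>r. poly (lift f) r = 0 \<Longrightarrow> L r \<le> L c" shows "cval c f = \<mu> f"
  unfolding cval_def \<mu>[symmetric] restr_def
proof (rule poly_exts_eq[OF ball_val_poly_exts \<mu>'])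
  fix r assume "poly (lift f) r = 0"
  then have le: "L r \<le> L c" by (rule assms)
  have "min (w (c - r)) (L c) = L r"
  proof (rule antisym)
    show "min (w (c - r)) (L c) \<le> L r" using L_ge[of c r] by (simp add: min.commute)
    show "L r \<le> min (w (c - r)) (L c)" using w_diff_geI[of "L r" c r] le by simp
  qed
  then show "ball_val w c (rad c) [:- r, 1:] = \<mu>' [:- r, 1:]" by (simp add: ball_val_linear closeness_def)
qed

lemma centre_min_polynomial: "centre c \<Longrightarrow> cval c (mp c) = \<mu> (mp c)"
  by (rule cval_eq_\<mu>) (simp add: centre_def)

lemma centre_min: "centre c \<Longrightarrow> Fin (rad c) \<le> w (r - c) \<Longrightarrow> deg_elt \<iota> c \<le> deg_elt \<iota> r"
  using mem_ball_iff[of r c] by (auto simp: centre_def ball_def vball_def)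

lemma key_poly_cval: "centre c \<Longrightarrow> key_poly (cval c) (mp c)"
  unfolding cval_def by (rule key_poly_min_polynomial) (rule centre_min)

lemma cval_transcendental: "valuation_transcendental (cval c)"
  unfolding cval_def by (rule valuation_transcendental_ball_val)

lemma trans_deg_cval: "centre c \<Longrightarrow> trans_deg (cval c) = deg_elt \<iota> c"
  unfolding cval_def by (rule trans_deg_ball_val) (rule centre_min)

lemma deg_val_cval: "centre c \<Longrightarrow> deg_val v (cval c) = enat (deg_elt \<iota> c)"
  by (simp add: deg_val_def cval_transcendental trans_deg_cval)

text \<open>Take an element of least degree in the ball of \<open>r\<close> and replace it by its
  closest conjugate. The conjugate stays in the ball, so by minimality its degree does not drop and
  its minimal polynomial is the same.\<close>

lemma centre_exists: "\<exists>c. centre c \<and> L r \<le> L c \<and> deg_elt \<iota> c \<le> deg_elt \<iota> r"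
proof -
  have r: "r \<in> ball r" by (simp add: mem_ball_iff)
  then obtain c where c: "c \<in> ball r" "deg_elt \<iota> c = deg_set \<iota> (ball r)"
    using Min_deg_nonempty[of "ball r"] by (auto simp: Min_deg_def)
  have min: "deg_elt \<iota> c \<le> deg_elt \<iota> x" if "L r \<le> L x" for x
    using that deg_set_least[of x "ball r"] c(2) by (simp add: mem_ball_iff)
  have "0 < degree (mp c)" using deg_elt_pos[of c] by (simp add: deg_elt_def)
  then obtain s where s: "poly (lift (mp c)) s = 0" "\<And>x. poly (lift (mp c)) x = 0 \<Longrightarrow> L x \<le> L s"
    "L s = Fin (eps (restr \<iota> \<mu>') (mp c))"
    by (rule max_root[OF \<mu>', of "mp c", folded closeness_def]) blast
  have rs: "L r \<le> L s"
    using c(1) s(2)[OF poly_min_polynomial] by (auto simp: mem_ball_iff)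
  have deg: "deg_elt \<iota> s \<le> deg_elt \<iota> c" using s(1) by (rule deg_elt_conjugate_le)
  have "mp s = mp c" using s(1) min[OF rs] by (rule min_polynomial_conjugate)
  then have "centre s" unfolding centre_def using s(2) min rs deg by (auto intro: order_trans)
  then show ?thesis using rs deg min[OF order_refl] by (meson order_trans)
qed

text \<open>Otherwise \<open>c\<close> would lie in the ball of \<open>d\<close>, where no element
  has degree below that of \<open>d\<close>.\<close>

lemma centre_less: "centre c \<Longrightarrow> centre d \<Longrightarrow> deg_elt \<iota> c < deg_elt \<iota> d \<Longrightarrow> L c < L d"
  unfolding centre_def by (meson leD leI)

lemma close_root:
  assumes "f \<noteq> 0"
  obtains "\<And>r. poly (lift f) r \<noteq> 0"
  | r where "poly (lift f) r = 0" "deg_elt \<iota> r \<le> degree f" "\<And>x. poly (lift f) x = 0 \<Longrightarrow> L x \<le> L r"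
proof (cases "degree f = 0")
  case True
  then have "poly (lift f) r \<noteq> 0" for r using assms deg_elt_le[OF assms, of r] deg_elt_pos[of r] by auto
  then show thesis by (rule that(1))
next
  case False
  then have "0 < degree f" by simp
  then obtain s where "poly (lift f) s = 0" "\<And>x. poly (lift f) x = 0 \<Longrightarrow> L x \<le> L s"
    "L s = Fin (eps (restr \<iota> \<mu>') f)"
    by (rule max_root[OF \<mu>', of f, folded closeness_def]) blast
  then show thesis using that(2) deg_elt_le[OF assms] by blast
qed

lemma chain_cval: "Complete_Partial_Order.chain (\<le>) (cval ` S)"
  unfolding chain_def by (auto simp: cval_le_iff)

lemma increasing_family_cval: "S \<noteq> {} \<Longrightarrow> increasing_family (w \<circ> \<iota>) (cval ` S)"
  unfolding increasing_family_def using cval_poly_exts chain_cval by auto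

lemma eventually_cval_eq:
  assumes "c \<in> S" "\<And>r. poly (lift f) r = 0 \<Longrightarrow> L r \<le> L c"
  shows "cval c \<in> cval ` S \<and> (\<forall>\<sigma>\<in>cval ` S. cval c \<le> \<sigma> \<longrightarrow> \<sigma> f = \<mu> f)"
proof (intro conjI ballI impI)
  fix \<sigma> assume "\<sigma> \<in> cval ` S" "cval c \<le> \<sigma>"
  then obtain d where "\<sigma> = cval d" "L c \<le> L d" by (auto simp: cval_le_iff)
  then show "\<sigma> f = \<mu> f" using assms(2) by (metis cval_eq_\<mu> order_trans)
qed (use assms in auto)

lemma is_stable_limit_cval:
  assumes "\<And>f. f \<noteq> 0 \<Longrightarrow> \<exists>c\<in>S. \<forall>r. poly (lift f) r = 0 \<longrightarrow> L r \<le> L c"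
  shows "is_stable_limit \<mu> (cval ` S)"
proof (rule is_stable_limitI[OF chain_cval])
  fix f :: "'k poly"
  show "\<exists>\<rho>\<in>cval ` S. \<forall>\<sigma>\<in>cval ` S. \<rho> \<le> \<sigma> \<longrightarrow> \<sigma> f = \<mu> f"
  proof (cases "f = 0")
    case True
    have zero: "\<rho> 0 = Pinf" if "valuation \<rho>" for \<rho> :: "'k poly \<Rightarrow> 'v extended"
      using that by (simp add: valuation_def)
    obtain c where "c \<in> S" using assms[of 1] by auto
    moreover have "valuation \<mu>" using restr_valuation[OF \<mu>'] by (simp add: \<mu>)
    ultimately show ?thesis using True zero[OF cval_valuation] zero[of \<mu>] by auto
  next
    case False
    then show ?thesis using assms eventually_cval_eq by meson
  qed
qed

text \<open>Supplies a family of valuation-transcendental members with limit \<mu>, so that the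
  choice in the definition of the degree is meaningful in the algebraic case.\<close>

lemma is_stable_limit_all: "is_stable_limit \<mu> (cval ` {c. centre c})"
proof (rule is_stable_limit_cval)
  fix f :: "'k poly" assume "f \<noteq> 0"
  then show "\<exists>c\<in>{c. centre c}. \<forall>r. poly (lift f) r = 0 \<longrightarrow> L r \<le> L c"
  proof (cases rule: close_root)
    case 1
    then show ?thesis using centre_exists by blast
  next
    case (2 r)
    obtain c where c: "centre c" "L r \<le> L c" using centre_exists[of r] by blast
    have "L x \<le> L c" if "poly (lift f) x = 0" for x using 2(3)[OF that] c(2) by (rule order_trans)
    then show ?thesis using c(1) by blast
  qed
qed

lemma \<mu>_poly_exts: "\<mu> \<in> poly_exts (w \<circ> \<iota>)"
  using restr_poly_exts[OF \<mu>'] by (simp add: \<mu>)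

lemma cval_eq_if_max: "(\<And>r. L r \<le> L c) \<Longrightarrow> cval c = \<mu>"
  by (intro ext cval_eq_\<mu>)

lemma trans_deg_le: "valuation \<rho> \<Longrightarrow> key_poly \<rho> \<phi> \<Longrightarrow> trans_deg \<rho> \<le> degree \<phi>"
  unfolding trans_deg_def by (subst KP_eq) (auto intro: Least_le)

lemma trans_deg_attained:
  assumes "valuation \<rho>" "key_poly \<rho> \<phi>" obtains \<psi> where "key_poly \<rho> \<psi>" "degree \<psi> = trans_deg \<rho>"
proof -
  have "\<exists>n. \<exists>\<phi>\<in>KP \<rho>. n = degree \<phi>" using assms KP_eq by blast
  from LeastI_ex[OF this] show thesis using that KP_eq[OF assms(1)] by (auto simp: trans_deg_def)
qed

text \<open>The supremum defining the degree of \<open>\<mu>\<close> may be computed with the optimal balls, since any two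
  families with stable limit \<open>\<mu>\<close> are cofinal in each other.\<close>
lemma deg_val_algebraic:
  assumes alg: "\<not> valuation_transcendental \<mu>"
  shows "deg_val (w \<circ> \<iota>) \<mu> = (SUP c\<in>{c. centre c}. enat (deg_elt \<iota> c))"
proof -
  let ?P = "\<lambda>C. increasing_family (w \<circ> \<iota>) C \<and> (\<forall>\<rho>\<in>C. valuation_transcendental \<rho>) \<and> is_stable_limit \<mu> C"
  define C where "C = (SOME C. ?P C)"
  have "{c. centre c} \<noteq> {}" using centre_exists by blast
  then have "?P (cval ` {c. centre c})"
    using increasing_family_cval[of "{c. centre c}"] cval_transcendental is_stable_limit_all by simp
  then have "?P C" unfolding C_def by (rule someI[of ?P])
  then have inc: "increasing_family (w \<circ> \<iota>) C" and tr: "\<And>\<rho>. \<rho> \<in> C \<Longrightarrow> valuation_transcendental \<rho>"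
    and lim: "is_stable_limit \<mu> C" by auto
  have chain: "Complete_Partial_Order.chain (\<le>) C" and ext: "\<And>\<rho>. \<rho> \<in> C \<Longrightarrow> \<rho> \<in> poly_exts (w \<circ> \<iota>)"
    using inc by (auto simp: increasing_family_def)
  have val: "valuation \<rho>" if "\<rho> \<in> C" for \<rho> using ext[OF that] by (simp add: poly_exts_def)
  \<comment> \<open>Members of the family are valuation-transcendental and \<mu> is not, so they are
    different from \<mu>.\<close>
  have less: "\<rho> < \<mu>" if "\<rho> \<in> C" for \<rho>
    using stable_limit_ge[OF chain lim that] tr[OF that] alg by (auto simp: less_le)
  have cval_less\<mu>: "cval c < \<mu>" for c
    using cval_le[of c] cval_transcendental[of c] alg by (auto simp: less_le)
  \<comment> \<open>Choose \<open>f\<close> where \<rho> is still below \<mu> and a member of the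
    family that is final at \<open>f\<close>. It cannot lie below \<rho>, and valuations below \<mu>
    are comparable.\<close>
  have cofinal: "\<exists>\<sigma>\<in>C2. \<rho> \<le> \<sigma>"
    if "\<rho> \<in> poly_exts (w \<circ> \<iota>)" "\<rho> < \<mu>" "C2 \<subseteq> poly_exts (w \<circ> \<iota>)" "Complete_Partial_Order.chain (\<le>) C2" "is_stable_limit \<mu> C2"
    for \<rho> C2
  proof -
    have "\<not> \<mu> \<le> \<rho>" using that(2) by (simp add: less_le_not_le)
    then obtain f where f: "\<rho> f < \<mu> f" by (auto simp: le_fun_def not_le)
    have "\<exists>\<sigma>\<in>C2. \<sigma> f = \<mu> f" using stable_limit_attained[OF that(4,5), of f] by auto
    then obtain \<sigma> where \<sigma>: "\<sigma> \<in> C2" "\<sigma> f = \<mu> f" by blast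
    have not_le: "\<not> \<sigma> \<le> \<rho>"
    proof
      assume "\<sigma> \<le> \<rho>"
      then have "\<sigma> f \<le> \<rho> f" by (rule le_funD)
      then show False using f \<sigma>(2) by simp
    qed
    have "\<sigma> \<le> \<mu>" using stable_limit_ge[OF that(4,5) \<sigma>(1)] .
    moreover have "\<sigma> \<in> poly_exts (w \<circ> \<iota>)" using \<sigma>(1) that(3) by blast
    ultimately have "\<rho> \<le> \<sigma> \<or> \<sigma> \<le> \<rho>"
      using comparable_below[OF that(1) _ \<mu>_poly_exts less_imp_le[OF that(2)]] by blast
    then show ?thesis using \<sigma>(1) not_le by blast
  qed
  have "deg_val (w \<circ> \<iota>) \<mu> = (SUP \<rho>\<in>C. enat (trans_deg \<rho>))"
    using alg by (simp add: deg_val_def C_def)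
  also have "\<dots> = (SUP c\<in>{c. centre c}. enat (deg_elt \<iota> c))"
  proof (rule antisym)
    show "(SUP \<rho>\<in>C. enat (trans_deg \<rho>)) \<le> (SUP c\<in>{c. centre c}. enat (deg_elt \<iota> c))"
    proof (rule SUP_mono)
      fix \<rho> assume \<rho>: "\<rho> \<in> C"
      have "\<exists>\<sigma>\<in>cval ` {c. centre c}. \<rho> \<le> \<sigma>"
        by (rule cofinal[OF ext[OF \<rho>] less[OF \<rho>] _ chain_cval is_stable_limit_all]) (use cval_poly_exts in blast)
      then obtain c where c: "centre c" "\<rho> \<le> cval c" by auto
      obtain \<phi> where "key_poly \<rho> \<phi>" "degree \<phi> \<le> degree (mp c)"
        using key_poly_degree_mono[OF val[OF \<rho>] cval_valuation c(2) key_poly_cval[OF c(1)]] by blast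
      then have "trans_deg \<rho> \<le> deg_elt \<iota> c"
        using trans_deg_le[OF val[OF \<rho>], of \<phi>] by (simp add: deg_elt_def)
      then show "\<exists>c\<in>{c. centre c}. enat (trans_deg \<rho>) \<le> enat (deg_elt \<iota> c)" using c(1) by auto
    qed
    show "(SUP c\<in>{c. centre c}. enat (deg_elt \<iota> c)) \<le> (SUP \<rho>\<in>C. enat (trans_deg \<rho>))"
    proof (rule SUP_mono)
      fix c assume "c \<in> {c. centre c}"
      then have c: "centre c" by simp
      have "C \<subseteq> poly_exts (w \<circ> \<iota>)" using ext by blast
      from cofinal[OF cval_poly_exts cval_less\<mu> this chain lim]
      obtain \<rho> where \<rho>: "\<rho> \<in> C" "cval c \<le> \<rho>" by blast
      \<comment> \<open>A tangent polynomial is a key polynomial of \<rho>, so the least degree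
        defining \<open>trans_deg\<close> is really attained.\<close>
      obtain \<psi> where "\<psi> \<in> tangent \<rho> \<mu>" "\<And>f. degree f < degree \<psi> \<Longrightarrow> \<mu> f = \<rho> f"
        by (rule tangent_exists[OF ext[OF \<rho>(1)] \<mu>_poly_exts less[OF \<rho>(1)]]) blast
      from key_poly_tangent[OF ext[OF \<rho>(1)] \<mu>_poly_exts less_imp_le[OF less[OF \<rho>(1)]] this]
      have "key_poly \<rho> \<psi>" .
      then obtain \<phi> where \<phi>: "key_poly \<rho> \<phi>" "degree \<phi> = trans_deg \<rho>"
        by (rule trans_deg_attained[OF val[OF \<rho>(1)]])
      obtain \<chi> where "key_poly (cval c) \<chi>" "degree \<chi> \<le> degree \<phi>"
        using key_poly_degree_mono[OF cval_valuation val[OF \<rho>(1)] \<rho>(2) \<phi>(1)] by blast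
      then have "deg_elt \<iota> c \<le> trans_deg \<rho>"
        using trans_deg_le[OF cval_valuation[of c], of \<chi>] trans_deg_cval[OF c] \<phi>(2) by simp
      then show "\<exists>\<rho>\<in>C. enat (deg_elt \<iota> c) \<le> enat (trans_deg \<rho>)" using \<rho>(1) by auto
    qed
  qed
  finally show ?thesis .
qed

end

section \<open>The chain of optimal balls\<close>

locale optimal_chain = ball_nest \<iota> w \<mu>' \<mu> F D
  for \<iota> :: "'k::field \<Rightarrow> 'l::alg_closed_field" and w :: "'l \<Rightarrow> 'v::linordered_ab_group_add extended"
    and \<mu>' :: "'l poly \<Rightarrow> 'v extended" and \<mu> :: "'k poly \<Rightarrow> 'v extended" and F D +
  fixes N :: enat and m :: "nat \<Rightarrow> nat" and \<B> :: "nat \<Rightarrow> 'l set set" and B :: "nat \<Rightarrow> 'l set"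
  assumes mono: "strict_mono_on {n. enat n < N} m"
    and img: "m ` {n. enat n < N} = deg_set \<iota> ` opt_balls w \<iota> \<mu> \<mu>' D"
    and fam: "\<forall>n. enat n < N \<longrightarrow>
           (let Opt = {A \<in> opt_balls w \<iota> \<mu> \<mu>' D. deg_set \<iota> A = m n} in
              \<B> n \<subseteq> Opt \<and>
              well_order_on (\<B> n) (relation_of (\<supseteq>) (\<B> n)) \<and>
              (\<forall>A\<in>Opt. \<exists>A'\<in>\<B> n. A' \<subseteq> A) \<and>
              (\<forall>A\<in>Opt. (\<forall>A'\<in>Opt. A \<subseteq> A') \<longrightarrow> \<B> n = {A}) \<and>
              B n \<in> \<B> n \<and> (\<forall>A\<in>\<B> n. A \<subseteq> B n))"
begin

text \<open>All centres of the balls of one level are kept instead of one per ball; different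
  centres of the same ball have the same \<open>cval\<close>.\<close>

definition centres :: "nat \<Rightarrow> 'l set" where "centres n = {c. centre c \<and> ball c \<in> \<B> n}"

definition first :: "nat \<Rightarrow> 'l" where "first n = (SOME c. centre c \<and> B n = ball c)"

lemma opt_eq: "{A \<in> opt_balls w \<iota> \<mu> \<mu>' D. deg_set \<iota> A = m n} = ball ` {c. centre c \<and> deg_elt \<iota> c = m n}"
  unfolding opt_balls_eq using deg_set_ball by auto

lemma
  assumes n: "enat n < N"
  shows \<B>_subset: "\<B> n \<subseteq> ball ` {c. centre c \<and> deg_elt \<iota> c = m n}"
    and \<B>_well_order: "well_order_on (\<B> n) (relation_of (\<supseteq>) (\<B> n))"
    and \<B>_cofinal: "\<And>c. centre c \<Longrightarrow> deg_elt \<iota> c = m n \<Longrightarrow> \<exists>A\<in>\<B> n. A \<subseteq> ball c"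
    and \<B>_last: "\<And>c. centre c \<Longrightarrow> deg_elt \<iota> c = m n \<Longrightarrow>
      (\<And>d. centre d \<Longrightarrow> deg_elt \<iota> d = m n \<Longrightarrow> ball c \<subseteq> ball d) \<Longrightarrow> \<B> n = {ball c}"
    and B_in: "B n \<in> \<B> n" and B_first: "\<And>A. A \<in> \<B> n \<Longrightarrow> A \<subseteq> B n"
  using fam[rule_format, OF n] unfolding Let_def opt_eq by auto

lemma \<B>_eq:
  assumes "enat n < N" shows "\<B> n = ball ` centres n"
  using \<B>_subset[OF assms] unfolding centres_def by blast

lemma centres_degree:
  assumes "enat n < N" "c \<in> centres n" shows "centre c" "deg_elt \<iota> c = m n"
proof -
  show c: "centre c" using assms(2) by (simp add: centres_def)
  have "ball c \<in> ball ` {c. centre c \<and> deg_elt \<iota> c = m n}"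
    using assms(2) \<B>_subset[OF assms(1)] by (auto simp: centres_def)
  then obtain d where "centre d" "deg_elt \<iota> d = m n" "ball c = ball d" by blast
  then show "deg_elt \<iota> c = m n" using deg_set_ball[OF c] deg_set_ball[of d] by simp
qed

lemma centres_cofinal:
  assumes "enat n < N" "centre c" "deg_elt \<iota> c = m n" shows "\<exists>d\<in>centres n. L c \<le> L d"
  using \<B>_cofinal[OF assms] unfolding \<B>_eq[OF assms(1)] by (auto simp: ball_subset_iff)

lemma first:
  assumes n: "enat n < N"
  shows first_in: "first n \<in> centres n" and B_eq: "B n = ball (first n)"
    and first_le: "\<And>c. c \<in> centres n \<Longrightarrow> L (first n) \<le> L c"
    and first_centre: "centre (first n)" and first_degree: "deg_elt \<iota> (first n) = m n"
    and opt_ball_val_first: "opt_ball_val w \<iota> \<mu> (B n) = cval (first n)"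
proof -
  have ex: "\<exists>c. centre c \<and> B n = ball c" using B_in[OF n] \<B>_subset[OF n] by auto
  from someI_ex[OF this] have *: "centre (first n)" "B n = ball (first n)" by (simp_all add: first_def)
  then show B: "B n = ball (first n)" and c: "centre (first n)" by simp_all
  show "opt_ball_val w \<iota> \<mu> (B n) = cval (first n)" unfolding B by (rule opt_ball_val_ball[OF c])
  show in_c: "first n \<in> centres n" using * B_in[OF n] by (simp add: centres_def)
  then show "deg_elt \<iota> (first n) = m n" by (rule centres_degree(2)[OF n])
  fix c assume "c \<in> centres n"
  then have "ball c \<subseteq> B n" using B_first[OF n, of "ball c"] by (simp add: centres_def)
  then show "L (first n) \<le> L c" by (simp add: B ball_subset_iff)
qed

lemma m_less: "enat j < N \<Longrightarrow> i < j \<Longrightarrow> m i < m j"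
proof -
  assume "enat j < N" "i < j"
  moreover from this have "enat i < N" by (metis enat_ord_simps(2) order.strict_trans)
  ultimately show "m i < m j" using strict_mono_onD[OF mono, of i j] by simp
qed

lemma centre_degree:
  assumes "centre c" obtains n where "enat n < N" "deg_elt \<iota> c = m n"
proof -
  have "deg_elt \<iota> c \<in> deg_set \<iota> ` opt_balls w \<iota> \<mu> \<mu>' D"
    unfolding opt_balls_eq using assms deg_set_ball[OF assms] by force
  then show thesis using that unfolding img[symmetric] by auto
qed

lemma centre_degree_le:
  assumes "enat (Suc n) < N" "centre c" "deg_elt \<iota> c < m (Suc n)" shows "deg_elt \<iota> c \<le> m n"
proof -
  obtain k where k: "enat k < N" "deg_elt \<iota> c = m k" using assms(2) by (rule centre_degree)
  have "k < Suc n"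
  proof (rule ccontr)
    assume "\<not> k < Suc n"
    then have "Suc n = k \<or> Suc n < k" by auto
    then have "m (Suc n) \<le> m k" using m_less[OF k(1), of "Suc n"] by auto
    then show False using assms(3) k(2) by simp
  qed
  moreover have "enat n < N" using assms(1) by (metis enat_ord_simps(2) lessI order.strict_trans)
  ultimately show ?thesis using m_less[of n k] k(2) by (cases "k = n") auto
qed

lemma m_ge: "enat n < N \<Longrightarrow> n \<le> m n"
proof (induction n)
  case (Suc n)
  then have "enat n < N" by (metis enat_ord_simps(2) lessI order.strict_trans)
  then show ?case using Suc.IH m_less[OF Suc.prems, of n] by simp
qed simp

text \<open>The closest root of \<open>f\<close> is dominated by a centre of degree at most that of
  \<open>f\<close>, hence at most \<open>m n\<close>. If the degree is \<open>m n\<close>,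
  cofinality of the family goes beyond it; if it is smaller, already the first ball of the level
  does.\<close>

lemma close_centre:
  assumes n: "enat n < N" and "f \<noteq> 0"
    and deg: "\<And>c. centre c \<Longrightarrow> deg_elt \<iota> c \<le> degree f \<Longrightarrow> deg_elt \<iota> c \<le> m n"
  shows "\<exists>c\<in>centres n. \<forall>r. poly (lift f) r = 0 \<longrightarrow> L r \<le> L c"
  using assms(2)
proof (cases rule: close_root)
  case 1
  then show ?thesis using first_in[OF n] by auto
next
  case (2 r)
  obtain c where c: "centre c" "L r \<le> L c" "deg_elt \<iota> c \<le> deg_elt \<iota> r" using centre_exists[of r] by blast
  have "deg_elt \<iota> c \<le> m n" using deg[OF c(1)] c(3) 2(2) by simp
  then have "\<exists>d\<in>centres n. L c \<le> L d"
  proof (cases "deg_elt \<iota> c = m n")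
    case True
    then show ?thesis by (rule centres_cofinal[OF n c(1)])
  next
    case False
    then have "L c < L (first n)"
      using \<open>deg_elt \<iota> c \<le> m n\<close> first_degree[OF n] by (intro centre_less c(1) first_centre[OF n]) simp
    then show ?thesis using first_in[OF n] by (blast intro: less_imp_le)
  qed
  then obtain d where d: "d \<in> centres n" "L c \<le> L d" by blast
  have "L x \<le> L d" if "poly (lift f) x = 0" for x
    using 2(3)[OF that] c(2) d(2) by simp
  then show ?thesis using d(1) by blast
qed

text \<open>On balls of one level the valuation is injective and reverses inclusion, so the
  well-order by descending inclusion becomes the order of valuations.\<close>

lemma const_deg_family_centres:
  assumes n: "enat n < N" shows "const_deg_family (w \<circ> \<iota>) (cval (first n)) (cval ` centres n)"
  unfolding const_deg_family_def
proof (intro conjI ballI)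
  show "increasing_family (w \<circ> \<iota>) (cval ` centres n)"
    using first_in[OF n] by (intro increasing_family_cval) auto
  let ?g = "opt_ball_val w \<iota> \<mu>"
  have g: "?g (ball c) = cval c" if "c \<in> centres n" for c
    using centres_degree(1)[OF n that] by (rule opt_ball_val_ball)
  have img: "cval ` centres n = ?g ` \<B> n" unfolding \<B>_eq[OF n] image_image by (intro image_cong) (simp_all add: g)
  have iff: "?g A \<le> ?g A' \<longleftrightarrow> A \<supseteq> A'" if "A \<in> \<B> n" "A' \<in> \<B> n" for A A'
  proof -
    from that obtain c d where "c \<in> centres n" "A = ball c" "d \<in> centres n" "A' = ball d"
      unfolding \<B>_eq[OF n] by blast
    then show ?thesis by (simp add: g cval_le_iff ball_subset_iff)
  qed
  have inj: "inj_on ?g (\<B> n)"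
  proof (rule inj_onI)
    fix A A' assume *: "A \<in> \<B> n" "A' \<in> \<B> n" "?g A = ?g A'"
    then show "A = A'" using iff[OF *(1,2)] iff[OF *(2,1)] by auto
  qed
  show "well_order_on (cval ` centres n) (relation_of (\<le>) (cval ` centres n))"
    unfolding img by (rule well_order_on_relation_of_image[OF \<B>_well_order[OF n] inj]) (rule iff)
  show "cval (first n) \<in> cval ` centres n" using first_in[OF n] by simp
  fix \<rho> assume "\<rho> \<in> cval ` centres n"
  then obtain c where c: "c \<in> centres n" "\<rho> = cval c" by blast
  show "cval (first n) \<le> \<rho>" unfolding c(2) by (intro cval_mono first_le n c(1))
  fix \<sigma> assume "\<sigma> \<in> cval ` centres n"
  then obtain d where d: "d \<in> centres n" "\<sigma> = cval d" by blast
  show "deg_val (w \<circ> \<iota>) \<rho> = deg_val (w \<circ> \<iota>) \<sigma>"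
    using centres_degree[OF n c(1)] centres_degree[OF n d(1)] by (simp add: c(2) d(2) deg_val_cval)
qed

text \<open>The polynomial of the step is the minimal polynomial of a centre of the next first ball,
  and the new value is its value there.\<close>

lemma chain_step:
  assumes Sn: "enat (Suc n) < N"
  defines "d \<equiv> first (Suc n)"
  shows "ordinary_augmentation (cval (first n)) (mp d) (fin_val (cval d (mp d))) (cval d) \<or>
    limit_augmentation (cval ` centres n) (mp d) (fin_val (cval d (mp d))) (cval d)"
proof -
  have n: "enat n < N" using Sn by (metis enat_ord_simps(2) lessI order.strict_trans)
  have d: "centre d" "deg_elt \<iota> d = m (Suc n)" unfolding d_def by (rule first_centre first_degree Sn)+
  interpret V: is_valuation "cval d" by unfold_locales (rule cval_valuation)
  have \<gamma>: "Fin (fin_val (cval d (mp d))) = cval d (mp d)" by (rule V.Fin_fin_val_eq) simp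
  have min: "v_minimal (cval d) (mp d)" using key_poly_cval[OF d(1)] by (simp add: key_poly_def)
  have m: "m n < m (Suc n)" by (rule m_less[OF Sn]) simp
  have less: "L c < L d" if "c \<in> centres n" for c
    using centres_degree[OF n that] d m by (intro centre_less) auto
  have close: "\<exists>c\<in>centres n. \<forall>r. poly (lift f) r = 0 \<longrightarrow> L r \<le> L c" if "f \<noteq> 0" "degree f < degree (mp d)" for f
  proof (rule close_centre[OF n that(1)])
    fix c assume "centre c" "deg_elt \<iota> c \<le> degree f"
    then show "deg_elt \<iota> c \<le> m n" using that(2) d(2) by (intro centre_degree_le[OF Sn]) (auto simp: deg_elt_def)
  qed
  have zero: "cval c 0 = Pinf" for c
    by (rule pseudo_valuation.zero[OF valuation_imp_pseudo[OF cval_valuation]])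
  have eq_d: "cval d f = \<mu> f" if f: "f \<noteq> 0" "degree f < degree (mp d)" for f
  proof -
    obtain c where c: "c \<in> centres n" "\<forall>r. poly (lift f) r = 0 \<longrightarrow> L r \<le> L c" using close[OF f] by blast
    show ?thesis
    proof (rule cval_eq_\<mu>)
      fix r assume "poly (lift f) r = 0"
      then have "L r \<le> L c" using c(2) by blast
      then show "L r \<le> L d" using less[OF c(1)] by simp
    qed
  qed
  show ?thesis
  \<comment> \<open>A last ball makes the family a singleton, so values that are eventually final
    are final at its only member.\<close>
  proof (cases "\<exists>c. centre c \<and> deg_elt \<iota> c = m n \<and> (\<forall>c'. centre c' \<and> deg_elt \<iota> c' = m n \<longrightarrow> L c' \<le> L c)")
    case True
    then obtain c where c: "centre c" "deg_elt \<iota> c = m n" "\<And>c'. centre c' \<Longrightarrow> deg_elt \<iota> c' = m n \<Longrightarrow> L c' \<le> L c"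
      by blast
    have "\<B> n = {ball c}" using c by (intro \<B>_last[OF n]) (auto simp: ball_subset_iff)
    then have same: "L c' = L (first n)" if "c' \<in> centres n" for c'
      using that first_in[OF n] by (auto simp: centres_def ball_eq_iff)
    have eq: "cval (first n) f = cval d f" if deg: "degree f < degree (mp d)" for f
    proof (cases "f = 0")
      case False
      obtain c where c: "c \<in> centres n" "\<forall>r. poly (lift f) r = 0 \<longrightarrow> L r \<le> L c" using close[OF False deg] by blast
      have "cval (first n) f = \<mu> f" using c(2) same[OF c(1)] by (intro cval_eq_\<mu>) simp
      then show ?thesis using eq_d[OF False deg] by simp
    qed (simp add: zero)
    have lt: "cval (first n) (mp d) < cval d (mp d)"
      using less[OF first_in[OF n]] by (intro cval_less_min_polynomial) auto
    have "key_poly (cval (first n)) (mp d)"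
      using less[OF first_in[OF n]] lt eq
      by (intro key_poly_if_tangent[OF cval_valuation valuation_imp_pseudo[OF cval_valuation[of d]]])
        (auto intro: cval_mono monic_min_polynomial)
    then have "ordinary_augmentation (cval (first n)) (mp d) (fin_val (cval d (mp d))) (cval d)"
      unfolding ordinary_augmentation_def \<gamma> KP_eq[OF cval_valuation] using lt eq
      by (auto intro!: v_minimal_augments[OF cval_valuation min])
    then show ?thesis ..
  next
    case False
    let ?C = "cval ` centres n"
    have lt: "\<rho> (mp d) < cval d (mp d)" if "\<rho> \<in> ?C" for \<rho>
      using that less cval_less_min_polynomial[of _ d d] by auto
    \<comment> \<open>Without a last ball every member is followed by one strictly closer to
      \<open>d\<close>, and each time the value at the minimal polynomial of \<open>d\<close>
      grows.\<close>
    have unstable: "\<not> stable ?C (mp d)"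
    proof
      assume "stable ?C (mp d)"
      then obtain \<rho> where \<rho>: "\<rho> \<in> ?C" "\<forall>\<sigma>\<in>?C. \<rho> \<le> \<sigma> \<longrightarrow> \<sigma> (mp d) = \<rho> (mp d)" unfolding stable_def by blast
      obtain c where c: "c \<in> centres n" "\<rho> = cval c" using \<rho>(1) by blast
      obtain c' where c': "centre c'" "deg_elt \<iota> c' = m n" "\<not> L c' \<le> L c"
        using False centres_degree[OF n c(1)] by blast
      obtain e where e: "e \<in> centres n" "L c' \<le> L e" using centres_cofinal[OF n c'(1,2)] by blast
      have "L c < L e" using c'(3) e(2) by simp
      then have "cval c (mp d) < cval e (mp d)" using less[OF e(1)] by (intro cval_less_min_polynomial) auto
      moreover have "\<rho> \<le> cval e" unfolding c(2) using \<open>L c < L e\<close> by (intro cval_mono) simp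
      then have "cval e (mp d) = \<rho> (mp d)" using \<rho>(2) e(1) by blast
      ultimately show False unfolding c(2) by simp
    qed
    have ev: "\<exists>\<rho>\<in>?C. \<forall>\<sigma>\<in>?C. \<rho> \<le> \<sigma> \<longrightarrow> \<sigma> f = cval d f" if deg: "degree f < degree (mp d)" for f
    proof (cases "f = 0")
      case True
      then show ?thesis using first_in[OF n] by (auto simp: zero)
    next
      case False
      obtain c where c: "c \<in> centres n" "\<forall>r. poly (lift f) r = 0 \<longrightarrow> L r \<le> L c" using close[OF False deg] by blast
      then show ?thesis using eventually_cval_eq[of c "centres n" f] unfolding eq_d[OF False deg] by blast
    qed
    have st: "stable ?C f" "stable_value ?C f = cval d f" if deg: "degree f < degree (mp d)" for f
    proof -
      obtain \<rho> where \<rho>: "\<rho> \<in> ?C" "\<forall>\<sigma>\<in>?C. \<rho> \<le> \<sigma> \<longrightarrow> \<sigma> f = cval d f" using ev[OF deg] by blast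
      have eq: "\<rho> f = cval d f" by (rule \<rho>(2)[rule_format, OF \<rho>(1) order_refl])
      have "\<forall>\<sigma>\<in>?C. \<rho> \<le> \<sigma> \<longrightarrow> \<sigma> f = \<rho> f" unfolding eq by (rule \<rho>(2))
      then show "stable ?C f" unfolding stable_def using \<rho>(1) by blast
      show "stable_value ?C f = cval d f" using \<rho>(2) by (intro stable_value_eqI[OF chain_cval \<rho>(1)]) blast
    qed
    have "mp d \<in> KP_inf ?C"
      unfolding KP_inf_def using unstable st(1) monic_min_polynomial[of d] by (auto simp: not_less[symmetric])
    moreover have "augments (stable_value ?C) (mp d) (fin_val (cval d (mp d))) (cval d)"
      by (rule v_minimal_augments[OF cval_valuation min st(2)])
    ultimately have "limit_augmentation ?C (mp d) (fin_val (cval d (mp d))) (cval d)"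
      unfolding limit_augmentation_def \<gamma> using lt by blast
    then show ?thesis ..
  qed
qed

text \<open>The element 0 has degree 1 over K, and some centre has no larger degree.\<close>

lemma N_pos: "0 < N" and m_0: "m 0 = 1"
proof -
  obtain c where c: "centre c" "deg_elt \<iota> c \<le> deg_elt \<iota> (\<iota> 0)" using centre_exists[of "\<iota> 0"] by blast
  then have 1: "deg_elt \<iota> c = 1" using deg_elt_pos[of c] deg_elt_base[of 0] by simp
  obtain k where k: "enat k < N" "deg_elt \<iota> c = m k" using c(1) by (rule centre_degree)
  show N: "0 < N" using k(1) by (metis not_less_zero gr_zeroI)
  then have N0: "enat 0 < N" by (simp add: zero_enat_def)
  have "m 0 \<le> m k" using m_less[OF k(1), of 0] by (cases "k = 0") auto
  moreover have "0 < m 0" using deg_elt_pos[of "first 0"] first_degree[OF N0] by simp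
  ultimately show "m 0 = 1" using 1 k(2) by simp
qed

text \<open>The ball valuation \<open>\<mu>'\<close> has a closest element, so some centre has the
  largest \<open>L\<close>. A further degree would need a strictly closer centre.\<close>

lemma transcendental_case:
  assumes "valuation_transcendental \<mu>"
  shows "\<exists>r. N = enat (Suc r) \<and> cval (first r) = \<mu>"
proof -
  obtain a \<delta> where a: "\<mu>' = ball_val w a \<delta>"
    using ball_val_if_valuation_transcendental[OF \<mu>'] assms unfolding \<mu> by blast
  have La: "L r \<le> L a" for r unfolding closeness_def unfolding a ball_val_linear by simp
  obtain c where c: "centre c" "L a \<le> L c" using centre_exists[of a] by blast
  have max: "L r \<le> L c" for r using La c(2) by (rule order_trans)
  obtain r where r: "enat r < N" "deg_elt \<iota> c = m r" using c(1) by (rule centre_degree)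
  have "\<not> enat (Suc r) < N"
  proof
    assume Sr: "enat (Suc r) < N"
    have "m r < m (Suc r)" by (rule m_less[OF Sr]) simp
    then have "L c < L (first (Suc r))"
      using first_degree[OF Sr] r(2) by (intro centre_less c(1) first_centre[OF Sr]) simp
    then show False using max[of "first (Suc r)"] by simp
  qed
  then have N: "N = enat (Suc r)" using r(1) by (cases N) auto
  have "\<B> r = {ball c}" using c(1) r(2) max by (intro \<B>_last[OF r(1)]) (auto simp: ball_subset_iff)
  then have "L (first r) = L c" using first_in[OF r(1)] by (auto simp: centres_def ball_eq_iff)
  then have "cval (first r) = \<mu>" using max by (intro cval_eq_if_max) simp
  then show ?thesis using N by blast
qed

lemma algebraic_less:
  assumes "\<not> valuation_transcendental \<mu>" shows "cval c < \<mu>"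
  using cval_le[of c] cval_transcendental[of c] assms by (auto simp: less_le)

text \<open>The degree of \<mu> bounds the degrees of all centres, so the strictly increasing
  sequence of degrees stops. At its last level no larger degree can obstruct
  \<open>close_centre\<close>.\<close>

lemma algebraic_finite_case:
  assumes alg: "\<not> valuation_transcendental \<mu>" and fin: "deg_val (w \<circ> \<iota>) \<mu> < \<infinity>"
  shows "\<exists>r. N = enat (Suc r) \<and> is_stable_limit \<mu> (cval ` centres r)"
proof -
  obtain M where M: "deg_val (w \<circ> \<iota>) \<mu> = enat M" using fin by (cases "deg_val (w \<circ> \<iota>) \<mu>") auto
  have le: "deg_elt \<iota> c \<le> M" if "centre c" for c
  proof -
    have "enat (deg_elt \<iota> c) \<le> (SUP c\<in>{c. centre c}. enat (deg_elt \<iota> c))" using that by (intro SUP_upper) simp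
    then show ?thesis using M unfolding deg_val_algebraic[OF alg] by simp
  qed
  have "N \<noteq> \<infinity>"
  proof
    assume "N = \<infinity>"
    then have n: "enat (Suc M) < N" by simp
    then show False using m_ge[OF n] le[OF first_centre[OF n]] first_degree[OF n] by simp
  qed
  then obtain r where N: "N = enat (Suc r)" using N_pos by (cases N; cases "the_enat N") (auto simp: zero_enat_def)
  then have r: "enat r < N" by simp
  have "is_stable_limit \<mu> (cval ` centres r)"
  proof (rule is_stable_limit_cval, rule close_centre[OF r])
    fix c assume "centre c"
    then obtain k where "enat k < N" "deg_elt \<iota> c = m k" by (rule centre_degree)
    then show "deg_elt \<iota> c \<le> m r" using m_less[OF r, of k] N by (cases "k = r") auto
  qed
  then show ?thesis using N by blast
qed

lemma algebraic_infinite_case: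
  assumes alg: "\<not> valuation_transcendental \<mu>" and inf: "deg_val (w \<circ> \<iota>) \<mu> = \<infinity>"
  shows "N = \<infinity> \<and> is_stable_limit \<mu> (range (\<lambda>n. cval (first n)))"
proof -
  have N: "N = \<infinity>"
  proof (rule ccontr)
    assume "N \<noteq> \<infinity>"
    then obtain k where k: "N = enat k" by (cases N) auto
    have "(SUP c\<in>{c. centre c}. enat (deg_elt \<iota> c)) \<le> enat (m (k - 1))"
    proof (rule SUP_least)
      fix c assume "c \<in> {c. centre c}"
      then have "centre c" by simp
      then obtain i where i: "enat i < N" "deg_elt \<iota> c = m i" by (rule centre_degree)
      then have "i \<le> k - 1" "enat (k - 1) < N" using k by auto
      then show "enat (deg_elt \<iota> c) \<le> enat (m (k - 1))" using m_less[of "k - 1" i] i(2) by (cases "i = k - 1") auto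
    qed
    then show False using inf unfolding deg_val_algebraic[OF alg] by simp
  qed
  have n: "enat n < N" for n by (simp add: N)
  have "is_stable_limit \<mu> (cval ` range first)"
  proof (rule is_stable_limit_cval)
    fix f :: "'k poly" assume f: "f \<noteq> 0"
    \<comment> \<open>Strict growth gives \<open>m ?n\<close> at least \<open>?n\<close>, which
      exceeds the degree of every root of \<open>f\<close>; so no root can be closer than this
      centre.\<close>
    let ?n = "Suc (degree f)"
    have "L r \<le> L (first ?n)" if "poly (lift f) r = 0" for r
    proof (rule ccontr)
      assume "\<not> L r \<le> L (first ?n)"
      then have "deg_elt \<iota> (first ?n) \<le> deg_elt \<iota> r" using first_centre[OF n, of ?n] by (simp add: centre_def)
      then show False using deg_elt_le[OF f that] m_ge[OF n, of ?n] first_degree[OF n, of ?n] by simp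
    qed
    then show "\<exists>c\<in>range first. \<forall>r. poly (lift f) r = 0 \<longrightarrow> L r \<le> L c" by blast
  qed
  then show ?thesis using N by (simp add: image_image)
qed

lemma MLV_chain_optimal: "MLV_chain (w \<circ> \<iota>) \<mu> N (\<lambda>n. opt_ball_val w \<iota> \<mu> (B n))"
  unfolding MLV_chain_def
proof (intro conjI allI impI)
  let ?m = "\<lambda>n. opt_ball_val w \<iota> \<mu> (B n)"
  note val = opt_ball_val_first
  have pred: "enat n < N" if "enat (Suc n) < N" for n
    using that by (metis enat_ord_simps(2) lessI order.strict_trans)
  show "0 < N" by (rule N_pos)
  have N0: "enat 0 < N" using N_pos by (simp add: zero_enat_def)
  show "deg_val (w \<circ> \<iota>) (?m 0) = 1"
    unfolding val[OF N0] deg_val_cval[OF first_centre[OF N0]] first_degree[OF N0] m_0 by (simp add: one_enat_def)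
  show "?m n \<in> poly_exts (w \<circ> \<iota>)" "?m n \<le> \<mu>" if "enat n < N" for n
    unfolding val[OF that] by (rule cval_poly_exts cval_le)+
  show "?m n < ?m (Suc n)" "deg_val (w \<circ> \<iota>) (?m n) < deg_val (w \<circ> \<iota>) (?m (Suc n))" if Sn: "enat (Suc n) < N" for n
  proof -
    have n: "enat n < N" using Sn by (rule pred)
    have m: "m n < m (Suc n)" by (rule m_less[OF Sn]) simp
    have "L (first n) < L (first (Suc n))"
      using m first_degree[OF n] first_degree[OF Sn]
      by (intro centre_less first_centre[OF n] first_centre[OF Sn]) simp
    then show "?m n < ?m (Suc n)" unfolding val[OF n] val[OF Sn] by (rule cval_less)
    show "deg_val (w \<circ> \<iota>) (?m n) < deg_val (w \<circ> \<iota>) (?m (Suc n))"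
      unfolding val[OF n] val[OF Sn] using m first_degree[OF n] first_degree[OF Sn]
      by (simp add: deg_val_cval first_centre[OF n] first_centre[OF Sn])
  qed
  show "\<exists>\<phi> \<gamma>. (\<forall>n. enat (Suc n) < N \<longrightarrow>
           ordinary_augmentation (?m n) (\<phi> (Suc n)) (\<gamma> (Suc n)) (?m (Suc n)) \<or>
           (\<exists>C. const_deg_family (w \<circ> \<iota>) (?m n) C \<and> limit_augmentation C (\<phi> (Suc n)) (\<gamma> (Suc n)) (?m (Suc n)))) \<and>
        (\<forall>n\<ge>1. enat n < N \<and> ?m n < \<mu> \<longrightarrow> \<phi> n \<notin> tangent (?m n) \<mu>)"
  proof (intro exI conjI allI impI)
    let ?\<phi> = "\<lambda>n. mp (first n)" and ?\<gamma> = "\<lambda>n. fin_val (cval (first n) (mp (first n)))"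
    fix n assume Sn: "enat (Suc n) < N"
    have n: "enat n < N" using Sn by (rule pred)
    show "ordinary_augmentation (?m n) (?\<phi> (Suc n)) (?\<gamma> (Suc n)) (?m (Suc n)) \<or>
           (\<exists>C. const_deg_family (w \<circ> \<iota>) (?m n) C \<and> limit_augmentation C (?\<phi> (Suc n)) (?\<gamma> (Suc n)) (?m (Suc n)))"
      unfolding val[OF n] val[OF Sn] using chain_step[OF Sn] const_deg_family_centres[OF n] by blast
  next
    \<comment> \<open>The value at this minimal polynomial is already final, because its closest
      root is the centre itself; so it cannot be tangent.\<close>
    fix n assume "enat n < N \<and> ?m n < \<mu>"
    then have n: "enat n < N" by simp
    show "mp (first n) \<notin> tangent (?m n) \<mu>"
      unfolding val[OF n] tangent_def using centre_min_polynomial[OF first_centre[OF n]] by simp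
  qed
  show "\<exists>r. N = enat (Suc r) \<and> ?m r = \<mu>" if "valuation_transcendental \<mu>"
    using transcendental_case[OF that] val by auto
  show "\<exists>r C. N = enat (Suc r) \<and> const_deg_family (w \<circ> \<iota>) (?m r) C \<and> (\<forall>\<rho>\<in>C. \<rho> < \<mu>) \<and> is_stable_limit \<mu> C"
    if *: "\<not> valuation_transcendental \<mu> \<and> deg_val (w \<circ> \<iota>) \<mu> < \<infinity>"
  proof -
    have alg: "\<not> valuation_transcendental \<mu>" using * by simp
    obtain r where r: "N = enat (Suc r)" "is_stable_limit \<mu> (cval ` centres r)"
      using algebraic_finite_case[OF alg] * by blast
    then have "enat r < N" by simp
    from const_deg_family_centres[OF this] val[OF this] show ?thesis
      using r algebraic_less[OF alg] by (intro exI[of _ r] exI[of _ "cval ` centres r"]) auto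
  qed
  assume *: "\<not> valuation_transcendental \<mu> \<and> deg_val (w \<circ> \<iota>) \<mu> = \<infinity>"
  then show N: "N = \<infinity>" using algebraic_infinite_case by blast
  have eq: "?m n = cval (first n)" for n using N by (intro val) simp
  show "is_stable_limit \<mu> (range ?m)" unfolding eq
    by (rule algebraic_infinite_case[OF *[THEN conjunct1] *[THEN conjunct2], THEN conjunct2])
qed

end

theorem theorem7p2:
  fixes v :: "'k::field \<Rightarrow> 'v::linordered_ab_group_add extended"
    and w :: "'l::alg_closed_field \<Rightarrow> 'v extended"
    and \<iota> :: "'k \<Rightarrow> 'l"
    and \<mu> :: "'k poly \<Rightarrow> 'v extended"
    and \<mu>' :: "'l poly \<Rightarrow> 'v extended"
    and D :: "('l poly \<Rightarrow> 'v extended) set"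
    and N :: enat
    and m :: "nat \<Rightarrow> nat"
    and \<B> :: "nat \<Rightarrow> 'l set set"
    and B :: "nat \<Rightarrow> 'l set"
  assumes "divisible_group TYPE('v)"
    and "algebraic_closure_embedding \<iota>"
    and "valuation v" and "valuation w" and "\<forall>a. w (\<iota> a) = v a"
    and "\<mu> \<in> poly_exts v" and "\<mu>' \<in> poly_exts w" and "restr \<iota> \<mu>' = \<mu>"
    and "\<not> valuation_transcendental \<mu> \<longrightarrow> ball_family w \<iota> \<mu> \<mu>' D"
    and "strict_mono_on {n. enat n < N} m"
    and "m ` {n. enat n < N} = deg_set \<iota> ` opt_balls w \<iota> \<mu> \<mu>' D"
    and "\<forall>n. enat n < N \<longrightarrow>
           (let Opt = {A \<in> opt_balls w \<iota> \<mu> \<mu>' D. deg_set \<iota> A = m n} in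
              \<B> n \<subseteq> Opt \<and>
              well_order_on (\<B> n) (relation_of (\<supseteq>) (\<B> n)) \<and>
              (\<forall>A\<in>Opt. \<exists>A'\<in>\<B> n. A' \<subseteq> A) \<and>
              (\<forall>A\<in>Opt. (\<forall>A'\<in>Opt. A \<subseteq> A') \<longrightarrow> \<B> n = {A}) \<and>
              B n \<in> \<B> n \<and> (\<forall>A\<in>\<B> n. A \<subseteq> B n))"
  shows "MLV_chain v \<mu> N (\<lambda>n. opt_ball_val w \<iota> \<mu> (B n))"
proof -
  interpret valued_closure \<iota> w by unfold_locales (fact assms)+
  let ?F = "if valuation_transcendental \<mu> then {\<mu>'} else D"
  \<comment> \<open>In the valuation-transcendental case \<open>\<mu>'\<close> is itself a ball
    valuation; in the other case a stable limit is attained at each single polynomial.\<close>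
  have F: "(\<forall>\<rho>\<in>?F. \<rho> \<le> \<mu>' \<and> (\<exists>a \<delta>. \<rho> = ball_val w a \<delta>)) \<and> (\<forall>f. \<exists>\<rho>\<in>?F. \<rho> f = \<mu>' f)"
  proof (cases "valuation_transcendental \<mu>")
    case True
    then have "valuation_transcendental (restr \<iota> \<mu>')" using assms(8) by simp
    then obtain a \<delta> where "\<mu>' = ball_val w a \<delta>" by (rule ball_val_if_valuation_transcendental[OF assms(7)])
    then show ?thesis using True by auto
  next
    case False
    then have D: "\<forall>\<rho>\<in>D. \<exists>a \<delta>. \<rho> = ball_val w a \<delta>" and lim: "is_stable_limit \<mu>' D"
      and chain: "Complete_Partial_Order.chain (\<le>) D"
      using assms(9) by (auto simp: ball_family_def increasing_family_def)
    have "\<exists>\<rho>\<in>D. \<rho> f = \<mu>' f" for f using stable_limit_attained[OF chain lim, of f] by auto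
    then show ?thesis using False D stable_limit_ge[OF chain lim] by simp
  qed
  interpret optimal_chain \<iota> w \<mu>' \<mu> ?F D N m \<B> B
    using assms(7,8,10-12) F by unfold_locales blast+
  have "v = w \<circ> \<iota>" using assms(5) by auto
  then show ?thesis using MLV_chain_optimal by simp
qed

end
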